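(* Let $n\ge 1$, let $\Omega\subseteq[-\infty,+\infty]^n$, let $\mathbb{F}$ be any field, and let $X(-)$ and $X'(-)$ be persistence spaces indexed by $\Omega$. (I) Let $\mathcal{K}(-)$ be either any persistence directed simplicial complex on $X(-)$ (where $X(-)$ is arbitrary), or any persistence simplicial complex on $X(-)$, where in this second case $X(-)$ is equipped with a persistence topological embedding into $\mathbb{R}$. Then all of the following inclusions hold (so they form a commutative diagram of inclusions with two rows and four columns): $$\mathrm{Cr}^{H\mathbb{F}}(\mathcal{K}(-))\subseteq\mathrm{GACr}^{H\mathbb{F}}(\mathcal{K}(-))\subseteq \mathrm{CACr}^{H\mathbb{F}}(\mathcal{K}(-))\subseteq \mathrm{AACr}^{H\mathbb{F}}(\mathcal{K}(-)),$$ $$\mathrm{Cr}^{H}(\mathcal{K}(-))\subseteq\mathrm{GACr}^{H}(\mathcal{K}(-))\subseteq \mathrm{CACr}^{H}(\mathcal{K}(-))\subseteq \mathrm{AACr}^{H}(\mathcal{K}(-)),$$ $$\mathrm{Cr}^{H\mathbb{F}}(\mathcal{K}(-))\subseteq \mathrm{Cr}^{H}(\mathcal{K}(-)),\quad \mathrm{GACr}^{H\mathbb{F}}(\mathcal{K}(-))\subseteq \mathrm{GACr}^{H}(\mathcal{K}(-)),$$ $$\mathrm{CACr}^{H\mathbb{F}}(\mathcal{K}(-))\subseteq \mathrm{CACr}^{H}(\mathcal{K}(-)),\quad \mathrm{AACr}^{H\mathbb{F}}(\mathcal{K}(-))\subseteq \mathrm{AACr}^{H}(\mathcal{K}(-)).$$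 (II) Let $f:\mathcal{K}(-)\to\mathcal{K}'(-)$ be either any persistence directed simplicial map from a persistence directed simplicial complex on $X(-)$ to a persistence directed simplicial complex on $X'(-)$ (with $X(-)$, $X'(-)$ arbitrary), or any persistence injective simplicial map from a persistence simplicial complex on $X(-)$ to a persistence simplicial complex on $X'(-)$, where in this second case each of $X(-)$ and $X'(-)$ is equipped with a persistence topological embedding into $\mathbb{R}$. Then all of the following inclusions hold (so they form a commutative square of inclusions): $$\mathrm{GACr}^{H\mathbb{F}}(\mathcal{K}(-))\subseteq \mathrm{GACr}^{H}(\mathcal{K}(-)),$$ $$\mathrm{GACr}^{H\mathbb{F}}(\mathcal{K}'(-))\cup \mathrm{Cr}^{H\mathbb{F}}(f)\subseteq \mathrm{GACr}^{H}(\mathcal{K}'(-))\cup \mathrm{Cr}^{H}(f),$$ $$\mathrm{GACr}^{H\mathbb{F}}(\mathcal{K}(-))\subseteq \mathrm{GACr}^{H\mathbb{F}}(\mathcal{K}'(-))\cup \mathrm{Cr}^{H\mathbb{F}}(f),$$ $$\mathrm{GACr}^{H}(\mathcal{K}(-))\subseteq \mathrm{GACr}^{H}(\mathcal{K}'(-))\cup \mathrm{Cr}^{H}(f).$$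
   Context: Index set. $\Omega\subseteq[-\infty,+\infty]^n$ carries the subspace topology and the coordinatewise order: $\mathbf{s}\le\mathbf{t}$ iff $s_i\le t_i$ for all $i$. Persistence space. A persistence space $X(-)$ is a family of triangulable topological spaces $X(\mathbf{t})$, $\mathbf{t}\in\Omega$, with maps $\varphi(\mathbf{s},\mathbf{t}):X(\mathbf{s})\to X(\mathbf{t})$ for $\mathbf{s}\le\mathbf{t}$ such that $\varphi(\mathbf{t},\mathbf{t})=\mathrm{id}$ and $\varphi(\mathbf{s},\mathbf{t})\circ\varphi(\mathbf{r},\mathbf{s})=\varphi(\mathbf{r},\mathbf{t})$ for $\mathbf{r}\le\mathbf{s}\le\mathbf{t}$. The structure maps of $X'(-)$ are denoted $\varphi'(\mathbf{s},\mathbf{t})$. A persistence topological embedding of $X(-)$ into $\mathbb{R}$ is a family of topological embeddings $e(\mathbf{t}):X(\mathbf{t})\to\mathbb{R}$ with $e(\mathbf{t})\circ\varphi(\mathbf{s},\mathbf{t})=e(\mathbf{s})$ for all $\mathbf{s}\le\mathbf{t}$; it induces a total order $\prec$ on each $X(\mathbf{t})$. Directed simplicial complexes. A directed $k$-hyperedge on a space $X$ is a sequence $(v_0,\dots,v_k)$ of $k+1$ distinct points of $X$ ($k\ge0$). A hyperdigraph on $X$ is a set of directed hyperedges on $X$; it is a directed simplicial complex if it is closed under taking nonempty subsequences. The chain complex $C_\bullet(\vec{\mathcal K})=C_\bullet(\vec{\mathcal K};\mathbb{Z})$ is the graded free abelian group on the elements of $\vec{\mathcal K}$, with $\partial_k(v_0,\dots,v_k)=\sum_{i=0}^k(-1)^i(v_0,\dots,\widehat{v_i},\dots,v_k)$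 for $k\geq 1$ and $\partial_0=0$. A directed simplicial map $\varphi:\vec{\mathcal K}\to\vec{\mathcal K}'$ between directed simplicial complexes on $X$ and $X'$ is given by a map $\varphi:X\to X'$ such that $(\varphi(v_0),\dots,\varphi(v_k))\in\vec{\mathcal K}'$ for every $(v_0,\dots,v_k)\in\vec{\mathcal K}$; by convention it sends distinct vertices to distinct vertices and distinct directed simplices to distinct directed simplices. Simplicial complexes. A $k$-hyperedge on $X$ is a set of $k+1$ distinct points of $X$. A hypergraph on $X$ is a set of hyperedges on $X$; it is a simplicial complex if it is closed under nonempty subsets. If $X$ is totally ordered by $\prec$ through an embedding into $\mathbb{R}$, the chain complex $C_\bullet(\mathcal K)=C_\bullet(\mathcal K;\mathbb{Z})$ of a simplicial complex $\mathcal K$ on $X$ is the graded free abelian group on its simplices with $\partial_k\{v_0,\dots,v_k\}=\sum_{i=0}^k(-1)^i\{v_0,\dots,\widehat{v_i},\dots,v_k\}$ for $v_0\prec\dots\prec v_k$, $k\geq 1$, and $\partial_0=0$. A simplicial map $\varphi:\mathcal K\to\mathcal K'$ is given by a map $\varphi:X\to X'$ sending each simplex of $\mathcal K$ (after removing repeated vertices in the image) to a simplex of $\mathcal K'$; it is injective if it sends distinct vertices of $\mathcal K$ to distinct vertices of $\mathcal K'$ (hence distinct simplices to distinct simplices). Homology. Let $\mathcal K$ be a directed simplicial complex on a space $X$, or a simplicial complex on a space $X$ that is totally ordered by $\prec$ through a topological embedding of $X$ into $\mathbb{R}$. $H_\bullet(\mathcal K)=H_\bullet(C_\bullet(\mathcal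 K))$. For a (directed) simplicial sub-complex $\mathcal A\subseteq\mathcal K$, $H_\bullet(\mathcal K,\mathcal A)=H_\bullet(C_\bullet(\mathcal K)/C_\bullet(\mathcal A))$. For a sub-hyper(di)graph $\mathcal H\subseteq\mathcal K$ (an arbitrary subset of $\mathcal K$), let $\mathbb{Z}(\mathcal H)$ be the graded subgroup of $C_\bullet(\mathcal K)$ generated by the (directed) hyperedges of $\mathcal H$ and let $\mathrm{Inf}(\mathcal H)$ be the largest sub-chain complex of $C_\bullet(\mathcal K)$ contained in $\mathbb{Z}(\mathcal H)$; the relative embedded homology is $H_\bullet(\mathcal K,\mathcal H)=H_\bullet(C_\bullet(\mathcal K)/\mathrm{Inf}(\mathcal H))$. For a sub-chain complex $D\subseteq C_\bullet(\mathcal K)$, $H_\bullet(C_\bullet(\mathcal K),D)=H_\bullet(C_\bullet(\mathcal K)/D)$. With coefficients in a field $\mathbb{F}$, the homology of these chain complexes (respectively quotient chain complexes) tensored with $\mathbb{F}$ over $\mathbb{Z}$ is taken. Persistence objects. A persistence directed simplicial complex (resp. persistence simplicial complex) $\mathcal K(-)$ on $X(-)$ is a family of directed simplicial complexes (resp. simplicial complexes) $\mathcal K(\mathbf{t})$ on $X(\mathbf{t})$ such that the maps $\varphi(\mathbf{s},\mathbf{t})$ induce directed simplicial maps (resp. simplicial maps) $\mathcal K(\mathbf{s})\to\mathcal K(\mathbf{t})$ for $\mathbf{s}\le\mathbf{t}$. These induce chain maps $\varphi(\mathbf{s},\mathbf{t})_\#:C_\bullet(\mathcal K(\mathbf{s}))\to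 C_\bullet(\mathcal K(\mathbf{t}))$ and homomorphisms $\varphi(\mathbf{s},\mathbf{t})_*$ on (relative) homology. A persistence directed simplicial map (resp. persistence (injective) simplicial map) $f:\mathcal K(-)\to\mathcal K'(-)$ is a family of directed simplicial maps (resp. (injective) simplicial maps) $f(\mathbf{t}):\mathcal K(\mathbf{t})\to\mathcal K'(\mathbf{t})$ with $\varphi'(\mathbf{s},\mathbf{t})\circ f(\mathbf{s})=f(\mathbf{t})\circ\varphi(\mathbf{s},\mathbf{t})$ for all $\mathbf{s}\le\mathbf{t}$. Critical points. Let $\mathbf{t}\in\Omega$. (1) $\mathbf{t}$ is a homological regular point of $\mathcal K(-)$ if there is an open neighborhood $U$ of $\mathbf{t}$ in $\Omega$ such that for all $\mathbf{r}\le\mathbf{s}$ in $U$, $\varphi(\mathbf{r},\mathbf{s})_*:H_\bullet(\mathcal K(\mathbf{r}))\to H_\bullet(\mathcal K(\mathbf{s}))$ is an isomorphism. (2) $\mathbf{t}$ is a geometric-absolute homological regular point if there is an open neighborhood $U$ of $\mathbf{t}$ in $\Omega$ such that for all $\mathbf{r}\le\mathbf{s}$ in $U$ and every (directed) simplicial sub-complex $\mathcal A(\mathbf{r})$ of $\mathcal K(\mathbf{r})$, $\varphi(\mathbf{r},\mathbf{s})_*:H_\bullet(\mathcal K(\mathbf{r}),\mathcal A(\mathbf{r}))\to H_\bullet(\mathcal K(\mathbf{s}),\mathcal A(\mathbf{s}))$ is an isomorphism, where $\mathcal A(\mathbf{s})=\varphi(\mathbf{r},\mathbf{s})(\mathcal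 A(\mathbf{r}))$. (3) $\mathbf{t}$ is a combinatorial-absolute homological regular point if there is an open neighborhood $U$ of $\mathbf{t}$ in $\Omega$ such that for all $\mathbf{r}\le\mathbf{s}$ in $U$ and every sub-hyper(di)graph $\mathcal H(\mathbf{r})$ of $\mathcal K(\mathbf{r})$, $\varphi(\mathbf{r},\mathbf{s})_*:H_\bullet(\mathcal K(\mathbf{r}),\mathcal H(\mathbf{r}))\to H_\bullet(\mathcal K(\mathbf{s}),\mathcal H(\mathbf{s}))$ is an isomorphism of relative embedded homology, where $\mathcal H(\mathbf{s})=\varphi(\mathbf{r},\mathbf{s})(\mathcal H(\mathbf{r}))$. (Here sub-hyperdigraphs are used for directed simplicial complexes and sub-hypergraphs for simplicial complexes.) (4) $\mathbf{t}$ is an algebraic-absolute homological regular point if there is an open neighborhood $U$ of $\mathbf{t}$ in $\Omega$ such that for all $\mathbf{r}\le\mathbf{s}$ in $U$ and every sub-chain complex $D(\mathbf{r})$ of $C_\bullet(\mathcal K(\mathbf{r}))$, $\varphi(\mathbf{r},\mathbf{s})_*:H_\bullet(C_\bullet(\mathcal K(\mathbf{r})),D(\mathbf{r}))\to H_\bullet(C_\bullet(\mathcal K(\mathbf{s})),D(\mathbf{s}))$ is an isomorphism, where $D(\mathbf{s})=\varphi(\mathbf{r},\mathbf{s})_\#(D(\mathbf{r}))$. (5) $\mathbf{t}$ is a homological regular point of $f:\mathcal K(-)\to\mathcal K'(-)$ if there is an open neighborhood $U$ of $\mathbf{t}$ in $\Omega$ such that for all $\mathbf{r}\le\mathbf{s}$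 in $U$, $\varphi'(\mathbf{r},\mathbf{s})_*:H_\bullet(\mathcal K'(\mathbf{r}),f(\mathbf{r})(\mathcal K(\mathbf{r})))\to H_\bullet(\mathcal K'(\mathbf{s}),f(\mathbf{s})(\mathcal K(\mathbf{s})))$ is an isomorphism. In each case a critical point of the given type is a point of $\Omega$ that is not regular of that type. The sets of critical points of types (1)–(5) are denoted $\mathrm{Cr}^H(\mathcal K(-))$, $\mathrm{GACr}^H(\mathcal K(-))$, $\mathrm{CACr}^H(\mathcal K(-))$, $\mathrm{AACr}^H(\mathcal K(-))$, $\mathrm{Cr}^H(f)$ for integer coefficients, and $\mathrm{Cr}^{H\mathbb{F}}$, $\mathrm{GACr}^{H\mathbb{F}}$, $\mathrm{CACr}^{H\mathbb{F}}$, $\mathrm{AACr}^{H\mathbb{F}}$, $\mathrm{Cr}^{H\mathbb{F}}(f)$ when the coefficients of all the homology groups are taken from $\mathbb{F}$. *)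

theory Defs
  imports
    "HOL-Analysis.Analysis"
    "HOL-Algebra.Free_Abelian_Groups"
    "HOL-Library.Sublist"
begin

section \<open>Chain complexes, quotients, homology, tensor products\<close>

text \<open>
  Chain complexes of abelian groups in degrees \<open>k \<ge> 0\<close>.  \<open>bd C k\<close> is the boundary map from
  degree \<open>k\<close> to degree \<open>k - 1\<close>.  As \<open>0 - 1 = 0\<close> on \<open>nat\<close>, \<open>bd C 0\<close> formally maps degree \<open>0\<close> to
  itself; it is the zero map in all complexes below.
\<close>

record 'c chain_complex =
  grp :: "nat \<Rightarrow> 'c monoid"
  bd :: "nat \<Rightarrow> 'c \<Rightarrow> 'c"

text \<open>
  For a homomorphism \<open>h\<close> from \<open>G\<close> to \<open>G'\<close> that maps a normal subgroup \<open>N\<close> of \<open>G\<close> into \<open>N'\<close>,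
  the induced homomorphism \<open>G Mod N \<rightarrow> G' Mod N'\<close>: the coset of \<open>x\<close>
  is sent to the coset of \<open>h x\<close>.
\<close>

definition quot_map :: "'d monoid \<Rightarrow> 'd set \<Rightarrow> ('c \<Rightarrow> 'd) \<Rightarrow> 'c set \<Rightarrow> 'd set" where
  "quot_map G' N' h c = N' <#>\<^bsub>G'\<^esub> (h ` c)"

definition sub_chain_complex :: "'c chain_complex \<Rightarrow> (nat \<Rightarrow> 'c set) \<Rightarrow> bool" where
  "sub_chain_complex C D \<longleftrightarrow>
     (\<forall>k. subgroup (D k) (grp C k)) \<and> (\<forall>k. bd C k ` D k \<subseteq> D (k - 1))"

definition quotient_complex ::
    "'c chain_complex \<Rightarrow> (nat \<Rightarrow> 'c set) \<Rightarrow> 'c set chain_complex" where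
  "quotient_complex C D =
     \<lparr> grp = \<lambda>k. grp C k Mod D k,
       bd = \<lambda>k. quot_map (grp C (k - 1)) (D (k - 1)) (bd C k) \<rparr>"

definition largest_sub_chain_complex ::
    "'c chain_complex \<Rightarrow> (nat \<Rightarrow> 'c set) \<Rightarrow> nat \<Rightarrow> 'c set" where
  "largest_sub_chain_complex C Z = (GREATEST D. sub_chain_complex C D \<and> D \<le> Z)"

definition boundaries :: "'c chain_complex \<Rightarrow> nat \<Rightarrow> 'c set" where
  "boundaries C k = bd C (Suc k) ` carrier (grp C (Suc k))"

definition homology :: "'c chain_complex \<Rightarrow> nat \<Rightarrow> 'c set monoid" where
  "homology C k =
     (grp C k)\<lparr>carrier := kernel (grp C k) (grp C (k - 1)) (bd C k)\<rparr> Mod boundaries C k"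

definition homology_map ::
    "'d chain_complex \<Rightarrow> (nat \<Rightarrow> 'c \<Rightarrow> 'd) \<Rightarrow> nat \<Rightarrow> 'c set \<Rightarrow> 'd set" where
  "homology_map C' h k = quot_map (grp C' k) (boundaries C' k) (h k)"

definition tensor_relations ::
    "'a monoid \<Rightarrow> 'b monoid \<Rightarrow> ('a \<times> 'b \<Rightarrow>\<^sub>0 int) set" where
  "tensor_relations A B =
     generate (free_Abelian_group (carrier A \<times> carrier B))
       ({frag_of (a \<otimes>\<^bsub>A\<^esub> a', b) - frag_of (a, b) - frag_of (a', b) | a a' b.
           a \<in> carrier A \<and> a' \<in> carrier A \<and> b \<in> carrier B} \<union>
        {frag_of (a, b \<otimes>\<^bsub>B\<^esub> b') - frag_of (a, b) - frag_of (a, b') | a b b'.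
           a \<in> carrier A \<and> b \<in> carrier B \<and> b' \<in> carrier B})"

definition tensor :: "'a monoid \<Rightarrow> 'b monoid \<Rightarrow> ('a \<times> 'b \<Rightarrow>\<^sub>0 int) set monoid" where
  "tensor A B = free_Abelian_group (carrier A \<times> carrier B) Mod tensor_relations A B"

text \<open>The homomorphism \<open>h \<otimes> id\<close> from \<open>A \<otimes> B\<close> to \<open>A' \<otimes> B\<close>.\<close>

definition tensor_map ::
    "'c monoid \<Rightarrow> 'b monoid \<Rightarrow> ('a \<Rightarrow> 'c) \<Rightarrow>
     ('a \<times> 'b \<Rightarrow>\<^sub>0 int) set \<Rightarrow> ('c \<times> 'b \<Rightarrow>\<^sub>0 int) set" where
  "tensor_map A' B h =
     quot_map (free_Abelian_group (carrier A' \<times> carrier B)) (tensor_relations A' B)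
       (frag_extend (\<lambda>(a, b). frag_of (h a, b)))"

definition tensor_complex ::
    "'c chain_complex \<Rightarrow> 'b monoid \<Rightarrow> ('c \<times> 'b \<Rightarrow>\<^sub>0 int) set chain_complex" where
  "tensor_complex C B =
     \<lparr> grp = \<lambda>k. tensor (grp C k) B,
       bd = \<lambda>k. tensor_map (grp C (k - 1)) B (bd C k) \<rparr>"

definition field_group :: "'f::field monoid" where
  "field_group = \<lparr>carrier = UNIV, monoid.mult = (+), one = 0\<rparr>"

text \<open>
  The coefficients are either the integers or the field given by the type \<open>'f\<close>.
\<close>

datatype 'f coefficients = Integer_coeffs | Field_coeffs

text \<open>
  \<open>homology_iso c C C' h\<close>: the chain map \<open>h\<close> from \<open>C\<close> to \<open>C'\<close> induces an isomorphism of homology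
  with coefficients \<open>c\<close> in every degree.  For field coefficients the induced map is linear, so that
  being an isomorphism does not depend on whether one regards it as a map of
  vector spaces or of abelian groups.
\<close>

fun homology_iso ::
    "'f::field coefficients \<Rightarrow> 'c chain_complex \<Rightarrow> 'd chain_complex \<Rightarrow>
     (nat \<Rightarrow> 'c \<Rightarrow> 'd) \<Rightarrow> bool" where
  "homology_iso Integer_coeffs C C' h \<longleftrightarrow>
     (\<forall>k. homology_map C' h k \<in> iso (homology C k) (homology C' k))"
| "homology_iso (Field_coeffs :: 'f coefficients) C C' h \<longleftrightarrow>
     (let B = (field_group :: 'f monoid); T = tensor_complex C B; T' = tensor_complex C' B in
      \<forall>k. homology_map T' (\<lambda>j. tensor_map (grp C' j) B (h j)) k
            \<in> iso (homology T k) (homology T' k))"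


section \<open>Hyperdigraphs, hypergraphs and their complexes\<close>

definition hyperdigraph :: "'a set \<Rightarrow> 'a list set \<Rightarrow> bool" where
  "hyperdigraph V K \<longleftrightarrow> (\<forall>\<sigma>\<in>K. \<sigma> \<noteq> [] \<and> distinct \<sigma> \<and> set \<sigma> \<subseteq> V)"

definition directed_simplicial_complex :: "'a set \<Rightarrow> 'a list set \<Rightarrow> bool" where
  "directed_simplicial_complex V K \<longleftrightarrow>
     hyperdigraph V K \<and> (\<forall>\<sigma>\<in>K. \<forall>\<tau>. \<tau> \<noteq> [] \<and> subseq \<tau> \<sigma> \<longrightarrow> \<tau> \<in> K)"

definition directed_simplicial_map ::
    "'a set \<Rightarrow> 'b set \<Rightarrow> 'a list set \<Rightarrow> 'b list set \<Rightarrow> ('a \<Rightarrow> 'b) \<Rightarrow> bool" where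
  "directed_simplicial_map V V' K K' f \<longleftrightarrow>
     f \<in> V \<rightarrow> V' \<and> (\<forall>\<sigma>\<in>K. map f \<sigma> \<in> K') \<and>
     inj_on f {v. [v] \<in> K} \<and> inj_on (map f) K"

definition hypergraph :: "'a set \<Rightarrow> 'a set set \<Rightarrow> bool" where
  "hypergraph V K \<longleftrightarrow> (\<forall>\<sigma>\<in>K. finite \<sigma> \<and> \<sigma> \<noteq> {} \<and> \<sigma> \<subseteq> V)"

definition abstract_simplicial_complex :: "'a set \<Rightarrow> 'a set set \<Rightarrow> bool" where
  "abstract_simplicial_complex V K \<longleftrightarrow>
     hypergraph V K \<and> (\<forall>\<sigma>\<in>K. \<forall>\<tau>. \<tau> \<noteq> {} \<and> \<tau> \<subseteq> \<sigma> \<longrightarrow> \<tau> \<in> K)"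

definition simplicial_map ::
    "'a set \<Rightarrow> 'b set \<Rightarrow> 'a set set \<Rightarrow> 'b set set \<Rightarrow> ('a \<Rightarrow> 'b) \<Rightarrow> bool" where
  "simplicial_map V V' K K' f \<longleftrightarrow> f \<in> V \<rightarrow> V' \<and> (\<forall>\<sigma>\<in>K. f ` \<sigma> \<in> K')"

definition injective_simplicial_map ::
    "'a set \<Rightarrow> 'b set \<Rightarrow> 'a set set \<Rightarrow> 'b set set \<Rightarrow> ('a \<Rightarrow> 'b) \<Rightarrow> bool" where
  "injective_simplicial_map V V' K K' f \<longleftrightarrow>
     simplicial_map V V' K K' f \<and> inj_on f {v. {v} \<in> K}"

definition directed_boundary :: "'a list \<Rightarrow> ('a list \<Rightarrow>\<^sub>0 int)" where
  "directed_boundary \<sigma> =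
     (\<Sum>i<length \<sigma>. frag_cmul ((- 1) ^ i) (frag_of (take i \<sigma> @ drop (Suc i) \<sigma>)))"

text \<open>
  The vertices are ordered by the injective function \<open>e\<close>; the vertex \<open>v\<close> is the \<open>i\<close>-th vertex
  of \<open>\<sigma>\<close> (counting from \<open>0\<close>) where \<open>i\<close> is the number of vertices of \<open>\<sigma>\<close> that precede it.
\<close>

definition ordered_boundary :: "('a \<Rightarrow> real) \<Rightarrow> 'a set \<Rightarrow> ('a set \<Rightarrow>\<^sub>0 int)" where
  "ordered_boundary e \<sigma> =
     (\<Sum>v\<in>\<sigma>. frag_cmul ((- 1) ^ card {w \<in> \<sigma>. e w < e v}) (frag_of (\<sigma> - {v})))"


section \<open>Triangulable spaces\<close>

definition closed_simplex :: "'a set \<Rightarrow> ('a \<Rightarrow> real) set" where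
  "closed_simplex \<sigma> = {\<alpha>. (\<forall>v. 0 \<le> \<alpha> v) \<and> (\<forall>v. v \<notin> \<sigma> \<longrightarrow> \<alpha> v = 0) \<and> sum \<alpha> \<sigma> = 1}"

text \<open>
  The geometric realization in barycentric coordinates, with the topology that is coherent with the
  closed simplices.  Each of these carries the topology of pointwise convergence,
  which is the Euclidean one as \<open>\<sigma>\<close> is finite.
\<close>

definition geometric_realization :: "'a set set \<Rightarrow> ('a \<Rightarrow> real) topology" where
  "geometric_realization K = topology (\<lambda>U. U \<subseteq> \<Union> (closed_simplex ` K) \<and>
     (\<forall>\<sigma>\<in>K. openin (top_of_set (closed_simplex \<sigma>)) (U \<inter> closed_simplex \<sigma>)))"

lemma openin_geometric_realization:
  "openin (geometric_realization K) U \<longleftrightarrow> U \<subseteq> \<Union> (closed_simplex ` K) \<and>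
     (\<forall>\<sigma>\<in>K. openin (top_of_set (closed_simplex \<sigma>)) (U \<inter> closed_simplex \<sigma>))"
proof -
  have "istopology (\<lambda>U. U \<subseteq> \<Union> (closed_simplex ` K) \<and>
     (\<forall>\<sigma>\<in>K. openin (top_of_set (closed_simplex \<sigma>)) (U \<inter> closed_simplex \<sigma>)))"
    unfolding istopology_def
  proof (rule conjI; intro allI impI)
    fix S T
    assume S: "S \<subseteq> \<Union> (closed_simplex ` K) \<and>
        (\<forall>\<sigma>\<in>K. openin (top_of_set (closed_simplex \<sigma>)) (S \<inter> closed_simplex \<sigma>))"
      and T: "T \<subseteq> \<Union> (closed_simplex ` K) \<and>
        (\<forall>\<sigma>\<in>K. openin (top_of_set (closed_simplex \<sigma>)) (T \<inter> closed_simplex \<sigma>))"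
    have "openin (top_of_set (closed_simplex \<sigma>)) (S \<inter> T \<inter> closed_simplex \<sigma>)" if "\<sigma> \<in> K" for \<sigma>
    proof -
      have "S \<inter> T \<inter> closed_simplex \<sigma> = (S \<inter> closed_simplex \<sigma>) \<inter> (T \<inter> closed_simplex \<sigma>)"
        by blast
      with S T that show ?thesis
        by (simp only: openin_Int)
    qed
    with S show "S \<inter> T \<subseteq> \<Union> (closed_simplex ` K) \<and>
        (\<forall>\<sigma>\<in>K. openin (top_of_set (closed_simplex \<sigma>)) (S \<inter> T \<inter> closed_simplex \<sigma>))"
      by blast
  next
    fix \<U>
    assume U: "\<forall>S\<in>\<U>. S \<subseteq> \<Union> (closed_simplex ` K) \<and>
        (\<forall>\<sigma>\<in>K. openin (top_of_set (closed_simplex \<sigma>)) (S \<inter> closed_simplex \<sigma>))"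
    have "openin (top_of_set (closed_simplex \<sigma>)) (\<Union>\<U> \<inter> closed_simplex \<sigma>)" if "\<sigma> \<in> K" for \<sigma>
    proof -
      have "openin (top_of_set (closed_simplex \<sigma>)) (\<Union> ((\<lambda>S. S \<inter> closed_simplex \<sigma>) ` \<U>))"
        by (rule openin_Union) (use U that in auto)
      moreover have "\<Union>\<U> \<inter> closed_simplex \<sigma> = \<Union> ((\<lambda>S. S \<inter> closed_simplex \<sigma>) ` \<U>)"
        by blast
      ultimately show ?thesis
        by (simp only:)
    qed
    with U show "\<Union>\<U> \<subseteq> \<Union> (closed_simplex ` K) \<and>
        (\<forall>\<sigma>\<in>K. openin (top_of_set (closed_simplex \<sigma>)) (\<Union>\<U> \<inter> closed_simplex \<sigma>))"
      by blast
  qed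
  then show ?thesis
    by (simp add: geometric_realization_def)
qed

text \<open>
  The vertices of the triangulating complex may be taken in the type of the points of the space,
  since the vertices of a triangulation correspond to distinct points.
\<close>

definition triangulable :: "'a topology \<Rightarrow> bool" where
  "triangulable X \<longleftrightarrow>
     (\<exists>K :: 'a set set. abstract_simplicial_complex UNIV K \<and>
        X homeomorphic_space geometric_realization K)"


section \<open>Persistence objects\<close>

definition persistence_space ::
    "'i::order set \<Rightarrow> ('i \<Rightarrow> 'a topology) \<Rightarrow> ('i \<Rightarrow> 'i \<Rightarrow> 'a \<Rightarrow> 'a) \<Rightarrow> bool" where
  "persistence_space \<Omega> X \<phi> \<longleftrightarrow>
     (\<forall>t\<in>\<Omega>. triangulable (X t)) \<and>
     (\<forall>s\<in>\<Omega>. \<forall>t\<in>\<Omega>. s \<le> t \<longrightarrow> \<phi> s t \<in> topspace (X s) \<rightarrow> topspace (X t)) \<and>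
     (\<forall>t\<in>\<Omega>. \<forall>x\<in>topspace (X t). \<phi> t t x = x) \<and>
     (\<forall>r\<in>\<Omega>. \<forall>s\<in>\<Omega>. \<forall>t\<in>\<Omega>. r \<le> s \<and> s \<le> t \<longrightarrow>
        (\<forall>x\<in>topspace (X r). \<phi> s t (\<phi> r s x) = \<phi> r t x))"

definition persistence_embedding ::
    "'i::order set \<Rightarrow> ('i \<Rightarrow> 'a topology) \<Rightarrow> ('i \<Rightarrow> 'i \<Rightarrow> 'a \<Rightarrow> 'a) \<Rightarrow>
     ('i \<Rightarrow> 'a \<Rightarrow> real) \<Rightarrow> bool" where
  "persistence_embedding \<Omega> X \<phi> e \<longleftrightarrow>
     (\<forall>t\<in>\<Omega>. embedding_map (X t) euclideanreal (e t)) \<and>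
     (\<forall>s\<in>\<Omega>. \<forall>t\<in>\<Omega>. s \<le> t \<longrightarrow> (\<forall>x\<in>topspace (X s). e t (\<phi> s t x) = e s x))"

definition persistence_directed_complex ::
    "'i::order set \<Rightarrow> ('i \<Rightarrow> 'a topology) \<Rightarrow> ('i \<Rightarrow> 'i \<Rightarrow> 'a \<Rightarrow> 'a) \<Rightarrow>
     ('i \<Rightarrow> 'a list set) \<Rightarrow> bool" where
  "persistence_directed_complex \<Omega> X \<phi> K \<longleftrightarrow>
     (\<forall>t\<in>\<Omega>. directed_simplicial_complex (topspace (X t)) (K t)) \<and>
     (\<forall>s\<in>\<Omega>. \<forall>t\<in>\<Omega>. s \<le> t \<longrightarrow>
        directed_simplicial_map (topspace (X s)) (topspace (X t)) (K s) (K t) (\<phi> s t))"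

definition persistence_simplicial_complex ::
    "'i::order set \<Rightarrow> ('i \<Rightarrow> 'a topology) \<Rightarrow> ('i \<Rightarrow> 'i \<Rightarrow> 'a \<Rightarrow> 'a) \<Rightarrow>
     ('i \<Rightarrow> 'a set set) \<Rightarrow> bool" where
  "persistence_simplicial_complex \<Omega> X \<phi> K \<longleftrightarrow>
     (\<forall>t\<in>\<Omega>. abstract_simplicial_complex (topspace (X t)) (K t)) \<and>
     (\<forall>s\<in>\<Omega>. \<forall>t\<in>\<Omega>. s \<le> t \<longrightarrow>
        simplicial_map (topspace (X s)) (topspace (X t)) (K s) (K t) (\<phi> s t))"

text \<open>
  The naturality condition of a persistence (directed) simplicial map is an equality of maps
  from \<open>K s\<close> to \<open>K' t\<close>, that is, an equality on the vertices of \<open>K s\<close>.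
\<close>

definition persistence_directed_map ::
    "'i::order set \<Rightarrow> ('i \<Rightarrow> 'a topology) \<Rightarrow> ('i \<Rightarrow> 'i \<Rightarrow> 'a \<Rightarrow> 'a) \<Rightarrow> ('i \<Rightarrow> 'a list set) \<Rightarrow>
     ('i \<Rightarrow> 'b topology) \<Rightarrow> ('i \<Rightarrow> 'i \<Rightarrow> 'b \<Rightarrow> 'b) \<Rightarrow> ('i \<Rightarrow> 'b list set) \<Rightarrow>
     ('i \<Rightarrow> 'a \<Rightarrow> 'b) \<Rightarrow> bool" where
  "persistence_directed_map \<Omega> X \<phi> K X' \<phi>' K' f \<longleftrightarrow>
     (\<forall>t\<in>\<Omega>. directed_simplicial_map (topspace (X t)) (topspace (X' t)) (K t) (K' t) (f t)) \<and>
     (\<forall>s\<in>\<Omega>. \<forall>t\<in>\<Omega>. s \<le> t \<longrightarrow> (\<forall>v. [v] \<in> K s \<longrightarrow> \<phi>' s t (f s v) = f t (\<phi> s t v)))"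

definition persistence_injective_simplicial_map ::
    "'i::order set \<Rightarrow> ('i \<Rightarrow> 'a topology) \<Rightarrow> ('i \<Rightarrow> 'i \<Rightarrow> 'a \<Rightarrow> 'a) \<Rightarrow> ('i \<Rightarrow> 'a set set) \<Rightarrow>
     ('i \<Rightarrow> 'b topology) \<Rightarrow> ('i \<Rightarrow> 'i \<Rightarrow> 'b \<Rightarrow> 'b) \<Rightarrow> ('i \<Rightarrow> 'b set set) \<Rightarrow>
     ('i \<Rightarrow> 'a \<Rightarrow> 'b) \<Rightarrow> bool" where
  "persistence_injective_simplicial_map \<Omega> X \<phi> K X' \<phi>' K' f \<longleftrightarrow>
     (\<forall>t\<in>\<Omega>. injective_simplicial_map (topspace (X t)) (topspace (X' t)) (K t) (K' t) (f t)) \<and>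
     (\<forall>s\<in>\<Omega>. \<forall>t\<in>\<Omega>. s \<le> t \<longrightarrow> (\<forall>v. {v} \<in> K s \<longrightarrow> \<phi>' s t (f s v) = f t (\<phi> s t v)))"


section \<open>Critical points\<close>

text \<open>
  The data through which directed simplicial complexes (simplices are lists) and simplicial
  complexes (simplices are sets) enter the definitions of the critical points: the simplices of
  \<open>K t\<close>, their dimensions, their boundaries in positive dimension, the action of the structure
  maps on simplices, and which sets of simplices are complexes on \<open>X t\<close>.
\<close>

record ('i, 's) persistence_system =
  simplices :: "'i \<Rightarrow> 's set"
  dimn :: "'s \<Rightarrow> nat"
  face_sum :: "'i \<Rightarrow> 's \<Rightarrow> ('s \<Rightarrow>\<^sub>0 int)"
  transition :: "'i \<Rightarrow> 'i \<Rightarrow> 's \<Rightarrow> 's"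
  is_complex :: "'i \<Rightarrow> 's set \<Rightarrow> bool"

definition directed_system ::
    "('i \<Rightarrow> 'a topology) \<Rightarrow> ('i \<Rightarrow> 'i \<Rightarrow> 'a \<Rightarrow> 'a) \<Rightarrow> ('i \<Rightarrow> 'a list set) \<Rightarrow>
     ('i, 'a list) persistence_system" where
  "directed_system X \<phi> K =
     \<lparr> simplices = K, dimn = \<lambda>\<sigma>. length \<sigma> - 1, face_sum = \<lambda>t. directed_boundary,
       transition = \<lambda>s t. map (\<phi> s t),
       is_complex = \<lambda>t. directed_simplicial_complex (topspace (X t)) \<rparr>"

text \<open>
  Since \<open>e t (\<phi> s t x) = e s x\<close> and the maps \<open>e s\<close> are injective, the structure maps are injective and
  preserve the vertex orders, so that the chain map induced by \<open>\<phi> s t\<close> sends a simplex to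
  its image, without signs or degenerate cases.
\<close>

definition simplicial_system ::
    "('i \<Rightarrow> 'a topology) \<Rightarrow> ('i \<Rightarrow> 'i \<Rightarrow> 'a \<Rightarrow> 'a) \<Rightarrow> ('i \<Rightarrow> 'a \<Rightarrow> real) \<Rightarrow> ('i \<Rightarrow> 'a set set) \<Rightarrow>
     ('i, 'a set) persistence_system" where
  "simplicial_system X \<phi> e K =
     \<lparr> simplices = K, dimn = \<lambda>\<sigma>. card \<sigma> - 1, face_sum = \<lambda>t. ordered_boundary (e t),
       transition = \<lambda>s t. image (\<phi> s t),
       is_complex = \<lambda>t. abstract_simplicial_complex (topspace (X t)) \<rparr>"

definition chains :: "('i, 's) persistence_system \<Rightarrow> 'i \<Rightarrow> ('s \<Rightarrow>\<^sub>0 int) chain_complex" where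
  "chains S t =
     \<lparr> grp = \<lambda>k. free_Abelian_group {\<sigma> \<in> simplices S t. dimn S \<sigma> = k},
       bd = \<lambda>k. if k = 0 then (\<lambda>_. 0) else frag_extend (face_sum S t) \<rparr>"

definition chain_map ::
    "('i, 's) persistence_system \<Rightarrow> 'i \<Rightarrow> 'i \<Rightarrow> nat \<Rightarrow> ('s \<Rightarrow>\<^sub>0 int) \<Rightarrow> ('s \<Rightarrow>\<^sub>0 int)" where
  "chain_map S s t k = frag_extend (\<lambda>\<sigma>. frag_of (transition S s t \<sigma>))"

text \<open>
  The graded subgroup of the chains that is generated by a set \<open>H\<close> of simplices.  If \<open>H\<close> is a
  subcomplex, this is the chain complex of \<open>H\<close>.
\<close>

definition graded_span ::
    "('i, 's) persistence_system \<Rightarrow> 's set \<Rightarrow> nat \<Rightarrow> ('s \<Rightarrow>\<^sub>0 int) set" where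
  "graded_span S H k = carrier (free_Abelian_group {\<sigma> \<in> H. dimn S \<sigma> = k})"

definition Inf_complex ::
    "('i, 's) persistence_system \<Rightarrow> 'i \<Rightarrow> 's set \<Rightarrow> nat \<Rightarrow> ('s \<Rightarrow>\<^sub>0 int) set" where
  "Inf_complex S t H = largest_sub_chain_complex (chains S t) (graded_span S H)"

definition absolute_iso ::
    "'f::field coefficients \<Rightarrow> ('i, 's) persistence_system \<Rightarrow> 'i \<Rightarrow> 'i \<Rightarrow> bool" where
  "absolute_iso c S r s \<longleftrightarrow> homology_iso c (chains S r) (chains S s) (chain_map S r s)"

text \<open>
  The structure map from \<open>r\<close> to \<open>s\<close> induces an isomorphism of homology relative to the
  sub-chain complexes \<open>D\<close> and \<open>D'\<close>.
\<close>

definition relative_iso ::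
    "'f::field coefficients \<Rightarrow> ('i, 's) persistence_system \<Rightarrow> 'i \<Rightarrow> 'i \<Rightarrow>
     (nat \<Rightarrow> ('s \<Rightarrow>\<^sub>0 int) set) \<Rightarrow> (nat \<Rightarrow> ('s \<Rightarrow>\<^sub>0 int) set) \<Rightarrow> bool" where
  "relative_iso c S r s D D' \<longleftrightarrow>
     homology_iso c (quotient_complex (chains S r) D) (quotient_complex (chains S s) D')
       (\<lambda>k. quot_map (grp (chains S s) k) (D' k) (chain_map S r s k))"

text \<open>
  The points of \<open>\<Omega>\<close> without an open neighbourhood \<open>U\<close> in \<open>\<Omega>\<close> such that \<open>P r s\<close> holds
  for all \<open>r \<le> s\<close> in \<open>U\<close>.
\<close>

definition critical_points ::
    "'i::{topological_space,order} set \<Rightarrow> ('i \<Rightarrow> 'i \<Rightarrow> bool) \<Rightarrow> 'i set" where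
  "critical_points \<Omega> P =
     {t \<in> \<Omega>. \<not> (\<exists>U. openin (top_of_set \<Omega>) U \<and> t \<in> U \<and>
                   (\<forall>r\<in>U. \<forall>s\<in>U. r \<le> s \<longrightarrow> P r s))}"

definition Cr ::
    "'f::field coefficients \<Rightarrow> 'i::{topological_space,order} set \<Rightarrow>
     ('i, 's) persistence_system \<Rightarrow> 'i set" where
  "Cr c \<Omega> S = critical_points \<Omega> (absolute_iso c S)"

definition GACr ::
    "'f::field coefficients \<Rightarrow> 'i::{topological_space,order} set \<Rightarrow>
     ('i, 's) persistence_system \<Rightarrow> 'i set" where
  "GACr c \<Omega> S = critical_points \<Omega> (\<lambda>r s.
     \<forall>A. A \<subseteq> simplices S r \<and> is_complex S r A \<longrightarrow>
       relative_iso c S r s (graded_span S A) (graded_span S (transition S r s ` A)))"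

definition CACr ::
    "'f::field coefficients \<Rightarrow> 'i::{topological_space,order} set \<Rightarrow>
     ('i, 's) persistence_system \<Rightarrow> 'i set" where
  "CACr c \<Omega> S = critical_points \<Omega> (\<lambda>r s.
     \<forall>H. H \<subseteq> simplices S r \<longrightarrow>
       relative_iso c S r s (Inf_complex S r H) (Inf_complex S s (transition S r s ` H)))"

definition AACr ::
    "'f::field coefficients \<Rightarrow> 'i::{topological_space,order} set \<Rightarrow>
     ('i, 's) persistence_system \<Rightarrow> 'i set" where
  "AACr c \<Omega> S = critical_points \<Omega> (\<lambda>r s.
     \<forall>D. sub_chain_complex (chains S r) D \<longrightarrow>
       relative_iso c S r s D (\<lambda>k. chain_map S r s k ` D k))"

text \<open>
  The critical points of a persistence map from \<open>S\<close> to \<open>S'\<close> that acts on simplices by \<open>F\<close>.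
\<close>

definition Cr_map ::
    "'f::field coefficients \<Rightarrow> 'i::{topological_space,order} set \<Rightarrow>
     ('i, 's) persistence_system \<Rightarrow> ('i, 'u) persistence_system \<Rightarrow> ('i \<Rightarrow> 's \<Rightarrow> 'u) \<Rightarrow> 'i set" where
  "Cr_map c \<Omega> S S' F = critical_points \<Omega> (\<lambda>r s.
     relative_iso c S' r s (graded_span S' (F r ` simplices S r))
       (graded_span S' (F s ` simplices S s)))"

end

theory Submission
  imports Defs
begin

text \<open>
  The structure maps are injective on simplices.  Hence the chain map \<open>\<phi>\<close> from \<open>C = C(K(r))\<close> to
  \<open>C' = C(K(s))\<close> sends basis elements to distinct basis elements, and \<open>Q = C' / \<phi> C\<close> is a
  complex of free groups.  By the long exact sequence, \<open>\<phi>\<close> induces an isomorphism of integral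
  homology if and only if \<open>Q\<close> is acyclic; as \<open>Q\<close> is free and bounded below, it is then contractible.
  A contraction of \<open>Q\<close> turns \<open>C\<close> into a deformation retract of \<open>C'\<close> by a homotopy that vanishes on
  \<open>\<phi> C\<close> (\<open>deformation_retract_of_quasi_iso\<close>).  Such a retraction consists of homomorphisms and
  equations between them.  It therefore survives the passage to the quotients by \<open>D\<close> and \<open>\<phi> D\<close>, for
  every sub-chain complex \<open>D\<close>, and tensoring with the field.  So an integral isomorphism of absolute
  homology yields isomorphisms of all relative homology groups with all coefficients
  (\<open>integral_imp_algebraic\<close>); this gives the inclusions between field and integer coefficients.

  The inclusions for fixed coefficients are specialisations.  The chains of a subcomplex form a
  sub-chain complex and so coincide with its \<open>Inf\<close>; the \<open>Inf\<close> of any set \<open>H\<close> of simplices is a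
  sub-chain complex, and \<open>\<phi>\<close> maps it onto the \<open>Inf\<close> of \<open>\<phi> H\<close> because \<open>\<phi>\<close> is
  injective; and absolute homology is homology relative to the empty subcomplex.

  For a persistence map \<open>f\<close> from \<open>K\<close> to \<open>K'\<close> and a subcomplex \<open>A\<close> of \<open>K\<close>, the triple
  \<open>f A \<subseteq> f K \<subseteq> K'\<close> gives a degreewise split exact sequence of quotient complexes, whose left term is
  isomorphic to \<open>C(K) / C(A)\<close>.  The structure maps act on it, so that the five
  lemma applies.  If the middle and the right map are isomorphisms in homology, then so is the
  left one (\<open>geometric_iso_source\<close>).  For the comparison of the coefficients, integral regularity
  passes in this way from \<open>K'\<close> and \<open>f\<close> to \<open>K\<close>; then \<open>K\<close> and \<open>K'\<close> are regular with field coefficients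
  by the first paragraph, and the right map is an isomorphism because the left and the middle one
  are (\<open>map_iso_of_integral\<close>).  A simplicial \<open>f\<close> need not respect the orders of the vertices; it
  induces a chain map once each simplex is given the sign of the permutation that sorts the images
  of its vertices.
\<close>

section \<open>Maps between quotients of abelian groups\<close>

locale pair_hom =
  G: comm_group G + G': comm_group G' + N: subgroup N G + N': subgroup N' G'
  for G :: "'c monoid" and N and G' :: "'d monoid" and N' +
  fixes h :: "'c \<Rightarrow> 'd"
  assumes hom: "h \<in> hom G G'" and pair: "h ` N \<subseteq> N'"
begin

sublocale group_hom G G' h
  by unfold_locales (rule hom)

lemma N_normal: "N \<lhd> G" and N'_normal: "N' \<lhd> G'"
  by (rule G.subgroup_imp_normal[OF N.subgroup_axioms] G'.subgroup_imp_normal[OF N'.subgroup_axioms])+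

lemma quot_map_coset:
  assumes "x \<in> carrier G"
  shows "quot_map G' N' h (N #>\<^bsub>G\<^esub> x) = N' #>\<^bsub>G'\<^esub> h x"
proof -
  have h_N: "h n \<in> N'" if "n \<in> N" for n
    using pair that by blast
  have "h ` (N #>\<^bsub>G\<^esub> x) = (\<lambda>n. h n \<otimes>\<^bsub>G'\<^esub> h x) ` N"
    using assms N.subset by (force simp: r_coset_def)
  moreover have "n' \<otimes>\<^bsub>G'\<^esub> (h n \<otimes>\<^bsub>G'\<^esub> h x) = (n' \<otimes>\<^bsub>G'\<^esub> h n) \<otimes>\<^bsub>G'\<^esub> h x" if "n' \<in> N'" "n \<in> N" for n n'
    using that assms h_N by (simp add: G'.m_assoc)
  ultimately have "quot_map G' N' h (N #>\<^bsub>G\<^esub> x) = (\<Union>n'\<in>N'. \<Union>n\<in>N. {(n' \<otimes>\<^bsub>G'\<^esub> h n) \<otimes>\<^bsub>G'\<^esub> h x})"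
    by (auto simp: quot_map_def set_mult_def)
  also have "\<dots> = N' #>\<^bsub>G'\<^esub> h x"
  proof -
    have "(\<Union>n'\<in>N'. \<Union>n\<in>N. {n' \<otimes>\<^bsub>G'\<^esub> h n}) = N'"
    proof (intro equalityI subsetI)
      fix n' assume "n' \<in> N'"
      moreover from this have "n' = n' \<otimes>\<^bsub>G'\<^esub> h \<one>\<^bsub>G\<^esub>"
        by simp
      ultimately show "n' \<in> (\<Union>n'\<in>N'. \<Union>n\<in>N. {n' \<otimes>\<^bsub>G'\<^esub> h n})"
        using N.one_closed by blast
    qed (use h_N in auto)
    then have "(\<Union>m\<in>N'. {m \<otimes>\<^bsub>G'\<^esub> h x}) = (\<Union>m\<in>(\<Union>n'\<in>N'. \<Union>n\<in>N. {n' \<otimes>\<^bsub>G'\<^esub> h n}). {m \<otimes>\<^bsub>G'\<^esub> h x})"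
      by (simp only:)
    then show ?thesis
      by (simp add: r_coset_def)
  qed
  finally show ?thesis .
qed

lemma quot_map_hom: "quot_map G' N' h \<in> hom (G Mod N) (G' Mod N')"
proof (rule homI)
  fix c assume "c \<in> carrier (G Mod N)"
  then show "quot_map G' N' h c \<in> carrier (G' Mod N')"
    by (auto simp: carrier_FactGroup quot_map_coset)
next
  fix c d assume "c \<in> carrier (G Mod N)" "d \<in> carrier (G Mod N)"
  then obtain x y where "x \<in> carrier G" "y \<in> carrier G" "c = N #>\<^bsub>G\<^esub> x" "d = N #>\<^bsub>G\<^esub> y"
    by (auto simp: carrier_FactGroup)
  then show "quot_map G' N' h (c \<otimes>\<^bsub>G Mod N\<^esub> d)
      = quot_map G' N' h c \<otimes>\<^bsub>G' Mod N'\<^esub> quot_map G' N' h d"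
    by (simp add: quot_map_coset normal.rcos_sum[OF N_normal] normal.rcos_sum[OF N'_normal])
qed

end

lemma coset_one_iff:
  assumes "comm_group G" "subgroup N G" "x \<in> carrier G"
  shows "N #>\<^bsub>G\<^esub> x = N \<longleftrightarrow> x \<in> N"
proof -
  interpret G: comm_group G by fact
  show ?thesis
    using G.coset_join1[of N x] G.coset_join2[of x N] assms subgroup.subset[OF assms(2)] by blast
qed

context pair_hom
begin

lemma quot_map_iso_iff:
  "quot_map G' N' h \<in> iso (G Mod N) (G' Mod N') \<longleftrightarrow>
     (\<forall>x\<in>carrier G. h x \<in> N' \<longrightarrow> x \<in> N) \<and>
     (\<forall>y\<in>carrier G'. \<exists>x\<in>carrier G. \<exists>n\<in>N'. y = n \<otimes>\<^bsub>G'\<^esub> h x)"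
proof -
  interpret Q: group_hom "G Mod N" "G' Mod N'" "quot_map G' N' h"
    using quot_map_hom normal.factorgroup_is_group[OF N_normal]
      normal.factorgroup_is_group[OF N'_normal]
    by (simp add: group_hom_def group_hom_axioms_def)
  have inj: "(\<forall>c\<in>carrier (G Mod N). quot_map G' N' h c = \<one>\<^bsub>G' Mod N'\<^esub> \<longrightarrow> c = \<one>\<^bsub>G Mod N\<^esub>)
      \<longleftrightarrow> (\<forall>x\<in>carrier G. h x \<in> N' \<longrightarrow> x \<in> N)"
    using coset_one_iff[OF G.comm_group_axioms N.subgroup_axioms]
      coset_one_iff[OF G'.comm_group_axioms N'.subgroup_axioms]
    by (simp add: carrier_FactGroup quot_map_coset)
  have coset: "N' #>\<^bsub>G'\<^esub> y = N' #>\<^bsub>G'\<^esub> h x \<longleftrightarrow> (\<exists>n\<in>N'. y = n \<otimes>\<^bsub>G'\<^esub> h x)"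
    if "y \<in> carrier G'" "x \<in> carrier G" for x y
  proof
    assume "N' #>\<^bsub>G'\<^esub> y = N' #>\<^bsub>G'\<^esub> h x"
    with that have "y \<in> N' #>\<^bsub>G'\<^esub> h x"
      using G'.rcos_self[OF _ N'.subgroup_axioms] by blast
    then show "\<exists>n\<in>N'. y = n \<otimes>\<^bsub>G'\<^esub> h x"
      by (auto simp: r_coset_def)
  next
    assume "\<exists>n\<in>N'. y = n \<otimes>\<^bsub>G'\<^esub> h x"
    then have "y \<in> N' #>\<^bsub>G'\<^esub> h x"
      by (auto simp: r_coset_def)
    with that show "N' #>\<^bsub>G'\<^esub> y = N' #>\<^bsub>G'\<^esub> h x"
      using G'.repr_independence[of y N' "h x"] N'.subgroup_axioms by simp
  qed
  have "carrier (G' Mod N') \<subseteq> quot_map G' N' h ` carrier (G Mod N)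
      \<longleftrightarrow> (\<forall>y\<in>carrier G'. \<exists>x\<in>carrier G. N' #>\<^bsub>G'\<^esub> y = N' #>\<^bsub>G'\<^esub> h x)"
    by (auto simp: carrier_FactGroup image_image quot_map_coset subset_iff image_iff)
  also have "\<dots> \<longleftrightarrow> (\<forall>y\<in>carrier G'. \<exists>x\<in>carrier G. \<exists>n\<in>N'. y = n \<otimes>\<^bsub>G'\<^esub> h x)"
    using coset by blast
  finally show ?thesis
    unfolding Q.iso_iff inj by blast
qed

end

section \<open>Chain complexes of abelian groups and quasi-isomorphisms\<close>

locale abelian_complex =
  fixes C :: "'c chain_complex"
  assumes comm_group_grp: "\<And>k. comm_group (grp C k)"
    and bd_hom: "\<And>k. bd C k \<in> hom (grp C k) (grp C (k - 1))"
    and bd_bd: "\<And>k x. x \<in> carrier (grp C k) \<Longrightarrow> bd C (k - 1) (bd C k x) = \<one>\<^bsub>grp C (k - 1 - 1)\<^esub>"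
    and bd_0: "\<And>x. x \<in> carrier (grp C 0) \<Longrightarrow> bd C 0 x = \<one>\<^bsub>grp C 0\<^esub>"
begin

sublocale G: comm_group "grp C k" for k
  by (rule comm_group_grp)

lemma bd_group_hom: "group_hom (grp C k) (grp C (k - 1)) (bd C k)"
  using bd_hom by unfold_locales

lemma bd_closed: "x \<in> carrier (grp C k) \<Longrightarrow> bd C k x \<in> carrier (grp C (k - 1))"
  using bd_hom by (rule hom_in_carrier)

lemma bd_closed_Suc: "x \<in> carrier (grp C (Suc k)) \<Longrightarrow> bd C (Suc k) x \<in> carrier (grp C k)"
  using bd_closed[of x "Suc k"] by simp

lemma bd_bd_Suc: "x \<in> carrier (grp C (Suc k)) \<Longrightarrow> bd C k (bd C (Suc k) x) = \<one>\<^bsub>grp C (k - 1)\<^esub>"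
  using bd_bd[of x "Suc k"] by simp

lemma bd_mult:
  "x \<in> carrier (grp C k) \<Longrightarrow> y \<in> carrier (grp C k) \<Longrightarrow>
     bd C k (x \<otimes>\<^bsub>grp C k\<^esub> y) = bd C k x \<otimes>\<^bsub>grp C (k - 1)\<^esub> bd C k y"
  using bd_hom by (rule hom_mult)

lemma bd_one: "bd C k \<one>\<^bsub>grp C k\<^esub> = \<one>\<^bsub>grp C (k - 1)\<^esub>"
  using bd_group_hom by (rule group_hom.hom_one)

lemma bd_inv:
  "x \<in> carrier (grp C k) \<Longrightarrow> bd C k (inv\<^bsub>grp C k\<^esub> x) = inv\<^bsub>grp C (k - 1)\<^esub> bd C k x"
  using bd_group_hom by (rule group_hom.hom_inv)

lemmas bd_simps = bd_closed bd_closed_Suc bd_bd bd_bd_Suc bd_mult bd_one bd_inv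

definition cycles :: "nat \<Rightarrow> 'c monoid" where
  "cycles k = (grp C k)\<lparr>carrier := kernel (grp C k) (grp C (k - 1)) (bd C k)\<rparr>"

lemma carrier_cycles:
  "carrier (cycles k) = {x \<in> carrier (grp C k). bd C k x = \<one>\<^bsub>grp C (k - 1)\<^esub>}"
  by (auto simp: cycles_def kernel_def)

lemma mult_cycles: "x \<otimes>\<^bsub>cycles k\<^esub> y = x \<otimes>\<^bsub>grp C k\<^esub> y"
  by (simp add: cycles_def)

lemma subgroup_cycles: "subgroup (carrier (cycles k)) (grp C k)"
  unfolding cycles_def using group_hom.subgroup_kernel[OF bd_group_hom] by simp

lemma comm_group_cycles: "comm_group (cycles k)"
proof (rule group.group_comm_groupI)
  show "group (cycles k)"
    using subgroup.subgroup_is_group[OF subgroup_cycles G.group_axioms, of k] by (simp add: cycles_def)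
qed (simp add: mult_cycles carrier_cycles G.m_comm)

lemma boundaries_subset: "boundaries C k \<subseteq> carrier (cycles k)"
  by (auto simp: boundaries_def carrier_cycles bd_simps)

lemma subgroup_boundaries: "subgroup (boundaries C k) (cycles k)"
proof -
  have "subgroup (boundaries C k) (grp C k)"
    unfolding boundaries_def
    using group_hom.img_is_subgroup[OF bd_group_hom, of "Suc k"] by simp
  then have "subgroup (boundaries C k) ((grp C k)\<lparr>carrier := carrier (cycles k)\<rparr>)"
    using boundaries_subset subgroup_cycles by (simp add: G.subgroup_incl)
  then show ?thesis
    by (simp add: cycles_def)
qed

lemma homology_eq: "homology C k = cycles k Mod boundaries C k"
  by (simp add: homology_def cycles_def)

end

locale chain_hom = C: abelian_complex C + C': abelian_complex C'
  for C :: "'c chain_complex" and C' :: "'d chain_complex" +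
  fixes h :: "nat \<Rightarrow> 'c \<Rightarrow> 'd"
  assumes hom: "\<And>k. h k \<in> hom (grp C k) (grp C' k)"
    and bd_h: "\<And>k x. x \<in> carrier (grp C k) \<Longrightarrow> bd C' k (h k x) = h (k - 1) (bd C k x)"
begin

lemma group_hom_h: "group_hom (grp C k) (grp C' k) (h k)"
  using hom by unfold_locales

lemma closed: "x \<in> carrier (grp C k) \<Longrightarrow> h k x \<in> carrier (grp C' k)"
  using hom by (rule hom_in_carrier)

lemma mult:
  "x \<in> carrier (grp C k) \<Longrightarrow> y \<in> carrier (grp C k) \<Longrightarrow>
     h k (x \<otimes>\<^bsub>grp C k\<^esub> y) = h k x \<otimes>\<^bsub>grp C' k\<^esub> h k y"
  using hom by (rule hom_mult)

lemma one: "h k \<one>\<^bsub>grp C k\<^esub> = \<one>\<^bsub>grp C' k\<^esub>"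
  using group_hom_h by (rule group_hom.hom_one)

lemma inv: "x \<in> carrier (grp C k) \<Longrightarrow> h k (inv\<^bsub>grp C k\<^esub> x) = inv\<^bsub>grp C' k\<^esub> h k x"
  using group_hom_h by (rule group_hom.hom_inv)

lemmas h_simps = bd_h closed mult one inv

end

text \<open>
  Injectivity and surjectivity on homology in a single condition: the mapping cone of \<open>h\<close> is acyclic.
  A cycle of the cone in degree \<open>k\<close> is a pair \<open>(x, z)\<close> of degrees \<open>k\<close> and \<open>k - 1\<close>; since \<open>0 - 1 = 0\<close>,
  the component \<open>z\<close> has to be excluded explicitly for \<open>k = 0\<close>.  In this form the five lemma is a
  single diagram chase.
\<close>

definition quasi_iso ::
    "'c chain_complex \<Rightarrow> 'd chain_complex \<Rightarrow> (nat \<Rightarrow> 'c \<Rightarrow> 'd) \<Rightarrow> bool" where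
  "quasi_iso C C' h \<longleftrightarrow>
     (\<forall>k. \<forall>x\<in>carrier (grp C' k). \<forall>z\<in>carrier (grp C (k - 1)).
        (k = 0 \<longrightarrow> z = \<one>\<^bsub>grp C 0\<^esub>) \<and> bd C (k - 1) z = \<one>\<^bsub>grp C (k - 1 - 1)\<^esub> \<and> bd C' k x = h (k - 1) z \<longrightarrow>
        (\<exists>w\<in>carrier (grp C k). \<exists>y\<in>carrier (grp C' (Suc k)).
           bd C k w = z \<and> x = h k w \<otimes>\<^bsub>grp C' k\<^esub> bd C' (Suc k) y))"

lemma quasi_isoI:
  assumes "\<And>k x z. x \<in> carrier (grp C' k) \<Longrightarrow> z \<in> carrier (grp C (k - 1)) \<Longrightarrow>
      (k = 0 \<Longrightarrow> z = \<one>\<^bsub>grp C 0\<^esub>) \<Longrightarrow> bd C (k - 1) z = \<one>\<^bsub>grp C (k - 1 - 1)\<^esub> \<Longrightarrow>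
      bd C' k x = h (k - 1) z \<Longrightarrow>
      \<exists>w\<in>carrier (grp C k). \<exists>y\<in>carrier (grp C' (Suc k)).
           bd C k w = z \<and> x = h k w \<otimes>\<^bsub>grp C' k\<^esub> bd C' (Suc k) y"
  shows "quasi_iso C C' h"
  using assms unfolding quasi_iso_def by blast

lemma quasi_isoE:
  assumes "quasi_iso C C' h" "x \<in> carrier (grp C' k)" "z \<in> carrier (grp C (k - 1))"
    "k = 0 \<Longrightarrow> z = \<one>\<^bsub>grp C 0\<^esub>" "bd C (k - 1) z = \<one>\<^bsub>grp C (k - 1 - 1)\<^esub>" "bd C' k x = h (k - 1) z"
  obtains w y where "w \<in> carrier (grp C k)" "y \<in> carrier (grp C' (Suc k))"
    "bd C k w = z" "x = h k w \<otimes>\<^bsub>grp C' k\<^esub> bd C' (Suc k) y"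
proof -
  have "\<exists>w\<in>carrier (grp C k). \<exists>y\<in>carrier (grp C' (Suc k)).
      bd C k w = z \<and> x = h k w \<otimes>\<^bsub>grp C' k\<^esub> bd C' (Suc k) y"
    by (rule assms(1)[unfolded quasi_iso_def, rule_format]) (use assms(2-) in simp_all)
  then show thesis
    using that by blast
qed

context chain_hom
begin

lemma pair_hom_homology:
  "pair_hom (C.cycles k) (boundaries C k) (C'.cycles k) (boundaries C' k) (h k)"
proof (intro pair_hom.intro pair_hom_axioms.intro C.comm_group_cycles C'.comm_group_cycles
    C.subgroup_boundaries C'.subgroup_boundaries)
  show "h k \<in> hom (C.cycles k) (C'.cycles k)"
    by (rule homI) (auto simp: C.carrier_cycles C'.carrier_cycles C.mult_cycles C'.mult_cycles
        h_simps one)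
  have "h k (bd C (Suc k) x) = bd C' (Suc k) (h (Suc k) x)" if "x \<in> carrier (grp C (Suc k))" for x
    using bd_h[OF that] by simp
  then show "h k ` boundaries C k \<subseteq> boundaries C' k"
    using closed[of _ "Suc k"] by (force simp: boundaries_def)
qed

text \<open>
  For cone cycles \<open>(x, z)\<close> with trivial \<open>z\<close>, the condition is surjectivity in degree \<open>k\<close>.  In general,
  \<open>z\<close> is a cycle whose image under \<open>h\<close> bounds, and by injectivity in degree \<open>k - 1\<close> it bounds itself;
  this reduces the general case to the first.
\<close>

lemma homology_iso_iff_quasi_iso:
  "(\<forall>k. homology_map C' h k \<in> iso (homology C k) (homology C' k)) \<longleftrightarrow> quasi_iso C C' h"
proof -
  define inj where "inj k \<longleftrightarrow> (\<forall>x\<in>carrier (C.cycles k). h k x \<in> boundaries C' k \<longrightarrow> x \<in> boundaries C k)" for k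
  define surj where "surj k \<longleftrightarrow> (\<forall>y\<in>carrier (C'.cycles k). \<exists>x\<in>carrier (C.cycles k).
      \<exists>n\<in>boundaries C' k. y = n \<otimes>\<^bsub>grp C' k\<^esub> h k x)" for k
  have eq: "quot_map (grp C' k) (boundaries C' k) (h k) = quot_map (C'.cycles k) (boundaries C' k) (h k)" for k
    by (simp add: quot_map_def C'.cycles_def fun_eq_iff)
  have "homology_map C' h k \<in> iso (homology C k) (homology C' k) \<longleftrightarrow> inj k \<and> surj k" for k
    using pair_hom.quot_map_iso_iff[OF pair_hom_homology[of k]]
    by (simp add: homology_map_def C.homology_eq C'.homology_eq eq inj_def surj_def C'.mult_cycles)
  moreover have "(\<forall>k. inj k \<and> surj k) \<longleftrightarrow> quasi_iso C C' h"
  proof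
    assume IS: "\<forall>k. inj k \<and> surj k"
    show "quasi_iso C C' h"
    proof (rule quasi_isoI)
      fix k x z
      assume x: "x \<in> carrier (grp C' k)" and z: "z \<in> carrier (grp C (k - 1))"
        and z0: "k = 0 \<Longrightarrow> z = \<one>\<^bsub>grp C 0\<^esub>" and cz: "bd C (k - 1) z = \<one>\<^bsub>grp C (k - 1 - 1)\<^esub>"
        and xz: "bd C' k x = h (k - 1) z"
      have "\<exists>v\<in>carrier (grp C k). bd C k v = z"
      proof (cases k)
        case 0
        then show ?thesis
          using z0 C.bd_one[of 0] by auto
      next
        case (Suc j)
        have "h j z \<in> boundaries C' j"
          using xz x Suc by (simp add: boundaries_def) (metis imageI)
        then have "z \<in> boundaries C j"
          using IS z cz Suc by (auto simp: inj_def C.carrier_cycles)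
        then show ?thesis
          using Suc by (auto simp: boundaries_def)
      qed
      then obtain v where v: "v \<in> carrier (grp C k)" "bd C k v = z"
        by blast
      define x' where "x' = x \<otimes>\<^bsub>grp C' k\<^esub> inv\<^bsub>grp C' k\<^esub> h k v"
      have "x' \<in> carrier (C'.cycles k)"
        using v x xz z by (simp add: x'_def C'.carrier_cycles C'.bd_simps h_simps)
      then obtain u n where u: "u \<in> carrier (C.cycles k)" "n \<in> carrier (grp C' (Suc k))"
          "x' = bd C' (Suc k) n \<otimes>\<^bsub>grp C' k\<^esub> h k u"
        using IS unfolding surj_def boundaries_def by blast
      have uc: "u \<in> carrier (grp C k)" "bd C k u = \<one>\<^bsub>grp C (k - 1)\<^esub>"
        using u(1) by (auto simp: C.carrier_cycles)
      have "x = x' \<otimes>\<^bsub>grp C' k\<^esub> h k v"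
        using x v by (simp add: x'_def C'.G.m_assoc closed)
      also have "\<dots> = h k (u \<otimes>\<^bsub>grp C k\<^esub> v) \<otimes>\<^bsub>grp C' k\<^esub> bd C' (Suc k) n"
        using u uc v by (simp add: h_simps C'.bd_simps C'.G.m_ac)
      finally have "x = h k (u \<otimes>\<^bsub>grp C k\<^esub> v) \<otimes>\<^bsub>grp C' k\<^esub> bd C' (Suc k) n" .
      moreover have "bd C k (u \<otimes>\<^bsub>grp C k\<^esub> v) = z"
        using uc v z by (simp add: C.bd_simps)
      ultimately show "\<exists>w\<in>carrier (grp C k). \<exists>y\<in>carrier (grp C' (Suc k)).
           bd C k w = z \<and> x = h k w \<otimes>\<^bsub>grp C' k\<^esub> bd C' (Suc k) y"
        using uc v u by blast
    qed
  next
    assume qi: "quasi_iso C C' h"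
    show "\<forall>k. inj k \<and> surj k"
    proof (intro allI conjI)
      fix k
      show "inj k"
        unfolding inj_def
      proof (intro ballI impI)
        fix z assume z: "z \<in> carrier (C.cycles k)" "h k z \<in> boundaries C' k"
        then obtain x where "x \<in> carrier (grp C' (Suc k))" "bd C' (Suc k) x = h k z"
          by (auto simp: boundaries_def)
        then show "z \<in> boundaries C k"
          using z quasi_isoE[OF qi, of x "Suc k" z] by (auto simp: C.carrier_cycles boundaries_def)
      qed
      show "surj k"
        unfolding surj_def
      proof (intro ballI)
        fix x assume x: "x \<in> carrier (C'.cycles k)"
        then obtain w y where "w \<in> carrier (grp C k)" "y \<in> carrier (grp C' (Suc k))"
            "bd C k w = \<one>\<^bsub>grp C (k - 1)\<^esub>" "x = h k w \<otimes>\<^bsub>grp C' k\<^esub> bd C' (Suc k) y"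
          using quasi_isoE[OF qi, of x k "\<one>\<^bsub>grp C (k - 1)\<^esub>"]
          by (auto simp: C'.carrier_cycles one C.bd_one)
        then show "\<exists>w\<in>carrier (C.cycles k). \<exists>n\<in>boundaries C' k. x = n \<otimes>\<^bsub>grp C' k\<^esub> h k w"
          unfolding C.carrier_cycles boundaries_def
          by (intro bexI[of _ w] bexI[of _ "bd C' (Suc k) y"])
            (auto simp: C'.G.m_comm closed C'.bd_simps)
      qed
    qed
  qed
  ultimately show ?thesis
    by blast
qed

end

section \<open>Ways to recognise quasi-isomorphisms\<close>

text \<open>
  Strong deformation retracts: the homotopy \<open>h\<close> from \<open>\<phi> g\<close> to the identity vanishes on the image of
  \<open>\<phi>\<close>.  Its component \<open>h k\<close> is indexed by the degree of its target, so that the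
  homotopy equation applies the dummy \<open>h 0\<close> to the trivial element only.  The definition is purely equational, which makes it stable under
  additive functors.
\<close>

locale deformation_retract = \<phi>: chain_hom C C' \<phi> + g: chain_hom C' C g
  for C :: "'c chain_complex" and C' :: "'d chain_complex" and \<phi> g +
  fixes h :: "nat \<Rightarrow> 'd \<Rightarrow> 'd"
  assumes h_hom: "\<And>k. h k \<in> hom (grp C' (k - 1)) (grp C' k)"
    and g_\<phi>: "\<And>k x. x \<in> carrier (grp C k) \<Longrightarrow> g k (\<phi> k x) = x"
    and h_\<phi>: "\<And>k x. x \<in> carrier (grp C (k - 1)) \<Longrightarrow> h k (\<phi> (k - 1) x) = \<one>\<^bsub>grp C' k\<^esub>"
    and homotopy: "\<And>k x. x \<in> carrier (grp C' k) \<Longrightarrow>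
      x = (\<phi> k (g k x) \<otimes>\<^bsub>grp C' k\<^esub> bd C' (Suc k) (h (Suc k) x)) \<otimes>\<^bsub>grp C' k\<^esub> h k (bd C' k x)"
begin

lemma h_Suc_hom: "h (Suc k) \<in> hom (grp C' k) (grp C' (Suc k))"
  using h_hom[of "Suc k"] by simp

lemma quasi_iso: "quasi_iso C C' \<phi>"
proof (rule quasi_isoI)
  fix k x z
  assume x: "x \<in> carrier (grp C' k)" and z: "z \<in> carrier (grp C (k - 1))"
    and xz: "bd C' k x = \<phi> (k - 1) z"
  have hx: "h (Suc k) x \<in> carrier (grp C' (Suc k))"
    using h_Suc_hom x by (rule hom_in_carrier)
  have "bd C k (g k x) = z"
    using xz x z g_\<phi> by (simp add: g.bd_h)
  moreover have "h k (bd C' k x) = \<one>\<^bsub>grp C' k\<^esub>"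
    using xz z h_\<phi> by simp
  then have "x = \<phi> k (g k x) \<otimes>\<^bsub>grp C' k\<^esub> bd C' (Suc k) (h (Suc k) x)"
    using homotopy[OF x] x hx by (simp add: \<phi>.closed g.closed \<phi>.C'.bd_closed_Suc)
  ultimately show "\<exists>w\<in>carrier (grp C k). \<exists>y\<in>carrier (grp C' (Suc k)).
           bd C k w = z \<and> x = \<phi> k w \<otimes>\<^bsub>grp C' k\<^esub> bd C' (Suc k) y"
    using x hx g.closed by blast
qed

end

text \<open>
  A retract, in the category of maps, of a quasi-isomorphism is a quasi-isomorphism.  This
  transports the property along isomorphisms of complexes, such as \<open>C\<close> and its quotient by \<open>0\<close>.
\<close>

locale retract_of_chain_hom = a: chain_hom A A' a + b: chain_hom B B' b +
    i: chain_hom A B i + r: chain_hom B A r + i': chain_hom A' B' i' + r': chain_hom B' A' r'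
  for A :: "'a chain_complex" and A' :: "'b chain_complex" and a
    and B :: "'c chain_complex" and B' :: "'d chain_complex" and b and i r i' r' +
  assumes r_i: "\<And>k x. x \<in> carrier (grp A k) \<Longrightarrow> r k (i k x) = x"
    and r'_i': "\<And>k x. x \<in> carrier (grp A' k) \<Longrightarrow> r' k (i' k x) = x"
    and b_i: "\<And>k x. x \<in> carrier (grp A k) \<Longrightarrow> b k (i k x) = i' k (a k x)"
    and r'_b: "\<And>k x. x \<in> carrier (grp B k) \<Longrightarrow> r' k (b k x) = a k (r k x)"
begin

lemma quasi_iso_retract:
  assumes "quasi_iso B B' b"
  shows "quasi_iso A A' a"
proof (rule quasi_isoI)
  fix k x z
  assume x: "x \<in> carrier (grp A' k)" and z: "z \<in> carrier (grp A (k - 1))"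
    and z0: "k = 0 \<Longrightarrow> z = \<one>\<^bsub>grp A 0\<^esub>" and cz: "bd A (k - 1) z = \<one>\<^bsub>grp A (k - 1 - 1)\<^esub>"
    and xz: "bd A' k x = a (k - 1) z"
  obtain w y where w: "w \<in> carrier (grp B k)" and y: "y \<in> carrier (grp B' (Suc k))"
    and bw: "bd B k w = i (k - 1) z" and xw: "i' k x = b k w \<otimes>\<^bsub>grp B' k\<^esub> bd B' (Suc k) y"
    using quasi_isoE[OF assms, of "i' k x" k "i (k - 1) z"] x z z0 cz xz
    by (auto simp: i'.h_simps i.h_simps i.one b_i)
  have "bd A k (r k w) = z"
    using w bw z r_i by (simp add: r.bd_h)
  moreover have "x = r' k (i' k x)"
    using x r'_i' by simp
  then have "x = a k (r k w) \<otimes>\<^bsub>grp A' k\<^esub> bd A' (Suc k) (r' (Suc k) y)"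
    using w y unfolding xw
    by (simp add: r'.mult r'.bd_h b.closed b.C'.bd_closed_Suc r'_b)
  ultimately show "\<exists>w\<in>carrier (grp A k). \<exists>y\<in>carrier (grp A' (Suc k)).
           bd A k w = z \<and> x = a k w \<otimes>\<^bsub>grp A' k\<^esub> bd A' (Suc k) y"
    using w y r.closed r'.closed by blast
qed

end

text \<open>
  Exactness is witnessed by a splitting \<open>r\<close>, \<open>s\<close> in each degree (not compatible with the boundary
  maps), because split sequences stay exact under tensor products.
\<close>

locale split_exact = i: chain_hom A B i + p: chain_hom B E p
  for A :: "'a chain_complex" and B :: "'b chain_complex" and E :: "'c chain_complex" and i p +
  fixes r :: "nat \<Rightarrow> 'b \<Rightarrow> 'a" and s :: "nat \<Rightarrow> 'c \<Rightarrow> 'b"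
  assumes r_hom: "\<And>k. r k \<in> hom (grp B k) (grp A k)"
    and s_hom: "\<And>k. s k \<in> hom (grp E k) (grp B k)"
    and r_i: "\<And>k x. x \<in> carrier (grp A k) \<Longrightarrow> r k (i k x) = x"
    and p_s: "\<And>k x. x \<in> carrier (grp E k) \<Longrightarrow> p k (s k x) = x"
    and p_i: "\<And>k x. x \<in> carrier (grp A k) \<Longrightarrow> p k (i k x) = \<one>\<^bsub>grp E k\<^esub>"
    and splitting: "\<And>k x. x \<in> carrier (grp B k) \<Longrightarrow> x = i k (r k x) \<otimes>\<^bsub>grp B k\<^esub> s k (p k x)"
begin

lemma i_inject:
  "x \<in> carrier (grp A k) \<Longrightarrow> y \<in> carrier (grp A k) \<Longrightarrow> i k x = i k y \<Longrightarrow> x = y"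
  by (metis r_i)

lemma lift_p:
  assumes "x \<in> carrier (grp E k)"
  obtains y where "y \<in> carrier (grp B k)" "p k y = x"
  using assms p_s hom_in_carrier[OF s_hom] by blast

lemma lift_i:
  assumes "x \<in> carrier (grp B k)" "p k x = \<one>\<^bsub>grp E k\<^esub>"
  obtains y where "y \<in> carrier (grp A k)" "x = i k y"
proof
  show rx: "r k x \<in> carrier (grp A k)"
    using r_hom assms(1) by (rule hom_in_carrier)
  have "s k \<one>\<^bsub>grp E k\<^esub> = \<one>\<^bsub>grp B k\<^esub>"
    using s_hom p.C'.G.group_axioms i.C'.G.group_axioms by (rule hom_one)
  then show "x = i k (r k x)"
    using splitting[OF assms(1)] assms rx by (simp add: i.closed)
qed

end

locale split_exact_map = S: split_exact A B E i p r s + S': split_exact A' B' E' i' p' r' s' +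
    a: chain_hom A A' a + b: chain_hom B B' b + e: chain_hom E E' e
  for A :: "'a chain_complex" and B :: "'b chain_complex" and E :: "'c chain_complex" and i p r s
    and A' :: "'d chain_complex" and B' :: "'e chain_complex" and E' :: "'f chain_complex"
    and i' p' r' s' and a b e +
  assumes b_i: "\<And>k x. x \<in> carrier (grp A k) \<Longrightarrow> b k (i k x) = i' k (a k x)"
    and e_p: "\<And>k x. x \<in> carrier (grp B k) \<Longrightarrow> e k (p k x) = p' k (b k x)"
begin

text \<open>
  The part of the five lemma for the long exact homology sequences that deduces the left map from
  the other two, as a chase on cycles of the mapping cones: a cone cycle of \<open>a\<close> bounds in the cone
  of \<open>b\<close>; the image of the bounding chain in the cone of \<open>e\<close> is a cycle, hence bounds; after
  subtracting a lift of that boundary, the bounding chain comes from the cone of \<open>a\<close>.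
\<close>

lemma quasi_iso_left:
  assumes qb: "quasi_iso B B' b" and qe: "quasi_iso E E' e"
  shows "quasi_iso A A' a"
proof (rule quasi_isoI)
  fix k x z
  assume x: "x \<in> carrier (grp A' k)" and z: "z \<in> carrier (grp A (k - 1))"
    and z0: "k = 0 \<Longrightarrow> z = \<one>\<^bsub>grp A 0\<^esub>" and cz: "bd A (k - 1) z = \<one>\<^bsub>grp A (k - 1 - 1)\<^esub>"
    and xz: "bd A' k x = a (k - 1) z"
  obtain w y where w: "w \<in> carrier (grp B k)" and y: "y \<in> carrier (grp B' (Suc k))"
    and bw: "bd B k w = i (k - 1) z" and xw: "i' k x = b k w \<otimes>\<^bsub>grp B' k\<^esub> bd B' (Suc k) y"
    using quasi_isoE[OF qb, of "i' k x" k "i (k - 1) z"] x z z0 cz xz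
    by (auto simp: S'.i.h_simps S.i.h_simps S.i.one b_i)
  have "bd E k (inv\<^bsub>grp E k\<^esub> p k w) = \<one>\<^bsub>grp E (k - 1)\<^esub>"
    using w z by (simp add: S.p.C'.bd_inv S.p.h_simps bw S.p_i)
  moreover have "bd E' (Suc k) (p' (Suc k) y) = e k (inv\<^bsub>grp E k\<^esub> p k w)"
  proof -
    have "\<one>\<^bsub>grp E' k\<^esub> = p' k (b k w \<otimes>\<^bsub>grp B' k\<^esub> bd B' (Suc k) y)"
      using x by (simp flip: xw add: S'.p_i)
    also have "\<dots> = e k (p k w) \<otimes>\<^bsub>grp E' k\<^esub> bd E' (Suc k) (p' (Suc k) y)"
      using w y by (simp add: S'.p.h_simps b.closed S'.i.C'.bd_closed_Suc e_p)
    finally show ?thesis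
      using w y by (metis S'.p.C'.G.inv_comm S'.p.C'.G.inv_equality S'.p.C'.bd_closed_Suc
          S'.p.closed S.p.closed e.closed e.inv)
  qed
  \<comment> \<open>The bounding chain of \<open>(x, z)\<close> is a cycle of the cone of \<open>e\<close>, in degree \<open>k + 1\<close>.\<close>
  ultimately obtain u v where u: "u \<in> carrier (grp E (Suc k))" and v: "v \<in> carrier (grp E' (Suc (Suc k)))"
    and bu: "bd E (Suc k) u = inv\<^bsub>grp E k\<^esub> p k w"
    and yu: "p' (Suc k) y = e (Suc k) u \<otimes>\<^bsub>grp E' (Suc k)\<^esub> bd E' (Suc (Suc k)) v"
    using quasi_isoE[OF qe, of "p' (Suc k) y" "Suc k" "inv\<^bsub>grp E k\<^esub> p k w"] w y
    by (auto simp: S.p.closed S'.p.closed)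
  obtain m where m: "m \<in> carrier (grp B (Suc k))" and pm: "p (Suc k) m = u"
    using S.lift_p[OF u] by blast
  obtain l where l: "l \<in> carrier (grp B' (Suc (Suc k)))" and pl: "p' (Suc (Suc k)) l = v"
    using S'.lift_p[OF v] by blast
  have bm: "bd B (Suc k) m \<in> carrier (grp B k)" and bl: "bd B' (Suc (Suc k)) l \<in> carrier (grp B' (Suc k))"
    and by': "bd B' (Suc k) y \<in> carrier (grp B' k)"
    using m l y by (simp_all add: S.i.C'.bd_closed_Suc S'.i.C'.bd_closed_Suc)
  have "p k (bd B (Suc k) m) = inv\<^bsub>grp E k\<^esub> p k w"
    using m pm bu S.p.bd_h[OF m] by simp
  then have pw: "p k (w \<otimes>\<^bsub>grp B k\<^esub> bd B (Suc k) m) = \<one>\<^bsub>grp E k\<^esub>"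
    using w bm by (simp add: S.p.h_simps)
  obtain n where n: "n \<in> carrier (grp A k)" and wn: "w \<otimes>\<^bsub>grp B k\<^esub> bd B (Suc k) m = i k n"
    by (rule S.lift_i[OF S.i.C'.G.m_closed[OF w bm] pw])
  \<comment> \<open>The pair \<open>(m, l)\<close> lifts \<open>(u, v)\<close>; subtracting its boundary moves \<open>(w, y)\<close> into \<open>A\<close> and \<open>A'\<close>.\<close>
  define q where "q = b (Suc k) m \<otimes>\<^bsub>grp B' (Suc k)\<^esub> bd B' (Suc (Suc k)) l"
  have q: "q \<in> carrier (grp B' (Suc k))"
    using m bl by (simp add: q_def b.closed)
  have "p' (Suc k) q = p' (Suc k) y"
    using m l bl pm pl yu e_p[OF m] S'.p.bd_h[OF l] by (simp add: q_def S'.p.h_simps b.closed)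
  then have py: "p' (Suc k) (y \<otimes>\<^bsub>grp B' (Suc k)\<^esub> inv\<^bsub>grp B' (Suc k)\<^esub> q) = \<one>\<^bsub>grp E' (Suc k)\<^esub>"
    using y q by (simp add: S'.p.h_simps)
  obtain n' where n': "n' \<in> carrier (grp A' (Suc k))"
    and "y \<otimes>\<^bsub>grp B' (Suc k)\<^esub> inv\<^bsub>grp B' (Suc k)\<^esub> q = i' (Suc k) n'"
    by (rule S'.lift_i[OF S'.i.C'.G.m_closed[OF y S'.i.C'.G.inv_closed[OF q]] py])
  then have yn: "y = i' (Suc k) n' \<otimes>\<^bsub>grp B' (Suc k)\<^esub> q"
    using y q by (metis S'.i.C'.G.inv_closed S'.i.C'.G.inv_solve_right' S'.i.C'.G.m_closed)
  have "i (k - 1) (bd A k n) = bd B k (w \<otimes>\<^bsub>grp B k\<^esub> bd B (Suc k) m)"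
    using n by (simp add: wn S.i.bd_h)
  also have "\<dots> = i (k - 1) z"
    using w m bm z by (simp add: S.i.C'.bd_simps bw S.i.closed)
  finally have "bd A k n = z"
    using n z S.i_inject S.i.C.bd_closed by blast
  moreover have "x = a k n \<otimes>\<^bsub>grp A' k\<^esub> bd A' (Suc k) n'"
  proof (rule S'.i_inject)
    have "b k (bd B (Suc k) m) = bd B' (Suc k) (b (Suc k) m)"
      using b.bd_h[OF m] by simp
    then have "bd B' (Suc k) q = b k (bd B (Suc k) m)"
      using m l bl by (simp add: q_def S'.i.C'.bd_simps b.closed)
    then have "bd B' (Suc k) y = bd B' (Suc k) (i' (Suc k) n') \<otimes>\<^bsub>grp B' k\<^esub> b k (bd B (Suc k) m)"
      using n' q S'.i.closed[OF n'] by (simp add: yn S'.i.C'.bd_mult)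
    then have "i' k x = b k (w \<otimes>\<^bsub>grp B k\<^esub> bd B (Suc k) m) \<otimes>\<^bsub>grp B' k\<^esub> bd B' (Suc k) (i' (Suc k) n')"
      using w bm n' S'.i.closed[OF n']
      by (simp add: xw b.h_simps S'.i.C'.G.m_ac S'.i.C'.bd_closed_Suc)
    then show "i' k x = i' k (a k n \<otimes>\<^bsub>grp A' k\<^esub> bd A' (Suc k) n')"
      using n n' S'.i.bd_h[OF n'] by (simp add: wn b_i S'.i.mult a.closed S'.i.C.bd_closed_Suc)
  qed (use x n n' in \<open>simp_all add: a.closed S'.i.C.bd_closed_Suc\<close>)
  ultimately show "\<exists>w\<in>carrier (grp A k). \<exists>y\<in>carrier (grp A' (Suc k)).
           bd A k w = z \<and> x = a k w \<otimes>\<^bsub>grp A' k\<^esub> bd A' (Suc k) y"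
    using n n' by blast
qed

text \<open>
  The part of the five lemma that deduces the right map: lift a cone cycle of \<open>e\<close> to \<open>B\<close>.  The
  boundary of the lift is a cone cycle of \<open>a\<close>, hence bounds there, and correcting the lift by this
  bounding chain makes it a cone cycle of \<open>b\<close>.
\<close>

lemma quasi_iso_right:
  assumes qa: "quasi_iso A A' a" and qb: "quasi_iso B B' b"
  shows "quasi_iso E E' e"
proof (rule quasi_isoI)
  fix k x z
  assume x: "x \<in> carrier (grp E' k)" and z: "z \<in> carrier (grp E (k - 1))"
    and z0: "k = 0 \<Longrightarrow> z = \<one>\<^bsub>grp E 0\<^esub>" and cz: "bd E (k - 1) z = \<one>\<^bsub>grp E (k - 1 - 1)\<^esub>"
    and xz: "bd E' k x = e (k - 1) z"
  obtain X where X: "X \<in> carrier (grp B' k)" and pX: "p' k X = x"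
    using S'.lift_p[OF x] by blast
  have "\<exists>Z D. Z \<in> carrier (grp B (k - 1)) \<and> D \<in> carrier (grp A' k) \<and> p (k - 1) Z = z \<and>
      (k = 0 \<longrightarrow> Z = \<one>\<^bsub>grp B 0\<^esub>) \<and> bd B (k - 1) Z = \<one>\<^bsub>grp B (k - 1 - 1)\<^esub> \<and>
      bd B' k (X \<otimes>\<^bsub>grp B' k\<^esub> i' k D) = b (k - 1) Z"
  proof (cases "k = 0")
    case True
    then show ?thesis
      using X z0 S'.i.C'.bd_0 S.i.C'.bd_0[of "\<one>\<^bsub>grp B 0\<^esub>"]
      by (intro exI[of _ "\<one>\<^bsub>grp B 0\<^esub>"] exI[of _ "\<one>\<^bsub>grp A' 0\<^esub>"]) (simp add: S.p.one b.one S'.i.one)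
  next
    case False
    then obtain j where k: "k = Suc j"
      by (cases k) auto
    \<comment> \<open>The defect of the lift \<open>(X, Z)\<close> is \<open>(\<beta>, - \<alpha>)\<close>; the pair \<open>(\<delta>, \<gamma>)\<close> bounds it.\<close>
    obtain Z where Z: "Z \<in> carrier (grp B j)" and pZ: "p j Z = z"
      using S.lift_p[OF z] k by auto
    have bX: "bd B' (Suc j) X \<in> carrier (grp B' j)"
      using X k by (simp add: S'.i.C'.bd_closed_Suc)
    have "p (j - 1) (bd B j Z) = \<one>\<^bsub>grp E (j - 1)\<^esub>"
      using Z pZ cz k S.p.bd_h[OF Z] by simp
    then obtain \<alpha> where \<alpha>: "\<alpha> \<in> carrier (grp A (j - 1))" and Z\<alpha>: "bd B j Z = i (j - 1) \<alpha>"
      using S.lift_i[of "bd B j Z"] Z S.i.C'.bd_closed by blast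
    have "p' j (bd B' (Suc j) X) = e j z"
      using X pX xz k S'.p.bd_h[of X "Suc j"] by simp
    then have pX': "p' j (bd B' (Suc j) X \<otimes>\<^bsub>grp B' j\<^esub> inv\<^bsub>grp B' j\<^esub> b j Z) = \<one>\<^bsub>grp E' j\<^esub>"
      using bX Z e_p[OF Z] by (simp add: S'.p.h_simps b.closed pZ)
    obtain \<beta> where \<beta>: "\<beta> \<in> carrier (grp A' j)"
      and X\<beta>: "bd B' (Suc j) X \<otimes>\<^bsub>grp B' j\<^esub> inv\<^bsub>grp B' j\<^esub> b j Z = i' j \<beta>"
      by (rule S'.lift_i[OF S'.i.C'.G.m_closed[OF bX S'.i.C'.G.inv_closed[OF b.closed[OF Z]]] pX'])
    have "i (j - 1 - 1) (bd A (j - 1) \<alpha>) = i (j - 1 - 1) \<one>\<^bsub>grp A (j - 1 - 1)\<^esub>"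
      using Z \<alpha> S.i.C'.bd_bd[OF Z] by (simp add: Z\<alpha> S.i.one S.i.bd_h)
    then have b\<alpha>: "bd A (j - 1) \<alpha> = \<one>\<^bsub>grp A (j - 1 - 1)\<^esub>"
      using \<alpha> S.i_inject S.i.C.bd_closed S.i.C.G.one_closed by blast
    have \<alpha>0: "\<alpha> = \<one>\<^bsub>grp A 0\<^esub>" if "j = 0"
    proof -
      have "i 0 \<alpha> = i 0 \<one>\<^bsub>grp A 0\<^esub>"
        using that Z Z\<alpha> S.i.C'.bd_0[of Z] by (simp add: S.i.one)
      then show ?thesis
        using \<alpha> that S.i_inject by simp
    qed
    have "i' (j - 1) (bd A' j \<beta>) = bd B' j (i' j \<beta>)"
      using \<beta> by (simp add: S'.i.bd_h)
    also have "\<dots> = inv\<^bsub>grp B' (j - 1)\<^esub> b (j - 1) (bd B j Z)"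
      using Z bX X k
      by (simp flip: X\<beta> add: S'.i.C'.bd_mult S'.i.C'.bd_inv S'.i.C'.bd_bd_Suc b.closed b.bd_h S.i.C'.bd_closed del: One_nat_def)
    also have "\<dots> = i' (j - 1) (a (j - 1) (inv\<^bsub>grp A (j - 1)\<^esub> \<alpha>))"
      using \<alpha> by (simp add: Z\<alpha> b_i S'.i.inv a.inv a.closed)
    finally have b\<beta>: "bd A' j \<beta> = a (j - 1) (inv\<^bsub>grp A (j - 1)\<^esub> \<alpha>)"
      using \<alpha> \<beta> S'.i_inject S'.i.C.bd_closed a.closed S.i.C.G.inv_closed by metis
    obtain \<gamma> \<delta> where \<gamma>: "\<gamma> \<in> carrier (grp A j)" and \<delta>: "\<delta> \<in> carrier (grp A' (Suc j))"
      and b\<gamma>: "bd A j \<gamma> = inv\<^bsub>grp A (j - 1)\<^esub> \<alpha>" and \<beta>\<gamma>: "\<beta> = a j \<gamma> \<otimes>\<^bsub>grp A' j\<^esub> bd A' (Suc j) \<delta>"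
      using quasi_isoE[OF qa \<beta> _ _ _ b\<beta>] \<alpha> \<alpha>0 b\<alpha> by (auto simp: S.i.C.bd_inv)
    define Z' where "Z' = Z \<otimes>\<^bsub>grp B j\<^esub> i j \<gamma>"
    define D where "D = inv\<^bsub>grp A' (Suc j)\<^esub> \<delta>"
    have iD: "i' (Suc j) D \<in> carrier (grp B' (Suc j))" and D: "D \<in> carrier (grp A' (Suc j))"
      using \<delta> by (simp_all add: D_def S'.i.closed)
    have "bd B' (Suc j) (i' (Suc j) \<delta>) = i' j (bd A' (Suc j) \<delta>)"
      using S'.i.bd_h[OF \<delta>] by simp
    then have biD: "bd B' (Suc j) (i' (Suc j) D) = inv\<^bsub>grp B' j\<^esub> i' j (bd A' (Suc j) \<delta>)"
      using \<delta> by (simp add: D_def S'.i.inv S'.i.C'.bd_inv S'.i.closed)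
    have i\<delta>: "i' j (bd A' (Suc j) \<delta>) \<in> carrier (grp B' j)"
      using \<delta> by (simp add: S'.i.closed S'.i.C.bd_closed_Suc)
    have "bd B' (Suc j) X = i' j \<beta> \<otimes>\<^bsub>grp B' j\<^esub> b j Z"
      using X\<beta> bX Z by (metis S'.i.C'.G.inv_closed S'.i.C'.G.inv_solve_right' S'.i.C'.G.m_closed b.closed)
    also have "i' j \<beta> = b j (i j \<gamma>) \<otimes>\<^bsub>grp B' j\<^esub> i' j (bd A' (Suc j) \<delta>)"
      using \<gamma> \<delta> by (simp add: \<beta>\<gamma> S'.i.mult a.closed S'.i.C.bd_closed_Suc b_i)
    finally have "bd B' (Suc j) (X \<otimes>\<^bsub>grp B' (Suc j)\<^esub> i' (Suc j) D) =
        ((b j (i j \<gamma>) \<otimes>\<^bsub>grp B' j\<^esub> i' j (bd A' (Suc j) \<delta>)) \<otimes>\<^bsub>grp B' j\<^esub> b j Z)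
           \<otimes>\<^bsub>grp B' j\<^esub> inv\<^bsub>grp B' j\<^esub> i' j (bd A' (Suc j) \<delta>)"
      using X iD k by (simp add: S'.i.C'.bd_mult biD)
    also have "\<dots> = b j Z'"
      using Z \<gamma> i\<delta> by (simp add: Z'_def b.mult S.i.closed b.closed S'.i.C'.G.m_ac)
    finally have "bd B' (Suc j) (X \<otimes>\<^bsub>grp B' (Suc j)\<^esub> i' (Suc j) D) = b j Z'" .
    moreover have "bd B j Z' = \<one>\<^bsub>grp B (j - 1)\<^esub>"
      using Z \<gamma> \<alpha> by (simp add: Z'_def S.i.C'.bd_mult S.i.closed S.i.bd_h b\<gamma> Z\<alpha> S.i.inv)
    moreover have "p j Z' = z"
      using Z \<gamma> pZ z k by (simp add: Z'_def S.p.mult S.i.closed S.p_i)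
    moreover have "Z' \<in> carrier (grp B j)"
      using Z \<gamma> by (simp add: Z'_def S.i.closed)
    ultimately show ?thesis
      using k D by auto
  qed
  then obtain Z D where Z: "Z \<in> carrier (grp B (k - 1))" and D: "D \<in> carrier (grp A' k)"
    and pZ: "p (k - 1) Z = z" and Z0: "k = 0 \<Longrightarrow> Z = \<one>\<^bsub>grp B 0\<^esub>"
    and bZ: "bd B (k - 1) Z = \<one>\<^bsub>grp B (k - 1 - 1)\<^esub>"
    and XZ: "bd B' k (X \<otimes>\<^bsub>grp B' k\<^esub> i' k D) = b (k - 1) Z"
    by blast
  have iD: "i' k D \<in> carrier (grp B' k)"
    using D by (rule S'.i.closed)
  obtain W Y where W: "W \<in> carrier (grp B k)" and Y: "Y \<in> carrier (grp B' (Suc k))"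
    and bW: "bd B k W = Z" and XW: "X \<otimes>\<^bsub>grp B' k\<^esub> i' k D = b k W \<otimes>\<^bsub>grp B' k\<^esub> bd B' (Suc k) Y"
    using quasi_isoE[OF qb _ Z Z0 bZ XZ] X iD by blast
  have "x = p' k (X \<otimes>\<^bsub>grp B' k\<^esub> i' k D)"
    using X iD D pX x by (simp add: S'.p.mult S'.p_i)
  also have "\<dots> = e k (p k W) \<otimes>\<^bsub>grp E' k\<^esub> bd E' (Suc k) (p' (Suc k) Y)"
    using W Y S'.p.bd_h[OF Y] by (simp add: XW S'.p.mult b.closed S'.i.C'.bd_closed_Suc e_p)
  finally have "x = e k (p k W) \<otimes>\<^bsub>grp E' k\<^esub> bd E' (Suc k) (p' (Suc k) Y)" .
  moreover have "bd E k (p k W) = z"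
    using W bW pZ by (simp add: S.p.bd_h)
  ultimately show "\<exists>w\<in>carrier (grp E k). \<exists>y\<in>carrier (grp E' (Suc k)).
           bd E k w = z \<and> x = e k w \<otimes>\<^bsub>grp E' k\<^esub> bd E' (Suc k) y"
    using W Y S.p.closed S'.p.closed by blast
qed

end

section \<open>Passing to quotient complexes\<close>

locale subcomplex = abelian_complex C for C :: "'c chain_complex" +
  fixes D :: "nat \<Rightarrow> 'c set"
  assumes sub: "sub_chain_complex C D"
begin

lemma subgroup_D: "subgroup (D k) (grp C k)"
  using sub by (simp add: sub_chain_complex_def)

lemma D_closed: "x \<in> D k \<Longrightarrow> x \<in> carrier (grp C k)"
  using subgroup_D by (rule subgroup.mem_carrier)

lemma normal_D: "D k \<lhd> grp C k"
  using subgroup_D by (rule G.subgroup_imp_normal)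

lemma coset_mult:
  "x \<in> carrier (grp C k) \<Longrightarrow> y \<in> carrier (grp C k) \<Longrightarrow>
     (D k #>\<^bsub>grp C k\<^esub> x) <#>\<^bsub>grp C k\<^esub> (D k #>\<^bsub>grp C k\<^esub> y) = D k #>\<^bsub>grp C k\<^esub> (x \<otimes>\<^bsub>grp C k\<^esub> y)"
  by (rule normal.rcos_sum[OF normal_D])

lemma coset_one: "D k #>\<^bsub>grp C k\<^esub> \<one>\<^bsub>grp C k\<^esub> = D k"
  using subgroup.subset[OF subgroup_D] by simp

lemma coset_absorb: "x \<in> D k \<Longrightarrow> D k #>\<^bsub>grp C k\<^esub> x = D k"
  using subgroup_D D_closed G.coset_join2 by blast

lemma grp_quotient: "grp (quotient_complex C D) k = grp C k Mod D k"
  by (simp add: quotient_complex_def)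

lemma carrier_quotient:
  "carrier (grp (quotient_complex C D) k) = (\<lambda>x. D k #>\<^bsub>grp C k\<^esub> x) ` carrier (grp C k)"
  by (simp add: grp_quotient carrier_FactGroup)

lemma bd_quotient:
  assumes "x \<in> carrier (grp C k)"
  shows "bd (quotient_complex C D) k (D k #>\<^bsub>grp C k\<^esub> x) = D (k - 1) #>\<^bsub>grp C (k - 1)\<^esub> bd C k x"
    and "bd (quotient_complex C D) k \<in> hom (grp C k Mod D k) (grp C (k - 1) Mod D (k - 1))"
proof -
  have "bd C k ` D k \<subseteq> D (k - 1)"
    using sub by (simp add: sub_chain_complex_def)
  then interpret pair_hom "grp C k" "D k" "grp C (k - 1)" "D (k - 1)" "bd C k"
    by (intro pair_hom.intro pair_hom_axioms.intro comm_group_grp subgroup_D bd_hom)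
  show "bd (quotient_complex C D) k (D k #>\<^bsub>grp C k\<^esub> x) = D (k - 1) #>\<^bsub>grp C (k - 1)\<^esub> bd C k x"
    using quot_map_coset assms by (simp add: quotient_complex_def)
  show "bd (quotient_complex C D) k \<in> hom (grp C k Mod D k) (grp C (k - 1) Mod D (k - 1))"
    using quot_map_hom by (simp add: quotient_complex_def)
qed

lemma abelian_complex_quotient: "abelian_complex (quotient_complex C D)"
proof (rule abelian_complex.intro)
  show "comm_group (grp (quotient_complex C D) k)" for k
    using G.abelian_FactGroup[OF subgroup_D] by (simp add: grp_quotient)
  show "bd (quotient_complex C D) k \<in> hom (grp (quotient_complex C D) k) (grp (quotient_complex C D) (k - 1))" for k
    using bd_quotient(2)[OF G.one_closed] by (simp add: grp_quotient)
  show "bd (quotient_complex C D) (k - 1) (bd (quotient_complex C D) k x)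
      = \<one>\<^bsub>grp (quotient_complex C D) (k - 1 - 1)\<^esub>"
    if "x \<in> carrier (grp (quotient_complex C D) k)" for k x
    using that unfolding carrier_quotient
    by (auto simp: bd_quotient bd_closed bd_bd grp_quotient coset_one simp del: One_nat_def)
  show "bd (quotient_complex C D) 0 x = \<one>\<^bsub>grp (quotient_complex C D) 0\<^esub>"
    if "x \<in> carrier (grp (quotient_complex C D) 0)" for x
    using that unfolding carrier_quotient
    by (auto simp: bd_quotient bd_0 grp_quotient coset_one)
qed

end

locale pair_chain_hom = chain_hom C C' h + D: subcomplex C D + D': subcomplex C' D'
  for C :: "'c chain_complex" and C' :: "'d chain_complex" and h D D' +
  assumes h_D: "\<And>k x. x \<in> D k \<Longrightarrow> h k x \<in> D' k"
begin

definition induced :: "nat \<Rightarrow> 'c set \<Rightarrow> 'd set" where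
  "induced k = quot_map (grp C' k) (D' k) (h k)"

lemma pair_hom_h: "pair_hom (grp C k) (D k) (grp C' k) (D' k) (h k)"
  by (intro pair_hom.intro pair_hom_axioms.intro C.comm_group_grp C'.comm_group_grp
      D.subgroup_D D'.subgroup_D hom) (auto simp: h_D)

lemma induced_coset:
  "x \<in> carrier (grp C k) \<Longrightarrow> induced k (D k #>\<^bsub>grp C k\<^esub> x) = D' k #>\<^bsub>grp C' k\<^esub> h k x"
  unfolding induced_def by (rule pair_hom.quot_map_coset[OF pair_hom_h])

lemma chain_hom_induced: "chain_hom (quotient_complex C D) (quotient_complex C' D') induced"
proof (intro chain_hom.intro chain_hom_axioms.intro D.abelian_complex_quotient D'.abelian_complex_quotient)
  show "induced k \<in> hom (grp (quotient_complex C D) k) (grp (quotient_complex C' D') k)" for k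
    using pair_hom.quot_map_hom[OF pair_hom_h] by (simp add: induced_def D.grp_quotient D'.grp_quotient)
  show "bd (quotient_complex C' D') k (induced k x) = induced (k - 1) (bd (quotient_complex C D) k x)"
    if "x \<in> carrier (grp (quotient_complex C D) k)" for k x
    using that unfolding D.carrier_quotient
    by (auto simp: induced_coset D.bd_quotient D'.bd_quotient closed C.bd_closed bd_h simp del: One_nat_def)
qed

end

lemma (in deformation_retract) subcomplex_image:
  assumes "subcomplex C D"
  shows "subcomplex C' (\<lambda>k. \<phi> k ` D k)"
proof -
  interpret D: subcomplex C D by fact
  have "subgroup (\<phi> k ` D k) (grp C' k)" for k
    by (rule group_hom.subgroup_img_is_subgroup[OF \<phi>.group_hom_h D.subgroup_D])
  moreover have "bd C' k ` \<phi> k ` D k \<subseteq> \<phi> (k - 1) ` D (k - 1)" for k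
    using D.sub D.D_closed by (fastforce simp: sub_chain_complex_def \<phi>.bd_h simp del: One_nat_def)
  ultimately show ?thesis
    by unfold_locales (simp add: sub_chain_complex_def)
qed

text \<open>
  The retraction \<open>g\<close> maps \<open>\<phi> D\<close> to \<open>D\<close> because \<open>g \<phi>\<close> is the identity, and the homotopy preserves
  \<open>\<phi> D\<close> because it vanishes there; so all the data descend to the quotients.
\<close>

lemma (in deformation_retract) deformation_retract_quotient:
  assumes "subcomplex C D"
  defines "D' \<equiv> \<lambda>k. \<phi> k ` D k"
  shows "deformation_retract (quotient_complex C D) (quotient_complex C' D')
    (\<lambda>k. quot_map (grp C' k) (D' k) (\<phi> k)) (\<lambda>k. quot_map (grp C k) (D k) (g k))
    (\<lambda>k. quot_map (grp C' k) (D' k) (h k))"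
proof -
  interpret D: subcomplex C D by fact
  interpret D': subcomplex C' D'
    unfolding D'_def using assms by (intro subcomplex_image)
  interpret \<phi>D: pair_chain_hom C C' \<phi> D D'
    by unfold_locales (auto simp: D'_def)
  interpret gD: pair_chain_hom C' C g D' D
    by unfold_locales (auto simp: D'_def g_\<phi> D.D_closed)
  interpret hD: pair_hom "grp C' (k - 1)" "D' (k - 1)" "grp C' k" "D' k" "h k" for k
  proof (intro pair_hom.intro pair_hom_axioms.intro \<phi>.C'.comm_group_grp D'.subgroup_D h_hom)
    show "h k ` D' (k - 1) \<subseteq> D' k"
      using h_\<phi> D.D_closed subgroup.one_closed[OF D'.subgroup_D] by (auto simp: D'_def simp del: One_nat_def)
  qed
  have hD_Suc: "quot_map (grp C' (Suc k)) (D' (Suc k)) (h (Suc k)) (D' k #>\<^bsub>grp C' k\<^esub> x)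
      = D' (Suc k) #>\<^bsub>grp C' (Suc k)\<^esub> h (Suc k) x" if "x \<in> carrier (grp C' k)" for k x
    using hD.quot_map_coset[of x "Suc k"] that by simp
  have h_closed: "h k x \<in> carrier (grp C' k)" if "x \<in> carrier (grp C' (k - 1))" for k x
    using hom_in_carrier[OF h_hom that] .
  have h_closed_Suc: "h (Suc k) x \<in> carrier (grp C' (Suc k))" if "x \<in> carrier (grp C' k)" for k x
    using hom_in_carrier[OF h_Suc_hom that] .
  show ?thesis
    unfolding \<phi>D.induced_def[symmetric] gD.induced_def[symmetric]
  proof (intro deformation_retract.intro deformation_retract_axioms.intro
      \<phi>D.chain_hom_induced gD.chain_hom_induced)
    fix k
    show "quot_map (grp C' k) (D' k) (h k)
        \<in> hom (grp (quotient_complex C' D') (k - 1)) (grp (quotient_complex C' D') k)"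
      using hD.quot_map_hom by (simp add: D'.grp_quotient)
    show "gD.induced k (\<phi>D.induced k x) = x" if "x \<in> carrier (grp (quotient_complex C D) k)" for x
      using that unfolding D.carrier_quotient
      by (auto simp: \<phi>D.induced_coset gD.induced_coset \<phi>.closed g_\<phi>)
    show "quot_map (grp C' k) (D' k) (h k) (\<phi>D.induced (k - 1) x) = \<one>\<^bsub>grp (quotient_complex C' D') k\<^esub>"
      if "x \<in> carrier (grp (quotient_complex C D) (k - 1))" for x
      using that unfolding D.carrier_quotient
      by (auto simp: \<phi>D.induced_coset hD.quot_map_coset \<phi>.closed h_\<phi> D'.grp_quotient D'.coset_one
          simp del: One_nat_def)
    show "x = (\<phi>D.induced k (gD.induced k x) \<otimes>\<^bsub>grp (quotient_complex C' D') k\<^esub>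
        bd (quotient_complex C' D') (Suc k) (quot_map (grp C' (Suc k)) (D' (Suc k)) (h (Suc k)) x))
        \<otimes>\<^bsub>grp (quotient_complex C' D') k\<^esub> quot_map (grp C' k) (D' k) (h k) (bd (quotient_complex C' D') k x)"
      if c: "x \<in> carrier (grp (quotient_complex C' D') k)" for x
    proof -
      obtain y where y: "y \<in> carrier (grp C' k)" and x: "x = D' k #>\<^bsub>grp C' k\<^esub> y"
        using c unfolding D'.carrier_quotient by blast
      have "bd (quotient_complex C' D') (Suc k) (D' (Suc k) #>\<^bsub>grp C' (Suc k)\<^esub> h (Suc k) y)
          = D' k #>\<^bsub>grp C' k\<^esub> bd C' (Suc k) (h (Suc k) y)"
        using D'.bd_quotient(1)[OF h_closed_Suc[OF y]] by simp
      then show ?thesis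
        using y homotopy[OF y]
        by (simp add: x gD.induced_coset \<phi>D.induced_coset g.closed \<phi>.closed hD_Suc D'.bd_quotient(1)
            hD.quot_map_coset \<phi>.C'.bd_closed \<phi>.C'.bd_closed_Suc h_closed h_closed_Suc
            D'.grp_quotient D'.coset_mult del: One_nat_def)
    qed
  qed
qed

text \<open>
  The elements of a quotient by the trivial subgroup are singletons, so that \<open>x \<mapsto> {x}\<close> and
  \<open>the_elem\<close> are mutually inverse isomorphisms between a complex and its quotient by \<open>0\<close>.
\<close>

lemma (in chain_hom) retract_of_trivial_quotient:
  defines "Z \<equiv> \<lambda>k. {\<one>\<^bsub>grp C k\<^esub>}" and "Z' \<equiv> \<lambda>k. {\<one>\<^bsub>grp C' k\<^esub>}"
  shows "retract_of_chain_hom C C' h (quotient_complex C Z) (quotient_complex C' Z')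
    (\<lambda>k. quot_map (grp C' k) (Z' k) (h k)) (\<lambda>k x. {x}) (\<lambda>k. the_elem) (\<lambda>k x. {x}) (\<lambda>k. the_elem)"
proof -
  have trivial: "subcomplex K (\<lambda>k. {\<one>\<^bsub>grp K k\<^esub>})" if "abelian_complex K" for K :: "'k chain_complex"
  proof -
    interpret K: abelian_complex K by fact
    show ?thesis
      by unfold_locales (simp add: sub_chain_complex_def K.G.triv_subgroup K.bd_one)
  qed
  interpret Z: subcomplex C Z
    unfolding Z_def by (intro trivial C.abelian_complex_axioms)
  interpret Z': subcomplex C' Z'
    unfolding Z'_def by (intro trivial C'.abelian_complex_axioms)
  interpret hZ: pair_chain_hom C C' h Z Z'
    by unfold_locales (simp add: Z_def Z'_def one)
  have singleton: "chain_hom K (quotient_complex K (\<lambda>k. {\<one>\<^bsub>grp K k\<^esub>})) (\<lambda>k x. {x})"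
      "chain_hom (quotient_complex K (\<lambda>k. {\<one>\<^bsub>grp K k\<^esub>})) K (\<lambda>k. the_elem)"
      "\<And>k. carrier (grp (quotient_complex K (\<lambda>k. {\<one>\<^bsub>grp K k\<^esub>})) k) = (\<lambda>x. {x}) ` carrier (grp K k)"
    if "abelian_complex K" for K :: "'k chain_complex"
  proof -
    let ?K' = "quotient_complex K (\<lambda>k. {\<one>\<^bsub>grp K k\<^esub>})"
    interpret K: subcomplex K "\<lambda>k. {\<one>\<^bsub>grp K k\<^esub>}"
      using that by (rule trivial)
    have coset: "{\<one>\<^bsub>grp K k\<^esub>} #>\<^bsub>grp K k\<^esub> x = {x}" if "x \<in> carrier (grp K k)" for k x
      using that by (simp add: r_coset_def)
    show carrier: "carrier (grp ?K' k) = (\<lambda>x. {x}) ` carrier (grp K k)" for k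
      unfolding K.carrier_quotient by (rule image_cong) (simp_all add: coset)
    have bd: "bd ?K' k {x} = {bd K k x}" if "x \<in> carrier (grp K k)" for k x
      using K.bd_quotient(1)[OF that] that by (simp add: coset K.bd_closed del: One_nat_def)
    have mult: "{x} \<otimes>\<^bsub>grp ?K' k\<^esub> {y} = {x \<otimes>\<^bsub>grp K k\<^esub> y}" for k x y
      by (simp add: K.grp_quotient set_mult_def)
    show "chain_hom K ?K' (\<lambda>k x. {x})"
      by (intro chain_hom.intro chain_hom_axioms.intro that K.abelian_complex_quotient homI)
        (auto simp: carrier mult bd)
    show "chain_hom ?K' K (\<lambda>k. the_elem)"
      by (intro chain_hom.intro chain_hom_axioms.intro that K.abelian_complex_quotient homI)
        (auto simp: carrier mult bd)
  qed
  note C = singleton[OF C.abelian_complex_axioms, folded Z_def]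
    and C' = singleton[OF C'.abelian_complex_axioms, folded Z'_def]
  have induced: "hZ.induced k {x} = {h k x}" if "x \<in> carrier (grp C k)" for k x
    using hZ.induced_coset[OF that] that closed[OF that] by (simp add: Z_def Z'_def r_coset_def)
  show ?thesis
    unfolding hZ.induced_def[symmetric]
    by (intro retract_of_chain_hom.intro retract_of_chain_hom_axioms.intro C(1,2) C'(1,2)
        hZ.chain_hom_induced chain_hom_axioms) (auto simp: C(3) induced)
qed

text \<open>
  The sequence of the triple \<open>D1 \<subseteq> D2 \<subseteq> C'\<close> when \<open>D2\<close> contains the image of \<open>h\<close> and \<open>D1\<close> that of \<open>D\<close>.
  The left term \<open>D2 / D1\<close> is replaced by \<open>C / D\<close>, which \<open>h\<close> identifies with it.  The sequence is split
  by a left inverse \<open>\<rho>\<close> of \<open>h\<close> and the projection \<open>\<sigma>\<close> to the complementary summand.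
\<close>

lemma (in chain_hom) split_exact_quotient:
  assumes D: "subcomplex C D" and D1: "subcomplex C' D1" and D2: "subcomplex C' D2"
    and h_D: "\<And>k x. x \<in> D k \<Longrightarrow> h k x \<in> D1 k" and D12: "\<And>k. D1 k \<subseteq> D2 k"
    and h_D2: "\<And>k x. x \<in> carrier (grp C k) \<Longrightarrow> h k x \<in> D2 k"
    and \<rho>: "\<And>k. \<rho> k \<in> hom (grp C' k) (grp C k)" and \<sigma>: "\<And>k. \<sigma> k \<in> hom (grp C' k) (grp C' k)"
    and \<rho>_h: "\<And>k x. x \<in> carrier (grp C k) \<Longrightarrow> \<rho> k (h k x) = x"
    and \<rho>_D: "\<And>k x. x \<in> D1 k \<Longrightarrow> \<rho> k x \<in> D k"
    and \<sigma>_D: "\<And>k x. x \<in> D2 k \<Longrightarrow> \<sigma> k x \<in> D1 k"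
    and sum: "\<And>k x. x \<in> carrier (grp C' k) \<Longrightarrow> x = h k (\<rho> k x) \<otimes>\<^bsub>grp C' k\<^esub> \<sigma> k x"
  shows "split_exact (quotient_complex C D) (quotient_complex C' D1) (quotient_complex C' D2)
    (\<lambda>k. quot_map (grp C' k) (D1 k) (h k)) (\<lambda>k. quot_map (grp C' k) (D2 k) (\<lambda>x. x))
    (\<lambda>k. quot_map (grp C k) (D k) (\<rho> k)) (\<lambda>k. quot_map (grp C' k) (D1 k) (\<sigma> k))"
proof -
  interpret D: subcomplex C D by fact
  interpret D1: subcomplex C' D1 by fact
  interpret D2: subcomplex C' D2 by fact
  interpret i: pair_chain_hom C C' h D D1
    by unfold_locales (rule h_D)
  interpret p: pair_chain_hom C' C' "\<lambda>k x. x" D1 D2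
    using D12 by unfold_locales (auto simp: hom_def)
  interpret r: pair_hom "grp C' k" "D1 k" "grp C k" "D k" "\<rho> k" for k
    by (intro pair_hom.intro pair_hom_axioms.intro C.comm_group_grp C'.comm_group_grp
      D.subgroup_D D1.subgroup_D \<rho>) (auto simp: \<rho>_D)
  interpret s: pair_hom "grp C' k" "D2 k" "grp C' k" "D1 k" "\<sigma> k" for k
    by (intro pair_hom.intro pair_hom_axioms.intro C.comm_group_grp C'.comm_group_grp
      D2.subgroup_D D1.subgroup_D \<sigma>) (auto simp: \<sigma>_D)
  have \<rho>_closed: "\<rho> k x \<in> carrier (grp C k)" and \<sigma>_closed: "\<sigma> k x \<in> carrier (grp C' k)"
    if "x \<in> carrier (grp C' k)" for k x
    using that hom_in_carrier[OF \<rho>] hom_in_carrier[OF \<sigma>] by auto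
  show ?thesis
    unfolding i.induced_def[symmetric] p.induced_def[symmetric]
  proof (intro split_exact.intro split_exact_axioms.intro i.chain_hom_induced p.chain_hom_induced)
    fix k
    show "quot_map (grp C k) (D k) (\<rho> k)
        \<in> hom (grp (quotient_complex C' D1) k) (grp (quotient_complex C D) k)"
      using r.quot_map_hom by (simp add: D.grp_quotient D1.grp_quotient)
    show "quot_map (grp C' k) (D1 k) (\<sigma> k)
        \<in> hom (grp (quotient_complex C' D2) k) (grp (quotient_complex C' D1) k)"
      using s.quot_map_hom by (simp add: D2.grp_quotient D1.grp_quotient)
    show "quot_map (grp C k) (D k) (\<rho> k) (i.induced k x) = x"
      if "x \<in> carrier (grp (quotient_complex C D) k)" for x
      using that unfolding D.carrier_quotient
      by (auto simp: i.induced_coset r.quot_map_coset closed \<rho>_h)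
    show "p.induced k (quot_map (grp C' k) (D1 k) (\<sigma> k) x) = x"
      if c: "x \<in> carrier (grp (quotient_complex C' D2) k)" for x
    proof -
      obtain y where y: "y \<in> carrier (grp C' k)" and x: "x = D2 k #>\<^bsub>grp C' k\<^esub> y"
        using c unfolding D2.carrier_quotient by blast
      \<comment> \<open>As \<open>h (\<rho> y)\<close> lies in \<open>D2\<close>, the elements \<open>\<sigma> y\<close> and \<open>y\<close> agree modulo \<open>D2\<close>.\<close>
      have "D2 k #>\<^bsub>grp C' k\<^esub> \<sigma> k y = D2 k <#>\<^bsub>grp C' k\<^esub> (D2 k #>\<^bsub>grp C' k\<^esub> \<sigma> k y)"
        using D2.coset_mult[of "\<one>\<^bsub>grp C' k\<^esub>" k "\<sigma> k y"] y \<sigma>_closed by (simp add: D2.coset_one)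
      also have "\<dots> = D2 k #>\<^bsub>grp C' k\<^esub> (h k (\<rho> k y) \<otimes>\<^bsub>grp C' k\<^esub> \<sigma> k y)"
        using D2.coset_mult[of "h k (\<rho> k y)" k "\<sigma> k y"] y \<sigma>_closed \<rho>_closed
        by (simp add: closed h_D2 D2.coset_absorb)
      also have "\<dots> = D2 k #>\<^bsub>grp C' k\<^esub> y"
        using sum[OF y] by simp
      finally show ?thesis
        using y by (simp add: x s.quot_map_coset p.induced_coset \<sigma>_closed)
    qed
    show "p.induced k (i.induced k x) = \<one>\<^bsub>grp (quotient_complex C' D2) k\<^esub>"
      if "x \<in> carrier (grp (quotient_complex C D) k)" for x
      using that unfolding D.carrier_quotient
      by (auto simp: i.induced_coset p.induced_coset closed D2.grp_quotient h_D2 D2.coset_absorb)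
    show "x = i.induced k (quot_map (grp C k) (D k) (\<rho> k) x)
        \<otimes>\<^bsub>grp (quotient_complex C' D1) k\<^esub> quot_map (grp C' k) (D1 k) (\<sigma> k) (p.induced k x)"
      if c: "x \<in> carrier (grp (quotient_complex C' D1) k)" for x
    proof -
      obtain y where y: "y \<in> carrier (grp C' k)" and x: "x = D1 k #>\<^bsub>grp C' k\<^esub> y"
        using c unfolding D1.carrier_quotient by blast
      show ?thesis
        using y sum[OF y] by (simp add: x r.quot_map_coset s.quot_map_coset i.induced_coset
            p.induced_coset \<rho>_closed \<sigma>_closed closed D1.grp_quotient D1.coset_mult)
    qed
  qed
qed

section \<open>Tensor products\<close>

lemma hom_ident: "(\<lambda>x. x) \<in> hom G G"
  by (simp add: hom_def)

lemma hom_comp: "f \<in> hom G H \<Longrightarrow> g \<in> hom H K \<Longrightarrow> (\<lambda>x. g (f x)) \<in> hom G K"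
  using hom_compose[of f G H g K] by (simp add: comp_def)

lemma hom_const_one: "group H \<Longrightarrow> (\<lambda>x. \<one>\<^bsub>H\<^esub>) \<in> hom G H"
  by (simp add: hom_def group.is_monoid)

lemma hom_pointwise_mult:
  assumes "comm_group H" "f \<in> hom G H" "g \<in> hom G H"
  shows "(\<lambda>x. f x \<otimes>\<^bsub>H\<^esub> g x) \<in> hom G H"
proof -
  interpret H: comm_group H by fact
  show ?thesis
    using assms(2,3) by (intro homI) (auto simp: hom_in_carrier hom_mult[OF assms(2)] hom_mult[OF assms(3)] H.m_ac)
qed

lemma subgroup_equalizer:
  assumes "group G" "group H" "f \<in> hom G H" "g \<in> hom G H"
  shows "subgroup {x \<in> carrier G. f x = g x} G"
proof -
  interpret G: group G by fact
  interpret f: group_hom G H f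
    using assms by (simp add: group_hom_def group_hom_axioms_def)
  interpret g: group_hom G H g
    using assms by (simp add: group_hom_def group_hom_axioms_def)
  show ?thesis
    by (rule G.subgroupI) auto
qed

lemma free_Abelian_group_hom_eqI:
  assumes "group H" "f \<in> hom (free_Abelian_group S) H" "g \<in> hom (free_Abelian_group S) H"
    and "\<And>a. a \<in> S \<Longrightarrow> f (frag_of a) = g (frag_of a)"
    and "x \<in> carrier (free_Abelian_group S)"
  shows "f x = g x"
proof -
  interpret E: subgroup "{x \<in> carrier (free_Abelian_group S). f x = g x}" "free_Abelian_group S"
    using assms by (intro subgroup_equalizer group_free_Abelian_group)
  let ?E = "{x \<in> carrier (free_Abelian_group S). f x = g x}"
  have "x \<in> ?E"
  proof (rule free_Abelian_group_induct[of x S])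
    fix y z assume "y \<in> ?E" "z \<in> ?E"
    then have "y \<otimes>\<^bsub>free_Abelian_group S\<^esub> inv\<^bsub>free_Abelian_group S\<^esub> z \<in> ?E"
      by (intro E.m_closed E.m_inv_closed)
    then show "y - z \<in> ?E"
      using \<open>z \<in> ?E\<close> by simp
  qed (use assms E.one_closed in auto)
  then show ?thesis
    by simp
qed

lemma frag_extend_hom:
  assumes "\<And>a. a \<in> S \<Longrightarrow> f a \<in> carrier (free_Abelian_group T)"
  shows "frag_extend f \<in> hom (free_Abelian_group S) (free_Abelian_group T)"
proof (rule homI)
  fix x assume "x \<in> carrier (free_Abelian_group S)"
  then show "frag_extend f x \<in> carrier (free_Abelian_group T)"
    using assms keys_frag_extend[of f x] by fastforce
qed (simp add: frag_extend_add)

definition pure_tensor :: "'a monoid \<Rightarrow> 'b monoid \<Rightarrow> 'a \<Rightarrow> 'b \<Rightarrow> ('a \<times> 'b \<Rightarrow>\<^sub>0 int) set" where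
  "pure_tensor A B a b =
     tensor_relations A B #>\<^bsub>free_Abelian_group (carrier A \<times> carrier B)\<^esub> frag_of (a, b)"

locale coefficient_group = B: comm_group B for B :: "'b monoid"
begin

abbreviation free :: "'a monoid \<Rightarrow> ('a \<times> 'b \<Rightarrow>\<^sub>0 int) monoid" where
  "free A \<equiv> free_Abelian_group (carrier A \<times> carrier B)"

definition relators :: "'a monoid \<Rightarrow> ('a \<times> 'b \<Rightarrow>\<^sub>0 int) set" where
  "relators A =
     {frag_of (a \<otimes>\<^bsub>A\<^esub> a', b) - frag_of (a, b) - frag_of (a', b) | a a' b.
           a \<in> carrier A \<and> a' \<in> carrier A \<and> b \<in> carrier B} \<union>
     {frag_of (a, b \<otimes>\<^bsub>B\<^esub> b') - frag_of (a, b) - frag_of (a, b') | a b b'.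
           a \<in> carrier A \<and> b \<in> carrier B \<and> b' \<in> carrier B}"

lemma tensor_relations_eq: "tensor_relations A B = generate (free A) (relators A)"
  by (simp add: tensor_relations_def relators_def)

lemma relators_closed:
  assumes "comm_group A"
  shows "relators A \<subseteq> carrier (free A)"
proof -
  interpret A: comm_group A by fact
  have diff: "x - y \<in> carrier (free A)" if "x \<in> carrier (free A)" "y \<in> carrier (free A)" for x y
    using that keys_diff[of x y] by auto
  show ?thesis
    unfolding relators_def by (auto intro!: diff simp del: carrier_free_Abelian_group_iff)
qed

lemma subgroup_relations: "comm_group A \<Longrightarrow> subgroup (tensor_relations A B) (free A)"
  unfolding tensor_relations_eq
  using group.generate_is_subgroup[OF group_free_Abelian_group relators_closed] by blast

lemma normal_relations: "comm_group A \<Longrightarrow> tensor_relations A B \<lhd> free A"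
  using comm_group.subgroup_imp_normal[OF abelian_free_Abelian_group subgroup_relations] by blast

lemma comm_group_tensor: "comm_group A \<Longrightarrow> comm_group (tensor A B)"
  unfolding tensor_def
  by (rule comm_group.abelian_FactGroup[OF abelian_free_Abelian_group subgroup_relations])

lemma coset_hom:
  "comm_group A \<Longrightarrow> (\<lambda>x. tensor_relations A B #>\<^bsub>free A\<^esub> x) \<in> hom (free A) (tensor A B)"
  unfolding tensor_def by (rule normal.r_coset_hom_Mod[OF normal_relations])

text \<open>
  Pure tensors generate.  All identities that make the tensor product an additive functor are
  checked on them.
\<close>

lemma tensor_eqI:
  assumes "comm_group A" "comm_group H" "f \<in> hom (tensor A B) H" "g \<in> hom (tensor A B) H"
    and "\<And>a b. a \<in> carrier A \<Longrightarrow> b \<in> carrier B \<Longrightarrow> f (pure_tensor A B a b) = g (pure_tensor A B a b)"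
    and x: "x \<in> carrier (tensor A B)"
  shows "f x = g x"
proof -
  interpret H: comm_group H by fact
  obtain y where y: "y \<in> carrier (free A)" and xy: "x = tensor_relations A B #>\<^bsub>free A\<^esub> y"
    using x by (auto simp: tensor_def carrier_FactGroup)
  have "f (tensor_relations A B #>\<^bsub>free A\<^esub> y) = g (tensor_relations A B #>\<^bsub>free A\<^esub> y)"
    by (rule free_Abelian_group_hom_eqI[OF H.group_axioms _ _ _ y])
      (use assms coset_hom in \<open>auto simp: pure_tensor_def intro: hom_comp\<close>)
  then show ?thesis
    by (simp add: xy)
qed

lemma pure_tensor_closed:
  "comm_group A \<Longrightarrow> a \<in> carrier A \<Longrightarrow> b \<in> carrier B \<Longrightarrow> pure_tensor A B a b \<in> carrier (tensor A B)"
  unfolding pure_tensor_def by (rule hom_in_carrier[OF coset_hom]) auto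

lemma pure_tensor_mult:
  assumes "comm_group A" "a \<in> carrier A" "a' \<in> carrier A" "b \<in> carrier B"
  shows "pure_tensor A B (a \<otimes>\<^bsub>A\<^esub> a') b = pure_tensor A B a b \<otimes>\<^bsub>tensor A B\<^esub> pure_tensor A B a' b"
proof -
  interpret A: comm_group A by fact
  let ?F = "free A" and ?R = "tensor_relations A B"
  let ?x = "frag_of (a \<otimes>\<^bsub>A\<^esub> a', b)" and ?y = "frag_of (a, b) + frag_of (a', b)"
  have "?x - frag_of (a, b) - frag_of (a', b) \<in> ?R"
    unfolding tensor_relations_eq by (rule generate.incl) (use assms in \<open>auto simp: relators_def\<close>)
  then have "?x - ?y \<in> ?R"
    by (simp add: algebra_simps)
  moreover have "?x = (?x - ?y) \<otimes>\<^bsub>?F\<^esub> ?y"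
    by simp
  ultimately have "?x \<in> ?R #>\<^bsub>?F\<^esub> ?y"
    unfolding r_coset_def by blast
  moreover have y: "?y \<in> carrier ?F"
    using assms keys_add[of "frag_of (a, b)" "frag_of (a', b)"] by auto
  ultimately have "?R #>\<^bsub>?F\<^esub> ?x = ?R #>\<^bsub>?F\<^esub> ?y"
    using group.repr_independence[OF group_free_Abelian_group _ _ subgroup_relations[OF assms(1)]] by metis
  also have "\<dots> = (?R #>\<^bsub>?F\<^esub> frag_of (a, b)) \<otimes>\<^bsub>tensor A B\<^esub> (?R #>\<^bsub>?F\<^esub> frag_of (a', b))"
    using hom_mult[OF coset_hom[OF assms(1)], of "frag_of (a, b)" "frag_of (a', b)"] assms by simp
  finally show ?thesis
    by (simp add: pure_tensor_def)
qed

lemma pure_tensor_one: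
  assumes "comm_group A" "b \<in> carrier B"
  shows "pure_tensor A B \<one>\<^bsub>A\<^esub> b = \<one>\<^bsub>tensor A B\<^esub>"
proof -
  interpret A: comm_group A by fact
  interpret T: comm_group "tensor A B"
    using assms(1) by (rule comm_group_tensor)
  show ?thesis
    using pure_tensor_mult[OF assms(1) A.one_closed A.one_closed assms(2)]
      pure_tensor_closed[OF assms(1) A.one_closed assms(2)] by simp
qed

lemma pair_hom_tensor:
  assumes "comm_group A" "comm_group A'" and h: "h \<in> hom A A'"
  shows "pair_hom (free A) (tensor_relations A B) (free A') (tensor_relations A' B)
    (frag_extend (\<lambda>(a, b). frag_of (h a, b)))"
proof -
  let ?h = "frag_extend (\<lambda>(a, b). frag_of (h a, b))"
  have hom: "?h \<in> hom (free A) (free A')"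
    by (rule frag_extend_hom) (use hom_in_carrier[OF h] in auto)
  then interpret H: group_hom "free A" "free A'" ?h
    by (simp add: group_hom_def group_hom_axioms_def)
  have "?h x \<in> relators A'" if x: "x \<in> relators A" for x
  proof -
    note h_closed = hom_in_carrier[OF h]
    consider (left) a a' b where "x = frag_of (a \<otimes>\<^bsub>A\<^esub> a', b) - frag_of (a, b) - frag_of (a', b)"
        "a \<in> carrier A" "a' \<in> carrier A" "b \<in> carrier B"
      | (right) a b b' where "x = frag_of (a, b \<otimes>\<^bsub>B\<^esub> b') - frag_of (a, b) - frag_of (a, b')"
        "a \<in> carrier A" "b \<in> carrier B" "b' \<in> carrier B"
      using x unfolding relators_def by blast
    then show ?thesis
    proof cases
      case left
      then have "?h x = frag_of (h a \<otimes>\<^bsub>A'\<^esub> h a', b) - frag_of (h a, b) - frag_of (h a', b)"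
        by (simp add: frag_extend_diff hom_mult[OF h])
      with left h_closed show ?thesis
        unfolding relators_def by blast
    next
      case right
      then have "?h x = frag_of (h a, b \<otimes>\<^bsub>B\<^esub> b') - frag_of (h a, b) - frag_of (h a, b')"
        by (simp add: frag_extend_diff)
      with right h_closed show ?thesis
        unfolding relators_def by blast
    qed
  qed
  then have "?h ` tensor_relations A B \<subseteq> tensor_relations A' B"
    unfolding tensor_relations_eq H.generate_img[OF relators_closed[OF assms(1)], symmetric]
    by (intro group.mono_generate) auto
  then show ?thesis
    using assms hom by (intro pair_hom.intro pair_hom_axioms.intro abelian_free_Abelian_group subgroup_relations)
qed

lemma tensor_map_hom:
  "comm_group A \<Longrightarrow> comm_group A' \<Longrightarrow> h \<in> hom A A' \<Longrightarrow> tensor_map A' B h \<in> hom (tensor A B) (tensor A' B)"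
  using pair_hom.quot_map_hom[OF pair_hom_tensor] by (simp add: tensor_map_def tensor_def)

lemma tensor_map_pure:
  assumes "comm_group A" "comm_group A'" "h \<in> hom A A'" "a \<in> carrier A" "b \<in> carrier B"
  shows "tensor_map A' B h (pure_tensor A B a b) = pure_tensor A' B (h a) b"
  using pair_hom.quot_map_coset[OF pair_hom_tensor[OF assms(1-3)], of "frag_of (a, b)"] assms
  by (simp add: tensor_map_def pure_tensor_def)

lemma tensor_map_left_inverse:
  assumes "comm_group A" "comm_group A'" "f \<in> hom A A'" "g \<in> hom A' A"
    "\<And>a. a \<in> carrier A \<Longrightarrow> g (f a) = a" "x \<in> carrier (tensor A B)"
  shows "tensor_map A B g (tensor_map A' B f x) = x"
  using assms(1) comm_group_tensor[OF assms(1)] _ _ _ assms(6)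
  by (rule tensor_eqI)
    (use assms in \<open>auto intro!: hom_comp[OF tensor_map_hom tensor_map_hom] hom_ident
      simp: tensor_map_pure hom_in_carrier\<close>)

lemma tensor_map_comp_one:
  assumes "comm_group A" "comm_group A'" "comm_group A''" "f \<in> hom A A'" "g \<in> hom A' A''"
    "\<And>a. a \<in> carrier A \<Longrightarrow> g (f a) = \<one>\<^bsub>A''\<^esub>" "x \<in> carrier (tensor A B)"
  shows "tensor_map A'' B g (tensor_map A' B f x) = \<one>\<^bsub>tensor A'' B\<^esub>"
  using assms(1) comm_group_tensor[OF assms(3)] _ _ _ assms(7)
  by (rule tensor_eqI)
    (use assms comm_group.axioms(2)[OF comm_group_tensor[OF assms(3)]]
     in \<open>auto intro!: hom_comp[OF tensor_map_hom tensor_map_hom] hom_const_one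
      simp: tensor_map_pure hom_in_carrier pure_tensor_one\<close>)

lemma tensor_map_commute:
  assumes "comm_group A" "comm_group A'" "comm_group A''" "comm_group H"
    "f \<in> hom A A'" "g \<in> hom A' H" "f' \<in> hom A A''" "g' \<in> hom A'' H"
    "\<And>a. a \<in> carrier A \<Longrightarrow> g (f a) = g' (f' a)" "x \<in> carrier (tensor A B)"
  shows "tensor_map H B g (tensor_map A' B f x) = tensor_map H B g' (tensor_map A'' B f' x)"
  using assms(1) comm_group_tensor[OF assms(4)] _ _ _ assms(10)
  by (rule tensor_eqI)
    (use assms in \<open>auto intro!: hom_comp[OF tensor_map_hom tensor_map_hom]
      simp: tensor_map_pure hom_in_carrier\<close>)

abbreviation T :: "'c chain_complex \<Rightarrow> ('c \<times> 'b \<Rightarrow>\<^sub>0 int) set chain_complex" where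
  "T C \<equiv> tensor_complex C B"

lemma grp_T: "grp (T C) k = tensor (grp C k) B" and bd_T: "bd (T C) k = tensor_map (grp C (k - 1)) B (bd C k)"
  by (simp_all add: tensor_complex_def)

lemma abelian_complex_tensor:
  assumes "abelian_complex C"
  shows "abelian_complex (T C)"
proof -
  interpret C: abelian_complex C by fact
  note T_hom = tensor_map_hom[OF C.comm_group_grp C.comm_group_grp]
    and T_pure = tensor_map_pure[OF C.comm_group_grp C.comm_group_grp]
    and group_T = comm_group.axioms(2)[OF comm_group_tensor[OF C.comm_group_grp]]
  show ?thesis
  proof (rule abelian_complex.intro)
    fix k
    show "comm_group (grp (T C) k)"
      using comm_group_tensor[OF C.comm_group_grp] by (simp add: grp_T)
    show "bd (T C) k \<in> hom (grp (T C) k) (grp (T C) (k - 1))"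
      using T_hom[OF C.bd_hom] by (simp add: grp_T bd_T)
    fix x assume "x \<in> carrier (grp (T C) k)"
    then have x: "x \<in> carrier (tensor (grp C k) B)"
      by (simp add: grp_T)
    show "bd (T C) (k - 1) (bd (T C) k x) = \<one>\<^bsub>grp (T C) (k - 1 - 1)\<^esub>"
      unfolding grp_T bd_T
      by (rule tensor_map_comp_one[OF C.comm_group_grp C.comm_group_grp C.comm_group_grp C.bd_hom C.bd_hom C.bd_bd x])
  next
    fix x assume "x \<in> carrier (grp (T C) 0)"
    then have x: "x \<in> carrier (tensor (grp C 0) B)"
      by (simp add: grp_T)
    have "tensor_map (grp C 0) B (bd C 0) x = \<one>\<^bsub>tensor (grp C 0) B\<^esub>"
      by (rule tensor_eqI[OF C.comm_group_grp comm_group_tensor[OF C.comm_group_grp] _ _ _ x])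
        (use group_T C.bd_hom[of 0] in \<open>auto intro!: hom_const_one T_hom
          simp: T_pure C.bd_0 pure_tensor_one C.comm_group_grp\<close>)
    then show "bd (T C) 0 x = \<one>\<^bsub>grp (T C) 0\<^esub>"
      by (simp add: grp_T bd_T)
  qed
qed

abbreviation T_map :: "'d chain_complex \<Rightarrow> (nat \<Rightarrow> 'c \<Rightarrow> 'd) \<Rightarrow> nat \<Rightarrow>
    ('c \<times> 'b \<Rightarrow>\<^sub>0 int) set \<Rightarrow> ('d \<times> 'b \<Rightarrow>\<^sub>0 int) set" where
  "T_map C' h k \<equiv> tensor_map (grp C' k) B (h k)"

lemma chain_hom_tensor:
  assumes "chain_hom C C' h"
  shows "chain_hom (T C) (T C') (T_map C' h)"
proof -
  interpret chain_hom C C' h by fact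
  note CG = C.comm_group_grp C'.comm_group_grp
  show ?thesis
  proof (intro chain_hom.intro chain_hom_axioms.intro abelian_complex_tensor
      C.abelian_complex_axioms C'.abelian_complex_axioms)
    fix k
    show "T_map C' h k \<in> hom (grp (T C) k) (grp (T C') k)"
      using tensor_map_hom[OF CG hom] by (simp add: grp_T)
    fix x assume "x \<in> carrier (grp (T C) k)"
    then have x: "x \<in> carrier (tensor (grp C k) B)"
      by (simp add: grp_T)
    show "bd (T C') k (T_map C' h k x) = T_map C' h (k - 1) (bd (T C) k x)"
      unfolding grp_T bd_T
      by (rule tensor_map_commute[OF CG(1) CG(2) CG(1) CG(2) hom C'.bd_hom C.bd_hom hom bd_h x])
  qed
qed

text \<open>
  Tensoring preserves composition, identities and pointwise sums of homomorphisms, hence every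
  structure that is given by equations between such expressions; the next lemmas are instances.
\<close>

lemma deformation_retract_tensor:
  assumes "deformation_retract C C' \<phi> g h"
  shows "deformation_retract (T C) (T C') (T_map C' \<phi>) (T_map C g) (T_map C' h)"
proof -
  interpret deformation_retract C C' \<phi> g h by fact
  note CG = \<phi>.C.comm_group_grp \<phi>.C'.comm_group_grp
  show ?thesis
  proof (intro deformation_retract.intro deformation_retract_axioms.intro chain_hom_tensor
      \<phi>.chain_hom_axioms g.chain_hom_axioms)
    fix k
    show "T_map C' h k \<in> hom (grp (T C') (k - 1)) (grp (T C') k)"
      using tensor_map_hom[OF CG(2) CG(2) h_hom] by (simp add: grp_T)
    show "T_map C g k (T_map C' \<phi> k x) = x" if "x \<in> carrier (grp (T C) k)" for x
      using that g_\<phi> unfolding grp_T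
      by (intro tensor_map_left_inverse CG \<phi>.hom g.hom)
    show "T_map C' h k (T_map C' \<phi> (k - 1) x) = \<one>\<^bsub>grp (T C') k\<^esub>"
      if "x \<in> carrier (grp (T C) (k - 1))" for x
      using that h_\<phi> unfolding grp_T
      by (intro tensor_map_comp_one[of "grp C (k - 1)"] CG \<phi>.hom h_hom)
    fix x assume "x \<in> carrier (grp (T C') k)"
    then have x: "x \<in> carrier (tensor (grp C' k) B)"
      by (simp add: grp_T)
    let ?T = "tensor (grp C' k) B" and ?bd' = "tensor_map (grp C' k) B (bd C' (Suc k))"
      and ?bd = "tensor_map (grp C' (k - 1)) B (bd C' k)"
    have hom1: "(\<lambda>x. T_map C' \<phi> k (T_map C g k x)) \<in> hom (?T) (?T)"
      by (rule hom_comp[OF tensor_map_hom tensor_map_hom]) (rule CG \<phi>.hom g.hom)+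
    have bd_Suc_hom: "bd C' (Suc k) \<in> hom (grp C' (Suc k)) (grp C' k)"
      using \<phi>.C'.bd_hom[of "Suc k"] by simp
    have hom2: "(\<lambda>x. ?bd' (T_map C' h (Suc k) x))
        \<in> hom (?T) (?T)"
      by (rule hom_comp[OF tensor_map_hom tensor_map_hom]) (rule CG h_Suc_hom bd_Suc_hom)+
    have hom3: "(\<lambda>x. T_map C' h k (?bd x))
        \<in> hom (?T) (?T)"
      by (rule hom_comp[OF tensor_map_hom tensor_map_hom]) (rule CG h_hom \<phi>.C'.bd_hom)+
    have closed: "\<phi> k (g k a) \<in> carrier (grp C' k)" "h (Suc k) a \<in> carrier (grp C' (Suc k))"
      "h k (bd C' k a) \<in> carrier (grp C' k)" "bd C' (Suc k) (h (Suc k) a) \<in> carrier (grp C' k)"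
      "g k a \<in> carrier (grp C k)" "bd C' k a \<in> carrier (grp C' (k - 1))"
      if "a \<in> carrier (grp C' k)" for a
      using that \<phi>.closed g.closed \<phi>.C'.bd_closed \<phi>.C'.bd_closed_Suc
        hom_in_carrier[OF h_hom] hom_in_carrier[OF h_Suc_hom] by auto
    have "x = (T_map C' \<phi> k (T_map C g k x) \<otimes>\<^bsub>?T\<^esub>
        ?bd' (T_map C' h (Suc k) x))
        \<otimes>\<^bsub>?T\<^esub> T_map C' h k (?bd x)"
    proof (rule tensor_eqI[OF CG(2)[of k] comm_group_tensor[OF CG(2)[of k]] _ _ _ x])
      fix a b assume a: "a \<in> carrier (grp C' k)" and b: "b \<in> carrier B"
      have "pure_tensor (grp C' k) B a b = pure_tensor (grp C' k) B
          ((\<phi> k (g k a) \<otimes>\<^bsub>grp C' k\<^esub> bd C' (Suc k) (h (Suc k) a)) \<otimes>\<^bsub>grp C' k\<^esub> h k (bd C' k a)) b"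
        using homotopy[OF a] by simp
      also have "\<dots> = (T_map C' \<phi> k (T_map C g k (pure_tensor (grp C' k) B a b)) \<otimes>\<^bsub>?T\<^esub>
        ?bd' (T_map C' h (Suc k) (pure_tensor (grp C' k) B a b)))
        \<otimes>\<^bsub>?T\<^esub> T_map C' h k (?bd (pure_tensor (grp C' k) B a b))"
        using closed[OF a] a b
        by (simp add: tensor_map_pure[OF CG(2) CG(1) g.hom] tensor_map_pure[OF CG(1) CG(2) \<phi>.hom]
            tensor_map_pure[OF CG(2) CG(2) h_Suc_hom] tensor_map_pure[OF CG(2) CG(2) bd_Suc_hom]
            tensor_map_pure[OF CG(2) CG(2) h_hom] tensor_map_pure[OF CG(2) CG(2) \<phi>.C'.bd_hom]
            pure_tensor_mult CG del: One_nat_def)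
      finally show "pure_tensor (grp C' k) B a b = \<dots>" .
    qed (intro hom_ident hom_pointwise_mult hom1 hom2 hom3 comm_group_tensor CG)+
    then show "x = (T_map C' \<phi> k (T_map C g k x) \<otimes>\<^bsub>grp (T C') k\<^esub>
        bd (T C') (Suc k) (T_map C' h (Suc k) x)) \<otimes>\<^bsub>grp (T C') k\<^esub> T_map C' h k (bd (T C') k x)"
      by (simp add: grp_T bd_T)
  qed
qed

lemma retract_of_chain_hom_tensor:
  assumes "retract_of_chain_hom A A' a C C' c i r i' r'"
  shows "retract_of_chain_hom (T A) (T A') (T_map A' a) (T C) (T C') (T_map C' c)
    (T_map C i) (T_map A r) (T_map C' i') (T_map A' r')"
proof -
  interpret retract_of_chain_hom A A' a C C' c i r i' r' by fact
  note CG = a.C.comm_group_grp a.C'.comm_group_grp b.C.comm_group_grp b.C'.comm_group_grp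
  show ?thesis
  proof (intro retract_of_chain_hom.intro retract_of_chain_hom_axioms.intro chain_hom_tensor
      a.chain_hom_axioms b.chain_hom_axioms i.chain_hom_axioms r.chain_hom_axioms
      i'.chain_hom_axioms r'.chain_hom_axioms; unfold grp_T)
    fix k
    show "T_map A r k (T_map C i k x) = x" if "x \<in> carrier (tensor (grp A k) B)" for x
      by (rule tensor_map_left_inverse[OF CG(1) CG(3) i.hom r.hom r_i that])
    show "T_map A' r' k (T_map C' i' k x) = x" if "x \<in> carrier (tensor (grp A' k) B)" for x
      by (rule tensor_map_left_inverse[OF CG(2) CG(4) i'.hom r'.hom r'_i' that])
    show "T_map C' c k (T_map C i k x) = T_map C' i' k (T_map A' a k x)"
      if "x \<in> carrier (tensor (grp A k) B)" for x
      by (rule tensor_map_commute[OF CG(1) CG(3) CG(2) CG(4) i.hom b.hom a.hom i'.hom b_i that])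
    show "T_map A' r' k (T_map C' c k x) = T_map A' a k (T_map A r k x)"
      if "x \<in> carrier (tensor (grp C k) B)" for x
      by (rule tensor_map_commute[OF CG(3) CG(4) CG(1) CG(2) b.hom r'.hom r.hom a.hom r'_b that])
  qed
qed

lemma split_exact_tensor:
  assumes "split_exact A C E i p r s"
  shows "split_exact (T A) (T C) (T E) (T_map C i) (T_map E p) (T_map A r) (T_map C s)"
proof -
  interpret split_exact A C E i p r s by fact
  note CG = i.C.comm_group_grp i.C'.comm_group_grp p.C'.comm_group_grp
  show ?thesis
  proof (intro split_exact.intro split_exact_axioms.intro chain_hom_tensor
      i.chain_hom_axioms p.chain_hom_axioms; unfold grp_T)
    fix k
    show "T_map A r k \<in> hom (tensor (grp C k) B) (tensor (grp A k) B)"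
      by (rule tensor_map_hom[OF CG(2) CG(1) r_hom])
    show "T_map C s k \<in> hom (tensor (grp E k) B) (tensor (grp C k) B)"
      by (rule tensor_map_hom[OF CG(3) CG(2) s_hom])
    show "T_map A r k (T_map C i k x) = x" if "x \<in> carrier (tensor (grp A k) B)" for x
      using that r_i by (intro tensor_map_left_inverse CG i.hom r_hom)
    show "T_map E p k (T_map C s k x) = x" if "x \<in> carrier (tensor (grp E k) B)" for x
      using that p_s by (intro tensor_map_left_inverse CG p.hom s_hom)
    show "T_map E p k (T_map C i k x) = \<one>\<^bsub>tensor (grp E k) B\<^esub>" if "x \<in> carrier (tensor (grp A k) B)" for x
      using that p_i by (intro tensor_map_comp_one[of "grp A k"] CG p.hom i.hom)
    fix x assume x: "x \<in> carrier (tensor (grp C k) B)"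
    have hom1: "(\<lambda>x. T_map C i k (T_map A r k x)) \<in> hom (tensor (grp C k) B) (tensor (grp C k) B)"
      by (rule hom_comp[OF tensor_map_hom tensor_map_hom]) (rule CG i.hom r_hom)+
    have hom2: "(\<lambda>x. T_map C s k (T_map E p k x)) \<in> hom (tensor (grp C k) B) (tensor (grp C k) B)"
      by (rule hom_comp[OF tensor_map_hom tensor_map_hom]) (rule CG p.hom s_hom)+
    show "x = T_map C i k (T_map A r k x) \<otimes>\<^bsub>tensor (grp C k) B\<^esub> T_map C s k (T_map E p k x)"
    proof (rule tensor_eqI[OF CG(2)[of k] comm_group_tensor[OF CG(2)[of k]] _ _ _ x])
      fix a b assume a: "a \<in> carrier (grp C k)" and b: "b \<in> carrier B"
      have closed: "r k a \<in> carrier (grp A k)" "p k a \<in> carrier (grp E k)"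
        "i k (r k a) \<in> carrier (grp C k)" "s k (p k a) \<in> carrier (grp C k)"
        using a hom_in_carrier[OF r_hom] hom_in_carrier[OF s_hom] i.closed p.closed by auto
      have "pure_tensor (grp C k) B a b
          = pure_tensor (grp C k) B (i k (r k a) \<otimes>\<^bsub>grp C k\<^esub> s k (p k a)) b"
        using splitting[OF a] by simp
      also have "\<dots> = T_map C i k (T_map A r k (pure_tensor (grp C k) B a b)) \<otimes>\<^bsub>tensor (grp C k) B\<^esub>
          T_map C s k (T_map E p k (pure_tensor (grp C k) B a b))"
        using closed a b
        by (simp add: tensor_map_pure[OF CG(2) CG(1) r_hom] tensor_map_pure[OF CG(1) CG(2) i.hom]
            tensor_map_pure[OF CG(2) CG(3) p.hom] tensor_map_pure[OF CG(3) CG(2) s_hom]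
            pure_tensor_mult CG)
      finally show "pure_tensor (grp C k) B a b = \<dots>" .
    qed (intro hom_ident hom_pointwise_mult hom1 hom2 comm_group_tensor CG)+
  qed
qed

lemma split_exact_map_tensor:
  assumes "split_exact_map A C E i p r s A' C' E' i' p' r' s' a c e"
  shows "split_exact_map (T A) (T C) (T E) (T_map C i) (T_map E p) (T_map A r) (T_map C s)
     (T A') (T C') (T E') (T_map C' i') (T_map E' p') (T_map A' r') (T_map C' s')
     (T_map A' a) (T_map C' c) (T_map E' e)"
proof -
  interpret split_exact_map A C E i p r s A' C' E' i' p' r' s' a c e by fact
  note CG = S.i.C.comm_group_grp S.i.C'.comm_group_grp S.p.C'.comm_group_grp
    S'.i.C.comm_group_grp S'.i.C'.comm_group_grp S'.p.C'.comm_group_grp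
  show ?thesis
  proof (intro split_exact_map.intro split_exact_map_axioms.intro chain_hom_tensor split_exact_tensor
      a.chain_hom_axioms b.chain_hom_axioms e.chain_hom_axioms S.split_exact_axioms S'.split_exact_axioms;
      unfold grp_T)
    fix k
    show "T_map C' c k (T_map C i k x) = T_map C' i' k (T_map A' a k x)"
      if "x \<in> carrier (tensor (grp A k) B)" for x
      by (rule tensor_map_commute[OF CG(1) CG(2) CG(4) CG(5) S.i.hom b.hom a.hom S'.i.hom b_i that])
    show "T_map E' e k (T_map E p k x) = T_map E' p' k (T_map C' c k x)"
      if "x \<in> carrier (tensor (grp C k) B)" for x
      by (rule tensor_map_commute[OF CG(2) CG(3) CG(5) CG(6) S.p.hom e.hom b.hom S'.p.hom e_p that])
  qed
qed

end

section \<open>Homology isomorphisms with either kind of coefficients\<close>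

lemma comm_group_field_group: "comm_group (field_group :: 'f::field monoid)"
proof (intro group.group_comm_groupI groupI)
  fix x :: 'f
  show "\<exists>y\<in>carrier field_group. y \<otimes>\<^bsub>field_group\<^esub> x = \<one>\<^bsub>field_group\<^esub>"
    by (rule bexI[of _ "- x"]) (simp_all add: field_group_def)
qed (simp_all add: field_group_def add_ac)

interpretation field_coefficients: coefficient_group "field_group :: 'f::field monoid"
  by (rule coefficient_group.intro) (rule comm_group_field_group)

lemma homology_iso_Integer_iff:
  "chain_hom C C' h \<Longrightarrow> homology_iso Integer_coeffs C C' h \<longleftrightarrow> quasi_iso C C' h"
  using chain_hom.homology_iso_iff_quasi_iso by simp

text \<open>
  Field coefficients thus become ordinary homology of the tensored complexes, so that each of the
  criteria for quasi-isomorphisms holds for both kinds of coefficients.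
\<close>

lemma homology_iso_Field_iff:
  fixes C :: "'c chain_complex" and C' :: "'d chain_complex"
  defines "F \<equiv> field_group :: 'f::field monoid"
  assumes "chain_hom C C' h"
  shows "homology_iso (Field_coeffs :: 'f coefficients) C C' h \<longleftrightarrow>
    quasi_iso (tensor_complex C F) (tensor_complex C' F) (\<lambda>k. tensor_map (grp C' k) F (h k))"
  using chain_hom.homology_iso_iff_quasi_iso[OF field_coefficients.chain_hom_tensor[OF assms(2)]]
  by (simp add: F_def Let_def)

lemma (in deformation_retract) homology_iso:
  fixes c :: "'f::field coefficients"
  shows "homology_iso c C C' \<phi>"
proof (cases c)
  case Integer_coeffs
  then show ?thesis
    using quasi_iso homology_iso_Integer_iff[OF \<phi>.chain_hom_axioms] by metis
next
  case Field_coeffs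
  show ?thesis
    unfolding Field_coeffs homology_iso_Field_iff[OF \<phi>.chain_hom_axioms]
    by (rule deformation_retract.quasi_iso)
      (rule field_coefficients.deformation_retract_tensor, rule deformation_retract_axioms)
qed

lemma (in retract_of_chain_hom) homology_iso_retract:
  fixes c :: "'f::field coefficients"
  assumes "homology_iso c B B' b"
  shows "homology_iso c A A' a"
proof (cases c)
  case Integer_coeffs
  then show ?thesis
    using assms quasi_iso_retract homology_iso_Integer_iff[OF a.chain_hom_axioms]
      homology_iso_Integer_iff[OF b.chain_hom_axioms] by metis
next
  case Field_coeffs
  show ?thesis
    using assms
    unfolding Field_coeffs homology_iso_Field_iff[OF a.chain_hom_axioms]
      homology_iso_Field_iff[OF b.chain_hom_axioms]
    by (rule retract_of_chain_hom.quasi_iso_retract[rotated])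
      (rule field_coefficients.retract_of_chain_hom_tensor, rule retract_of_chain_hom_axioms)
qed

context split_exact_map
begin

lemma homology_iso_left:
  fixes c :: "'g::field coefficients"
  assumes "homology_iso c B B' b" "homology_iso c E E' e"
  shows "homology_iso c A A' a"
proof (cases c)
  case Integer_coeffs
  then show ?thesis
    using assms quasi_iso_left homology_iso_Integer_iff[OF a.chain_hom_axioms]
      homology_iso_Integer_iff[OF b.chain_hom_axioms] homology_iso_Integer_iff[OF e.chain_hom_axioms]
    by metis
next
  case Field_coeffs
  show ?thesis
    using assms
    unfolding Field_coeffs homology_iso_Field_iff[OF a.chain_hom_axioms]
      homology_iso_Field_iff[OF b.chain_hom_axioms] homology_iso_Field_iff[OF e.chain_hom_axioms]
    by (rule split_exact_map.quasi_iso_left[rotated])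
      (rule field_coefficients.split_exact_map_tensor, rule split_exact_map_axioms)
qed

lemma homology_iso_right:
  fixes c :: "'g::field coefficients"
  assumes "homology_iso c A A' a" "homology_iso c B B' b"
  shows "homology_iso c E E' e"
proof (cases c)
  case Integer_coeffs
  then show ?thesis
    using assms quasi_iso_right homology_iso_Integer_iff[OF a.chain_hom_axioms]
      homology_iso_Integer_iff[OF b.chain_hom_axioms] homology_iso_Integer_iff[OF e.chain_hom_axioms]
    by metis
next
  case Field_coeffs
  show ?thesis
    using assms
    unfolding Field_coeffs homology_iso_Field_iff[OF a.chain_hom_axioms]
      homology_iso_Field_iff[OF b.chain_hom_axioms] homology_iso_Field_iff[OF e.chain_hom_axioms]
    by (rule split_exact_map.quasi_iso_right[rotated])
      (rule field_coefficients.split_exact_map_tensor, rule split_exact_map_axioms)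
qed

end

section \<open>Chain complexes with a basis\<close>

lemma frag_extend_frag_extend:
  "frag_extend f (frag_extend g c) = frag_extend (\<lambda>x. frag_extend f (g x)) c"
  using subset_UNIV
  by (induction c rule: frag_induction) (auto simp: frag_extend_diff)

lemma grp_chains [simp]: "grp (chains S t) k = free_Abelian_group {\<sigma> \<in> simplices S t. dimn S \<sigma> = k}"
  by (simp add: chains_def)

lemma bd_chains:
  "bd (chains S t) 0 x = 0" "bd (chains S t) (Suc k) x = frag_extend (face_sum S t) x"
  by (simp_all add: chains_def)

lemma carrier_chains: "x \<in> carrier (grp (chains S t) k) \<longleftrightarrow> x \<in> graded_span S (simplices S t) k"
  by (simp add: graded_span_def)

text \<open>
  The property of subcomplexes that makes their spans sub-chain complexes, common to sets of lists
  and sets of sets.  Faces are only required in positive dimension, because the formal boundary of a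
  vertex is the empty simplex.
\<close>

definition face_closed :: "('i, 's) persistence_system \<Rightarrow> 'i \<Rightarrow> 's set \<Rightarrow> bool" where
  "face_closed S t A \<longleftrightarrow> A \<subseteq> simplices S t \<and>
     (\<forall>\<sigma>\<in>A. 0 < dimn S \<sigma> \<longrightarrow> Poly_Mapping.keys (face_sum S t \<sigma>) \<subseteq> A)"

locale based_complex =
  fixes S :: "('i, 's) persistence_system" and t :: 'i
  assumes face: "\<And>\<sigma>. \<sigma> \<in> simplices S t \<Longrightarrow> 0 < dimn S \<sigma> \<Longrightarrow>
      face_sum S t \<sigma> \<in> carrier (free_Abelian_group {\<tau> \<in> simplices S t. dimn S \<tau> = dimn S \<sigma> - 1})"
    and face_face: "\<And>\<sigma>. \<sigma> \<in> simplices S t \<Longrightarrow> 1 < dimn S \<sigma> \<Longrightarrow>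
      frag_extend (face_sum S t) (face_sum S t \<sigma>) = 0"
begin

lemma abelian_complex_chains: "abelian_complex (chains S t)"
proof (rule abelian_complex.intro)
  fix k
  show "comm_group (grp (chains S t) k)"
    by (simp add: abelian_free_Abelian_group)
  show "bd (chains S t) k \<in> hom (grp (chains S t) k) (grp (chains S t) (k - 1))"
  proof (cases k)
    case 0
    then show ?thesis
      by (auto intro!: homI simp: bd_chains)
  next
    case (Suc j)
    have "frag_extend (face_sum S t) \<in> hom (grp (chains S t) k) (grp (chains S t) j)"
      unfolding grp_chains by (rule frag_extend_hom) (use face Suc in fastforce)
    then show ?thesis
      using Suc by (simp add: chains_def)
  qed
  fix x assume x: "x \<in> carrier (grp (chains S t) k)"
  show "bd (chains S t) (k - 1) (bd (chains S t) k x) = \<one>\<^bsub>grp (chains S t) (k - 1 - 1)\<^esub>"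
  proof (cases "1 < k")
    case False
    then show ?thesis
      by (simp add: chains_def)
  next
    case True
    have "frag_extend (face_sum S t) (frag_extend (face_sum S t) x)
        = frag_extend (\<lambda>\<sigma>. frag_extend (face_sum S t) (face_sum S t \<sigma>)) x"
      by (rule frag_extend_frag_extend)
    also have "\<dots> = 0"
      by (rule frag_extend_eq_0) (use x True face_face in auto)
    finally show ?thesis
      using True by (simp add: chains_def)
  qed
qed (simp add: bd_chains)

sublocale abelian_complex "chains S t"
  by (rule abelian_complex_chains)

lemma subgroup_span:
  assumes "A \<subseteq> simplices S t"
  shows "subgroup (graded_span S A k) (grp (chains S t) k)"
proof (rule group.subgroupI[OF G.group_axioms])
  have span: "Poly_Mapping.keys x \<subseteq> {\<sigma> \<in> simplices S t. dimn S \<sigma> = k}" if "x \<in> graded_span S A k" for x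
    using that assms unfolding graded_span_def carrier_free_Abelian_group_iff by blast
  then show "graded_span S A k \<subseteq> carrier (grp (chains S t) k)"
    by auto
  show "inv\<^bsub>grp (chains S t) k\<^esub> x \<in> graded_span S A k" if "x \<in> graded_span S A k" for x
    using that span[OF that] by (simp add: graded_span_def)
  have "0 \<in> graded_span S A k"
    by (simp add: graded_span_def)
  then show "graded_span S A k \<noteq> {}"
    by blast
next
  fix x y assume "x \<in> graded_span S A k" "y \<in> graded_span S A k"
  then show "x \<otimes>\<^bsub>grp (chains S t) k\<^esub> y \<in> graded_span S A k"
    using keys_add[of x y] by (auto simp: graded_span_def)
qed

lemma bd_span:
  assumes "face_closed S t A" "x \<in> graded_span S A k"
  shows "bd (chains S t) k x \<in> graded_span S A (k - 1)"
proof (cases k)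
  case 0
  then show ?thesis
    by (simp add: bd_chains graded_span_def)
next
  case (Suc j)
  have "Poly_Mapping.keys (face_sum S t \<sigma>) \<subseteq> {\<tau> \<in> A. dimn S \<tau> = j}"
    if "\<sigma> \<in> Poly_Mapping.keys x" for \<sigma>
  proof -
    have "\<sigma> \<in> A" "dimn S \<sigma> = Suc j"
      using that assms(2) Suc by (auto simp: graded_span_def)
    then show ?thesis
      using face[of \<sigma>] assms(1) by (auto simp: face_closed_def)
  qed
  then have "Poly_Mapping.keys (frag_extend (face_sum S t) x) \<subseteq> {\<tau> \<in> A. dimn S \<tau> = j}"
    using keys_frag_extend[of "face_sum S t" x] by blast
  then show ?thesis
    by (simp add: Suc bd_chains graded_span_def)
qed

lemma subcomplex_span: "face_closed S t A \<Longrightarrow> subcomplex (chains S t) (graded_span S A)"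
  using subgroup_span bd_span
  by (intro subcomplex.intro subcomplex_axioms.intro abelian_complex_chains)
    (auto simp: sub_chain_complex_def face_closed_def)

lemma sub_chain_complex_span_inter:
  assumes H: "H \<subseteq> simplices S t"
  shows "sub_chain_complex (chains S t)
    (\<lambda>k. {x \<in> graded_span S H k. bd (chains S t) k x \<in> graded_span S H (k - 1)})"
    (is "sub_chain_complex _ ?I")
proof -
  have span: "x \<in> carrier (grp (chains S t) k)" if "x \<in> graded_span S H k" for x k
    using that subgroup_span[OF H] by (rule subgroup.mem_carrier[rotated])
  have "subgroup (?I k) (grp (chains S t) k)" for k
  proof (rule group.subgroupI[OF G.group_axioms])
    show "?I k \<subseteq> carrier (grp (chains S t) k)"
      using span by blast
    show "?I k \<noteq> {}"
      using subgroup.one_closed[OF subgroup_span[OF H], of k]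
        subgroup.one_closed[OF subgroup_span[OF H], of "k - 1"] bd_one[of k] by force
  next
    fix x assume "x \<in> ?I k"
    then show "inv\<^bsub>grp (chains S t) k\<^esub> x \<in> ?I k"
      using subgroup.m_inv_closed[OF subgroup_span[OF H], of x k]
        subgroup.m_inv_closed[OF subgroup_span[OF H], of "bd (chains S t) k x" "k - 1"]
      by (simp add: bd_inv span del: grp_chains)
  next
    fix x y assume "x \<in> ?I k" "y \<in> ?I k"
    then show "x \<otimes>\<^bsub>grp (chains S t) k\<^esub> y \<in> ?I k"
      using subgroup.m_closed[OF subgroup_span[OF H], of x k y]
        subgroup.m_closed[OF subgroup_span[OF H], of "bd (chains S t) k x" "k - 1" "bd (chains S t) k y"]
      by (simp add: bd_mult span del: grp_chains)
  qed
  moreover have "bd (chains S t) k x \<in> ?I (k - 1)" if "x \<in> ?I k" for k x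
  proof -
    have "bd (chains S t) (k - 1) (bd (chains S t) k x) = 0"
      using that bd_bd[of x k] span[of x k] by simp
    then show ?thesis
      using that by (simp add: graded_span_def)
  qed
  ultimately show ?thesis
    unfolding sub_chain_complex_def by blast
qed

text \<open>
  Chains in the span of \<open>H\<close> whose boundary is again in the span already form a sub-chain complex,
  since the boundary of a boundary is \<open>0\<close>; it clearly contains all others in the span.
\<close>

lemma Inf_complex_eq:
  assumes H: "H \<subseteq> simplices S t"
  shows "Inf_complex S t H
    = (\<lambda>k. {x \<in> graded_span S H k. bd (chains S t) k x \<in> graded_span S H (k - 1)})"
  unfolding Inf_complex_def largest_sub_chain_complex_def
proof (intro Greatest_equality conjI sub_chain_complex_span_inter[OF H])
  fix D assume D: "sub_chain_complex (chains S t) D \<and> D \<le> graded_span S H"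
  then have "bd (chains S t) k x \<in> graded_span S H (k - 1)" if "x \<in> D k" for k x
    using that unfolding sub_chain_complex_def le_fun_def by blast
  with D show "D \<le> (\<lambda>k. {x \<in> graded_span S H k. bd (chains S t) k x \<in> graded_span S H (k - 1)})"
    by (auto simp: le_fun_def)
qed (auto simp: le_fun_def)

lemma sub_chain_complex_Inf:
  "H \<subseteq> simplices S t \<Longrightarrow> sub_chain_complex (chains S t) (Inf_complex S t H)"
  using sub_chain_complex_span_inter by (simp only: Inf_complex_eq)

lemma Inf_complex_face_closed:
  assumes "face_closed S t A"
  shows "Inf_complex S t A = graded_span S A"
proof -
  have "A \<subseteq> simplices S t"
    using assms by (simp add: face_closed_def)
  then show ?thesis
    using bd_span[OF assms] by (auto simp: Inf_complex_eq)
qed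

end

section \<open>Chain maps that are injective on the basis\<close>

text \<open>
  The degree is a dummy argument: it gives the map the shape of a chain map.
\<close>

definition signed_map :: "('s \<Rightarrow> 'u) \<Rightarrow> ('s \<Rightarrow> int) \<Rightarrow> nat \<Rightarrow> ('s \<Rightarrow>\<^sub>0 int) \<Rightarrow> ('u \<Rightarrow>\<^sub>0 int)" where
  "signed_map F \<epsilon> k = frag_extend (\<lambda>\<sigma>. frag_cmul (\<epsilon> \<sigma>) (frag_of (F \<sigma>)))"

lemma chain_map_eq_signed_map: "chain_map S s t = signed_map (transition S s t) (\<lambda>_. 1)"
  by (simp add: chain_map_def signed_map_def fun_eq_iff)

text \<open>
  Chain maps that send basis elements, up to the signs \<open>\<epsilon>\<close>, to distinct basis elements.  Structure
  maps have trivial signs; signs occur for simplicial maps that do not respect the vertex orders.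
\<close>

locale based_map = C: based_complex S r + C': based_complex S' s
  for S :: "('i, 's) persistence_system" and r and S' :: "('j, 'u) persistence_system" and s +
  fixes F :: "'s \<Rightarrow> 'u" and \<epsilon> :: "'s \<Rightarrow> int"
  assumes F_simplex: "\<And>\<sigma>. \<sigma> \<in> simplices S r \<Longrightarrow> F \<sigma> \<in> simplices S' s"
    and F_dim: "\<And>\<sigma>. \<sigma> \<in> simplices S r \<Longrightarrow> dimn S' (F \<sigma>) = dimn S \<sigma>"
    and F_inj: "inj_on F (simplices S r)"
    and sign: "\<And>\<sigma>. \<sigma> \<in> simplices S r \<Longrightarrow> \<epsilon> \<sigma> * \<epsilon> \<sigma> = 1"
    and face_F: "\<And>\<sigma>. \<sigma> \<in> simplices S r \<Longrightarrow> 0 < dimn S \<sigma> \<Longrightarrow>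
      frag_cmul (\<epsilon> \<sigma>) (face_sum S' s (F \<sigma>)) = signed_map F \<epsilon> (dimn S \<sigma> - 1) (face_sum S r \<sigma>)"
begin

abbreviation push :: "nat \<Rightarrow> ('s \<Rightarrow>\<^sub>0 int) \<Rightarrow> ('u \<Rightarrow>\<^sub>0 int)" where
  "push \<equiv> signed_map F \<epsilon>"

text \<open>
  The left inverse of \<open>push\<close> that kills the basis elements outside the image of \<open>F\<close>.  It does not
  commute with the boundary maps.
\<close>

definition pull_simplex :: "'u \<Rightarrow> ('s \<Rightarrow>\<^sub>0 int)" where
  "pull_simplex \<tau> = (if \<tau> \<in> F ` simplices S r
     then let \<sigma> = inv_into (simplices S r) F \<tau> in frag_cmul (\<epsilon> \<sigma>) (frag_of \<sigma>) else 0)"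

lemma pull_simplex_F: "\<sigma> \<in> simplices S r \<Longrightarrow> pull_simplex (F \<sigma>) = frag_cmul (\<epsilon> \<sigma>) (frag_of \<sigma>)"
  by (simp add: pull_simplex_def F_inj)

definition pull :: "nat \<Rightarrow> ('u \<Rightarrow>\<^sub>0 int) \<Rightarrow> ('s \<Rightarrow>\<^sub>0 int)" where
  "pull k = frag_extend pull_simplex"

lemma keys_signed: "\<sigma> \<in> simplices S r \<Longrightarrow> Poly_Mapping.keys (frag_cmul (\<epsilon> \<sigma>) (frag_of (F \<sigma>))) = {F \<sigma>}"
  using sign[of \<sigma>] by (auto simp: keys_cmul_iff)

lemma push_hom: "push k \<in> hom (grp (chains S r) k) (grp (chains S' s) k)"
  unfolding signed_map_def grp_chains
  by (rule frag_extend_hom) (simp add: keys_signed F_simplex F_dim)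

lemma pull_hom: "pull k \<in> hom (grp (chains S' s) k) (grp (chains S r) k)"
  unfolding pull_def grp_chains
proof (rule frag_extend_hom)
  fix \<tau> assume \<tau>: "\<tau> \<in> {\<sigma> \<in> simplices S' s. dimn S' \<sigma> = k}"
  show "pull_simplex \<tau> \<in> carrier (free_Abelian_group {\<sigma> \<in> simplices S r. dimn S \<sigma> = k})"
  proof (cases "\<tau> \<in> F ` simplices S r")
    case True
    then obtain \<sigma> where "\<sigma> \<in> simplices S r" "\<tau> = F \<sigma>"
      by blast
    then show ?thesis
      using \<tau> keys_cmul[of "\<epsilon> \<sigma>" "frag_of \<sigma>"] by (auto simp: pull_simplex_F F_dim)
  qed (simp add: pull_simplex_def)
qed

lemma pull_push:
  assumes "x \<in> carrier (grp (chains S r) k)"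
  shows "pull k (push k x) = x"
proof -
  have "pull k (push k x) = frag_extend frag_of x"
    unfolding pull_def signed_map_def frag_extend_frag_extend
  proof (rule frag_extend_eq)
    fix \<sigma> assume "\<sigma> \<in> Poly_Mapping.keys x"
    then have "\<sigma> \<in> simplices S r"
      using assms by auto
    then show "frag_extend pull_simplex (frag_cmul (\<epsilon> \<sigma>) (frag_of (F \<sigma>))) = frag_of \<sigma>"
      by (simp add: frag_extend_cmul pull_simplex_F sign)
  qed
  then show ?thesis
    by (simp flip: frag_expansion)
qed

lemma push_bd:
  assumes "x \<in> carrier (grp (chains S r) k)"
  shows "bd (chains S' s) k (push k x) = push (k - 1) (bd (chains S r) k x)"
proof (cases k)
  case 0
  then show ?thesis
    by (simp add: bd_chains signed_map_def)
next
  case (Suc j)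
  show ?thesis
    unfolding Suc bd_chains signed_map_def frag_extend_frag_extend
  proof (rule frag_extend_eq)
    fix \<sigma> assume "\<sigma> \<in> Poly_Mapping.keys x"
    then have "\<sigma> \<in> simplices S r" "dimn S \<sigma> = Suc j"
      using assms Suc by auto
    then show "frag_extend (face_sum S' s) (frag_cmul (\<epsilon> \<sigma>) (frag_of (F \<sigma>))) =
        frag_extend (\<lambda>\<sigma>. frag_cmul (\<epsilon> \<sigma>) (frag_of (F \<sigma>))) (face_sum S r \<sigma>)"
      using face_F[of \<sigma>] by (simp add: frag_extend_cmul signed_map_def)
  qed
qed

lemma chain_hom_push: "chain_hom (chains S r) (chains S' s) push"
  by (intro chain_hom.intro chain_hom_axioms.intro C.abelian_complex_chains C'.abelian_complex_chains
      push_hom push_bd)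

sublocale push: chain_hom "chains S r" "chains S' s" push
  by (rule chain_hom_push)

lemma push_inject:
  "x \<in> carrier (grp (chains S r) k) \<Longrightarrow> y \<in> carrier (grp (chains S r) k) \<Longrightarrow> push k x = push k y \<Longrightarrow> x = y"
  by (metis pull_push)

lemma span_closed: "A \<subseteq> simplices S r \<Longrightarrow> x \<in> graded_span S A k \<Longrightarrow> x \<in> carrier (grp (chains S r) k)"
  using subgroup.mem_carrier[OF C.subgroup_span] by blast

lemma push_span:
  assumes "A \<subseteq> simplices S r"
  shows "push k ` graded_span S A k = graded_span S' (F ` A) k"
proof (intro equalityI subsetI)
  fix y assume "y \<in> push k ` graded_span S A k"
  then obtain x where x: "Poly_Mapping.keys x \<subseteq> {\<sigma> \<in> A. dimn S \<sigma> = k}" and y: "y = push k x"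
    by (auto simp: graded_span_def)
  have "Poly_Mapping.keys (frag_cmul (\<epsilon> \<sigma>) (frag_of (F \<sigma>))) \<subseteq> {\<tau> \<in> F ` A. dimn S' \<tau> = k}"
    if "\<sigma> \<in> Poly_Mapping.keys x" for \<sigma>
    using that x assms by (auto simp: keys_signed subset_iff F_dim)
  then show "y \<in> graded_span S' (F ` A) k"
    using keys_frag_extend[of "\<lambda>\<sigma>. frag_cmul (\<epsilon> \<sigma>) (frag_of (F \<sigma>))" x]
    unfolding y signed_map_def graded_span_def carrier_free_Abelian_group_iff by blast
next
  fix y assume "y \<in> graded_span S' (F ` A) k"
  then have "Poly_Mapping.keys y \<subseteq> {\<tau> \<in> F ` A. dimn S' \<tau> = k}"
    by (simp add: graded_span_def)
  then show "y \<in> push k ` graded_span S A k"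
  proof (induction y rule: frag_induction)
    case zero
    have "0 = push k 0" "0 \<in> graded_span S A k"
      by (simp_all add: signed_map_def graded_span_def)
    then show ?case
      by blast
  next
    case (one \<tau>)
    then obtain \<sigma> where \<sigma>: "\<sigma> \<in> A" "\<tau> = F \<sigma>" "dimn S \<sigma> = k"
      using assms F_dim by auto
    then have "frag_of \<tau> = push k (frag_cmul (\<epsilon> \<sigma>) (frag_of \<sigma>))"
      using assms sign[of \<sigma>] by (auto simp: signed_map_def frag_extend_cmul)
    moreover have "frag_cmul (\<epsilon> \<sigma>) (frag_of \<sigma>) \<in> graded_span S A k"
      using \<sigma> keys_cmul[of "\<epsilon> \<sigma>" "frag_of \<sigma>"] by (auto simp: graded_span_def)
    ultimately show ?case
      by blast
  next
    case (diff a b)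
    then obtain x y where "x \<in> graded_span S A k" "y \<in> graded_span S A k" "a = push k x" "b = push k y"
      by blast
    moreover from this have "x - y \<in> graded_span S A k" "a - b = push k (x - y)"
      using keys_diff[of x y] by (auto simp: graded_span_def signed_map_def frag_extend_diff)
    ultimately show ?case
      by blast
  qed
qed

lemma face_closed_image:
  assumes "face_closed S r A"
  shows "face_closed S' s (F ` A)"
  unfolding face_closed_def
proof (intro conjI ballI impI)
  have A: "A \<subseteq> simplices S r"
    using assms by (simp add: face_closed_def)
  then show "F ` A \<subseteq> simplices S' s"
    using F_simplex by blast
  fix \<tau> assume "\<tau> \<in> F ` A" "0 < dimn S' \<tau>"
  then obtain \<sigma> where \<sigma>: "\<sigma> \<in> A" "\<tau> = F \<sigma>" "0 < dimn S \<sigma>"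
    using A F_dim by auto
  then have \<sigma>': "\<sigma> \<in> simplices S r"
    using A by blast
  have "face_sum S r \<sigma> \<in> graded_span S A (dimn S \<sigma> - 1)"
    using C.face[OF \<sigma>' \<sigma>(3)] assms \<sigma> by (auto simp: face_closed_def graded_span_def)
  then have "frag_cmul (\<epsilon> \<sigma>) (face_sum S' s \<tau>) \<in> graded_span S' (F ` A) (dimn S \<sigma> - 1)"
    unfolding \<sigma>(2) face_F[OF \<sigma>' \<sigma>(3)] push_span[OF A, symmetric] by blast
  then have "Poly_Mapping.keys (frag_cmul (\<epsilon> \<sigma>) (frag_cmul (\<epsilon> \<sigma>) (face_sum S' s \<tau>))) \<subseteq> F ` A"
    using keys_cmul[of "\<epsilon> \<sigma>" "frag_cmul (\<epsilon> \<sigma>) (face_sum S' s \<tau>)"] by (auto simp: graded_span_def)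
  then show "Poly_Mapping.keys (face_sum S' s \<tau>) \<subseteq> F ` A"
    by (simp add: sign[OF \<sigma>'])
qed

text \<open>
  By injectivity, a chain lies in the span of \<open>H\<close> if and only if its image lies in the span of
  \<open>F ` H\<close>, and likewise for its boundary.
\<close>

lemma push_Inf:
  assumes "H \<subseteq> simplices S r"
  shows "push k ` Inf_complex S r H k = Inf_complex S' s (F ` H) k"
proof -
  have FH: "F ` H \<subseteq> simplices S' s"
    using assms F_simplex by blast
  have "push k x \<in> graded_span S' (F ` H) k \<longleftrightarrow> x \<in> graded_span S H k"
    if x: "x \<in> carrier (grp (chains S r) k)" for x k
  proof
    assume "push k x \<in> graded_span S' (F ` H) k"
    then obtain y where "y \<in> graded_span S H k" "push k x = push k y"
      unfolding push_span[OF assms, symmetric] by blast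
    then show "x \<in> graded_span S H k"
      using push_inject[OF x span_closed[OF assms]] by blast
  qed (unfold push_span[OF assms, symmetric], rule imageI)
  then have "bd (chains S' s) k (push k x) \<in> graded_span S' (F ` H) (k - 1) \<longleftrightarrow>
      bd (chains S r) k x \<in> graded_span S H (k - 1)" if "x \<in> graded_span S H k" for x
    unfolding push_bd[OF span_closed[OF assms that]] using C.bd_closed[OF span_closed[OF assms that]] by blast
  then show ?thesis
    unfolding C.Inf_complex_eq[OF assms] C'.Inf_complex_eq[OF FH] push_span[OF assms, symmetric]
    by blast
qed

text \<open>
  For a map between free complexes that is injective on the bases, an isomorphism in integral homology
  makes the complex on the remaining basis elements acyclic.  As that complex is free, a contraction
  can be chosen on one basis element after another, by recursion on the degree.
\<close>

lemma deformation_retract_of_quasi_iso: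
  assumes qi: "quasi_iso (chains S r) (chains S' s) push"
  obtains g h where "deformation_retract (chains S r) (chains S' s) push g h"
proof -
  let ?C = "chains S r" and ?C' = "chains S' s"
  define im where "im k = push k ` carrier (grp ?C k)" for k
  have im: "subgroup (im k) (grp ?C' k)" for k
    unfolding im_def by (rule group_hom.img_is_subgroup[OF push.group_hom_h])
  have im_0: "0 \<in> im k" and im_diff: "x \<in> im k \<Longrightarrow> y \<in> im k \<Longrightarrow> x - y \<in> im k" for k x y
  proof -
    show "0 \<in> im k"
      using subgroup.one_closed[OF im[of k]] by simp
    assume x: "x \<in> im k" and y: "y \<in> im k"
    then have "x \<otimes>\<^bsub>grp ?C' k\<^esub> inv\<^bsub>grp ?C' k\<^esub> y \<in> im k"
      using im by (simp only: subgroup.m_closed subgroup.m_inv_closed)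
    then show "x - y \<in> im k"
      using subgroup.mem_carrier[OF im y] by simp
  qed
  have C'_diff: "x - y \<in> carrier (grp ?C' k)" if "x \<in> carrier (grp ?C' k)" "y \<in> carrier (grp ?C' k)" for x y k
    using that keys_diff[of x y] by auto
  have bd_diff: "bd ?C' k (x - y) = bd ?C' k x - bd ?C' k y" for x y k
    by (simp add: chains_def frag_extend_diff)
  have acyclic: "\<exists>y\<in>carrier (grp ?C' (Suc k)). x - bd ?C' (Suc k) y \<in> im k"
    if x: "x \<in> carrier (grp ?C' k)" and bx: "bd ?C' k x \<in> im (k - 1)" for x k
  proof -
    obtain z where z: "z \<in> carrier (grp ?C (k - 1))" "bd ?C' k x = push (k - 1) z" "k = 0 \<longrightarrow> z = 0"
    proof (cases "k = 0")
      case True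
      have "bd ?C' k x = push (k - 1) 0"
        by (simp add: True bd_chains signed_map_def)
      then show thesis
        by (intro that[of 0]) simp_all
    next
      case False
      then show thesis
        using bx that by (auto simp: im_def)
    qed
    have "push (k - 1 - 1) (bd ?C (k - 1) z) = push (k - 1 - 1) \<one>\<^bsub>grp ?C (k - 1 - 1)\<^esub>"
      using push_bd[OF z(1)] C'.bd_bd[OF x] by (simp add: push.one z(2) del: grp_chains)
    then have bz: "bd ?C (k - 1) z = \<one>\<^bsub>grp ?C (k - 1 - 1)\<^esub>"
      using push_inject C.bd_closed[OF z(1)] C.G.one_closed by blast
    have z0: "z = \<one>\<^bsub>grp ?C 0\<^esub>" if "k = 0"
      using z(3) that by simp
    obtain w y where "w \<in> carrier (grp ?C k)" "y \<in> carrier (grp ?C' (Suc k))"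
        "x = push k w \<otimes>\<^bsub>grp ?C' k\<^esub> bd ?C' (Suc k) y"
      using quasi_isoE[OF qi x z(1) z0 bz z(2)] by blast
    then show ?thesis
      unfolding im_def by (intro bexI[of _ y]) auto
  qed
  \<comment> \<open>The last conjunct of \<open>P k h\<close> states that \<open>x - h (bd x)\<close> is a cycle modulo the image of \<open>push\<close>.
      Acyclicity then lets the recursion continue with a choice of bounding chains; this conjunct is restored
      in the next degree by \<open>R\<close>, the homotopy equation modulo that image.\<close>
  define P where "P k h \<longleftrightarrow> h \<in> hom (grp ?C' (k - 1)) (grp ?C' k) \<and>
      (\<forall>z\<in>carrier (grp ?C (k - 1)). h (push (k - 1) z) = 0) \<and>
      (\<forall>x\<in>carrier (grp ?C' k). bd ?C' k (x - h (bd ?C' k x)) \<in> im (k - 1))" for k h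
  define R where "R k h h' \<longleftrightarrow>
      (\<forall>x\<in>carrier (grp ?C' k). x - h (bd ?C' k x) - bd ?C' (Suc k) (h' x) \<in> im k)" for k h h'
  have "\<exists>h. \<forall>k. P k (h k) \<and> R k (h k) (h (Suc k))"
  proof (rule dependent_nat_choice)
    show "\<exists>h. P 0 h"
      by (rule exI[of _ "\<lambda>_. 0"]) (auto simp: P_def bd_chains im_0 intro!: homI)
  next
    fix h k assume "P k h"
    then have h: "h \<in> hom (grp ?C' (k - 1)) (grp ?C' k)"
      and h_push: "\<And>z. z \<in> carrier (grp ?C (k - 1)) \<Longrightarrow> h (push (k - 1) z) = 0"
      and bd_h: "\<And>x. x \<in> carrier (grp ?C' k) \<Longrightarrow> bd ?C' k (x - h (bd ?C' k x)) \<in> im (k - 1)"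
      by (auto simp: P_def)
    have h_closed: "h (bd ?C' k x) \<in> carrier (grp ?C' k)" if "x \<in> carrier (grp ?C' k)" for x
      using h C'.bd_closed[OF that] by (rule hom_in_carrier)
    define y where "y \<tau> = (SOME y. y \<in> carrier (grp ?C' (Suc k)) \<and>
        frag_of \<tau> - h (bd ?C' k (frag_of \<tau>)) - bd ?C' (Suc k) y \<in> im k)" for \<tau>
    have y: "y \<tau> \<in> carrier (grp ?C' (Suc k))"
        "frag_of \<tau> - h (bd ?C' k (frag_of \<tau>)) - bd ?C' (Suc k) (y \<tau>) \<in> im k"
      if \<tau>: "\<tau> \<in> simplices S' s" "dimn S' \<tau> = k" for \<tau>
    proof -
      have f\<tau>: "frag_of \<tau> \<in> carrier (grp ?C' k)"
        using \<tau> by simp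
      have "\<exists>y. y \<in> carrier (grp ?C' (Suc k)) \<and>
          frag_of \<tau> - h (bd ?C' k (frag_of \<tau>)) - bd ?C' (Suc k) y \<in> im k"
        using acyclic[OF C'_diff[OF f\<tau> h_closed[OF f\<tau>]] bd_h[OF f\<tau>]] unfolding Bex_def .
      from someI_ex[OF this, folded y_def]
      show "y \<tau> \<in> carrier (grp ?C' (Suc k))"
        "frag_of \<tau> - h (bd ?C' k (frag_of \<tau>)) - bd ?C' (Suc k) (y \<tau>) \<in> im k"
        by blast+
    qed
    define h' where "h' = frag_extend (\<lambda>\<tau>. if \<tau> \<in> F ` simplices S r then 0 else y \<tau>)"
    have h': "h' \<in> hom (grp ?C' k) (grp ?C' (Suc k))"
      unfolding h'_def grp_chains by (rule frag_extend_hom) (use y in auto)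
    have h'_push: "h' (push k z) = 0" if "z \<in> carrier (grp ?C k)" for z
      unfolding h'_def signed_map_def frag_extend_frag_extend
      by (rule frag_extend_eq_0) (use that in \<open>auto simp: frag_extend_cmul\<close>)
    have R: "x - h (bd ?C' k x) - bd ?C' (Suc k) (h' x) \<in> im k"
      if "x \<in> carrier (grp ?C' k)" for x
    proof -
      have "Poly_Mapping.keys x \<subseteq> {\<tau> \<in> simplices S' s. dimn S' \<tau> = k}"
        using that by simp
      then show ?thesis
      proof (rule free_Abelian_group_induct)
        have "h 0 = 0"
          using hom_one[OF h C'.G.group_axioms C'.G.group_axioms] by simp
        then show "0 - h (bd ?C' k 0) - bd ?C' (Suc k) (h' 0) \<in> im k"
          using im_0 by (simp add: h'_def chains_def)
      next
        fix x z
        assume xz: "Poly_Mapping.keys x \<subseteq> {\<tau> \<in> simplices S' s. dimn S' \<tau> = k}"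
            "Poly_Mapping.keys z \<subseteq> {\<tau> \<in> simplices S' s. dimn S' \<tau> = k}"
          and IH: "x - h (bd ?C' k x) - bd ?C' (Suc k) (h' x) \<in> im k"
            "z - h (bd ?C' k z) - bd ?C' (Suc k) (h' z) \<in> im k"
        have "h (bd ?C' k (x - z)) = h (bd ?C' k x) - h (bd ?C' k z)"
          using hom_frag_diff[OF h[unfolded grp_chains]] C'.bd_closed[of x k] C'.bd_closed[of z k] xz
          by (simp add: bd_diff)
        then have "x - z - h (bd ?C' k (x - z)) - bd ?C' (Suc k) (h' (x - z))
            = (x - h (bd ?C' k x) - bd ?C' (Suc k) (h' x)) - (z - h (bd ?C' k z) - bd ?C' (Suc k) (h' z))"
          by (simp add: h'_def frag_extend_diff bd_diff)
        then show "x - z - h (bd ?C' k (x - z)) - bd ?C' (Suc k) (h' (x - z)) \<in> im k"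
          using im_diff[OF IH] by (simp only:)
      next
        fix \<tau> assume \<tau>_dim: "\<tau> \<in> {\<tau> \<in> simplices S' s. dimn S' \<tau> = k}"
        show "frag_of \<tau> - h (bd ?C' k (frag_of \<tau>)) - bd ?C' (Suc k) (h' (frag_of \<tau>)) \<in> im k"
        proof (cases "\<tau> \<in> F ` simplices S r")
          case True
          then obtain \<sigma> where \<sigma>: "\<sigma> \<in> simplices S r" "\<tau> = F \<sigma>" "dimn S \<sigma> = k"
            using \<tau>_dim F_dim by auto
          then have "frag_of \<tau> \<in> graded_span S' (F ` simplices S r) k"
            using \<tau>_dim by (simp add: graded_span_def)
          then have \<tau>: "frag_of \<tau> \<in> im k"
            unfolding push_span[OF order_refl, symmetric] im_def by (simp add: graded_span_def)
          then obtain z where z: "z \<in> carrier (grp ?C k)" "frag_of \<tau> = push k z"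
            by (auto simp: im_def)
          then have "h (bd ?C' k (frag_of \<tau>)) = 0"
            using h_push C.bd_closed push_bd by metis
          moreover have "h' (frag_of \<tau>) = 0"
            using h'_push z by simp
          ultimately show ?thesis
            using \<tau> by (simp add: chains_def)
        next
          case False
          then show ?thesis
            using \<tau>_dim y(2)[of \<tau>] by (simp add: h'_def)
        qed
      qed
    qed
    have "bd ?C' (Suc k) (x - h' (bd ?C' (Suc k) x)) \<in> im k" if x: "x \<in> carrier (grp ?C' (Suc k))" for x
    proof -
      have "h (bd ?C' k (bd ?C' (Suc k) x)) = 0"
        using hom_one[OF h C'.G.group_axioms C'.G.group_axioms] C'.bd_bd_Suc[OF x] by simp
      then show ?thesis
        using R[OF C'.bd_closed_Suc[OF x]] by (simp add: bd_diff)
    qed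
    then show "\<exists>h'. P (Suc k) h' \<and> R k h h'"
      using h' h'_push R by (intro exI[of _ h']) (simp add: P_def R_def del: grp_chains)
  qed
  then obtain h where h: "\<And>k. P k (h k)" and Rh: "\<And>k. R k (h k) (h (Suc k))"
    by blast
  have h_hom: "h k \<in> hom (grp ?C' (k - 1)) (grp ?C' k)"
    and h_push: "z \<in> carrier (grp ?C (k - 1)) \<Longrightarrow> h k (push (k - 1) z) = 0" for k z
    using h by (auto simp: P_def)
  have h_hom_Suc: "h (Suc k) \<in> hom (grp ?C' k) (grp ?C' (Suc k))" for k
    using h_hom[of "Suc k"] by simp
  \<comment> \<open>The homotopy equation forces \<open>push (g x)\<close> to be \<open>u x\<close>, which lies in the image of \<open>push\<close>.\<close>
  define u where "u k x = x - h k (bd ?C' k x) - bd ?C' (Suc k) (h (Suc k) x)" for k x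
  define g where "g k x = pull k (u k x)" for k x
  have u_im: "u k x \<in> im k" if "x \<in> carrier (grp ?C' k)" for k x
    using Rh that by (simp add: R_def u_def)
  have u_closed: "u k x \<in> carrier (grp ?C' k)" if "x \<in> carrier (grp ?C' k)" for k x
    using subgroup.mem_carrier[OF im u_im[OF that]] .
  have push_g: "push k (g k x) = u k x" if "x \<in> carrier (grp ?C' k)" for k x
    using u_im[OF that] pull_push by (auto simp: im_def g_def)
  have g_closed: "g k x \<in> carrier (grp ?C k)" if "x \<in> carrier (grp ?C' k)" for k x
    unfolding g_def by (rule hom_in_carrier[OF pull_hom u_closed[OF that]])
  have h_bd_add: "h k (bd ?C' k (x + y)) = h k (bd ?C' k x) + h k (bd ?C' k y)"
    if "x \<in> carrier (grp ?C' k)" "y \<in> carrier (grp ?C' k)" for k x y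
    using hom_mult[OF h_hom C'.bd_closed[OF that(1)] C'.bd_closed[OF that(2)]] C'.bd_mult[OF that] by simp
  have bd_h_add: "bd ?C' (Suc k) (h (Suc k) (x + y)) = bd ?C' (Suc k) (h (Suc k) x) + bd ?C' (Suc k) (h (Suc k) y)"
    if "x \<in> carrier (grp ?C' k)" "y \<in> carrier (grp ?C' k)" for k x y
    using hom_mult[OF h_hom_Suc that] C'.bd_mult[of "h (Suc k) x" "Suc k" "h (Suc k) y"]
      hom_in_carrier[OF h_hom_Suc that(1)] hom_in_carrier[OF h_hom_Suc that(2)] by simp
  have g_hom: "g k \<in> hom (grp ?C' k) (grp ?C k)" for k
  proof (rule homI)
    fix x y assume xy: "x \<in> carrier (grp ?C' k)" "y \<in> carrier (grp ?C' k)"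
    have "u k (x + y) = u k x + u k y"
      by (simp add: u_def h_bd_add[OF xy] bd_h_add[OF xy])
    then show "g k (x \<otimes>\<^bsub>grp ?C' k\<^esub> y) = g k x \<otimes>\<^bsub>grp ?C k\<^esub> g k y"
      using hom_mult[OF pull_hom u_closed[OF xy(1)] u_closed[OF xy(2)]] by (simp add: g_def)
  qed (rule g_closed)
  have bd_g: "bd ?C k (g k x) = g (k - 1) (bd ?C' k x)" if x: "x \<in> carrier (grp ?C' k)" for k x
  proof (cases k)
    case 0
    have "g 0 0 = 0"
      using hom_one[OF g_hom[of 0] C'.G.group_axioms C.G.group_axioms] by simp
    then show ?thesis
      by (simp add: 0 bd_chains)
  next
    case (Suc j)
    have bx: "bd ?C' (Suc j) x \<in> carrier (grp ?C' j)"
      using x Suc C'.bd_closed_Suc by blast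
    have hx: "h (Suc k) x \<in> carrier (grp ?C' (Suc k))"
      using hom_in_carrier[OF h_hom_Suc x] .
    have bd0: "bd ?C' (Suc j) (bd ?C' (Suc (Suc j)) (h (Suc (Suc j)) x)) = 0"
      using C'.bd_bd_Suc[OF hx] Suc by simp
    have "bd ?C' j (bd ?C' (Suc j) x) = 0"
      using C'.bd_bd_Suc[of x j] x Suc by simp
    then have h0: "h j (bd ?C' j (bd ?C' (Suc j) x)) = 0"
      using hom_one[OF h_hom C'.G.group_axioms C'.G.group_axioms, of j] by simp
    have "push j (bd ?C (Suc j) (g (Suc j) x)) = bd ?C' (Suc j) (u (Suc j) x)"
      using push_bd[OF g_closed[OF x]] push_g[OF x] Suc by simp
    also have "\<dots> = bd ?C' (Suc j) x - bd ?C' (Suc j) (h (Suc j) (bd ?C' (Suc j) x))"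
      by (simp add: u_def bd_diff bd0)
    also have "\<dots> = u j (bd ?C' (Suc j) x)"
      by (simp add: u_def h0)
    also have "\<dots> = push j (g j (bd ?C' (Suc j) x))"
      using push_g[OF bx] by simp
    finally have "bd ?C (Suc j) (g (Suc j) x) = g j (bd ?C' (Suc j) x)"
      using push_inject[of _ j] C.bd_closed_Suc[OF g_closed[of x "Suc j"]] g_closed[OF bx] x Suc by blast
    then show ?thesis
      by (simp add: Suc)
  qed
  have "deformation_retract ?C ?C' push g h"
  proof (intro deformation_retract.intro deformation_retract_axioms.intro chain_hom_push
      chain_hom.intro chain_hom_axioms.intro C.abelian_complex_chains C'.abelian_complex_chains g_hom bd_g h_hom)
    fix k
    show "g k (push k x) = x" if x: "x \<in> carrier (grp ?C k)" for x
    proof -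
      have "h k (bd ?C' k (push k x)) = 0"
        using h_push[OF C.bd_closed[OF x]] push_bd[OF x] by simp
      moreover have "h (Suc k) (push k x) = 0"
        using h_push[of x "Suc k"] x by simp
      ultimately have "u k (push k x) = push k x"
        by (simp add: u_def chains_def)
      then show ?thesis
        using pull_push[OF x] by (simp add: g_def)
    qed
    show "h k (push (k - 1) x) = \<one>\<^bsub>grp ?C' k\<^esub>" if "x \<in> carrier (grp ?C (k - 1))" for x
      using h_push[OF that] by simp
    show "x = (push k (g k x) \<otimes>\<^bsub>grp ?C' k\<^esub> bd ?C' (Suc k) (h (Suc k) x)) \<otimes>\<^bsub>grp ?C' k\<^esub> h k (bd ?C' k x)"
      if "x \<in> carrier (grp ?C' k)" for x
      by (simp add: push_g[OF that] u_def)
  qed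
  then show thesis
    by (rule that)
qed

end

lemma (in based_complex) face_closed_simplices: "face_closed S t (simplices S t)"
  using face by (fastforce simp: face_closed_def)

lemma (in based_map) pair_chain_hom_push:
  assumes "face_closed S r A" "face_closed S' s A'" "F ` A \<subseteq> A'"
  shows "pair_chain_hom (chains S r) (chains S' s) push (graded_span S A) (graded_span S' A')"
proof (intro pair_chain_hom.intro pair_chain_hom_axioms.intro chain_hom_push
    C.subcomplex_span C'.subcomplex_span assms)
  have A: "A \<subseteq> simplices S r"
    using assms(1) by (simp add: face_closed_def)
  fix k x assume "x \<in> graded_span S A k"
  then have "push k x \<in> graded_span S' (F ` A) k"
    unfolding push_span[OF A, symmetric] by (rule imageI)
  then show "push k x \<in> graded_span S' A' k"
    using assms(3) by (fastforce simp: graded_span_def)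
qed

text \<open>
  The left term is written as a quotient of \<open>chains S r\<close>, to which the span of \<open>F ` simplices S r\<close>
  modulo that of \<open>F ` A\<close> is isomorphic.
\<close>

lemma (in based_map) split_exact_span:
  assumes A: "face_closed S r A"
  shows "split_exact (quotient_complex (chains S r) (graded_span S A))
    (quotient_complex (chains S' s) (graded_span S' (F ` A)))
    (quotient_complex (chains S' s) (graded_span S' (F ` simplices S r)))
    (\<lambda>k. quot_map (grp (chains S' s) k) (graded_span S' (F ` A) k) (push k))
    (\<lambda>k. quot_map (grp (chains S' s) k) (graded_span S' (F ` simplices S r) k) (\<lambda>x. x))
    (\<lambda>k. quot_map (grp (chains S r) k) (graded_span S A k) (pull k))
    (\<lambda>k. quot_map (grp (chains S' s) k) (graded_span S' (F ` A) k) (\<lambda>x. x - push k (pull k x)))"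
proof (rule push.split_exact_quotient)
  have A': "A \<subseteq> simplices S r"
    using A by (simp add: face_closed_def)
  show "subcomplex (chains S r) (graded_span S A)"
    using A by (rule C.subcomplex_span)
  show "subcomplex (chains S' s) (graded_span S' (F ` A))"
    using face_closed_image[OF A] by (rule C'.subcomplex_span)
  show "subcomplex (chains S' s) (graded_span S' (F ` simplices S r))"
    using face_closed_image[OF C.face_closed_simplices] by (rule C'.subcomplex_span)
  fix k
  show "graded_span S' (F ` A) k \<subseteq> graded_span S' (F ` simplices S r) k"
    using A' by (fastforce simp: graded_span_def)
  show "push k x \<in> graded_span S' (F ` A) k" if "x \<in> graded_span S A k" for x
    using that unfolding push_span[OF A', symmetric] by (rule imageI)
  show "push k x \<in> graded_span S' (F ` simplices S r) k" if "x \<in> carrier (grp (chains S r) k)" for x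
    using that unfolding push_span[OF order_refl, symmetric] carrier_chains by (rule imageI)
  show "pull k \<in> hom (grp (chains S' s) k) (grp (chains S r) k)"
    by (rule pull_hom)
  show "pull k (push k x) = x" if "x \<in> carrier (grp (chains S r) k)" for x
    using that by (rule pull_push)
  show "pull k x \<in> graded_span S A k" if "x \<in> graded_span S' (F ` A) k" for x
    using that pull_push span_closed[OF A'] unfolding push_span[OF A', symmetric] by auto
  show "x - push k (pull k x) \<in> graded_span S' (F ` A) k"
    if x: "x \<in> graded_span S' (F ` simplices S r) k" for x
  proof -
    have "x - push k (pull k x) = 0"
      using x pull_push unfolding push_span[OF order_refl, symmetric] by (auto simp flip: carrier_chains)
    then show ?thesis
      by (simp add: graded_span_def)
  qed
  have closed: "push k (pull k x) \<in> carrier (grp (chains S' s) k)" if "x \<in> carrier (grp (chains S' s) k)" for x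
    using hom_in_carrier[OF pull_hom that] by (rule push.closed)
  show "(\<lambda>x. x - push k (pull k x)) \<in> hom (grp (chains S' s) k) (grp (chains S' s) k)"
  proof (rule homI)
    fix x assume "x \<in> carrier (grp (chains S' s) k)"
    then show "x - push k (pull k x) \<in> carrier (grp (chains S' s) k)"
      using closed[of x] keys_diff[of x "push k (pull k x)"] by auto
  qed (simp add: pull_def signed_map_def frag_extend_add)
  show "x = push k (pull k x) \<otimes>\<^bsub>grp (chains S' s) k\<^esub> (x - push k (pull k x))" for x
    by simp
qed

section \<open>Regularity of a single structure map\<close>

text \<open>
  The conditions on pairs \<open>r \<le> s\<close> behind the geometric-, combinatorial- and algebraic-absolute
  critical points.
\<close>

definition geometric_iso ::
    "'f::field coefficients \<Rightarrow> ('i, 's) persistence_system \<Rightarrow> 'i \<Rightarrow> 'i \<Rightarrow> bool" where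
  "geometric_iso c S r s \<longleftrightarrow> (\<forall>A. A \<subseteq> simplices S r \<and> is_complex S r A \<longrightarrow>
     relative_iso c S r s (graded_span S A) (graded_span S (transition S r s ` A)))"

definition combinatorial_iso ::
    "'f::field coefficients \<Rightarrow> ('i, 's) persistence_system \<Rightarrow> 'i \<Rightarrow> 'i \<Rightarrow> bool" where
  "combinatorial_iso c S r s \<longleftrightarrow> (\<forall>H. H \<subseteq> simplices S r \<longrightarrow>
     relative_iso c S r s (Inf_complex S r H) (Inf_complex S s (transition S r s ` H)))"

definition algebraic_iso ::
    "'f::field coefficients \<Rightarrow> ('i, 's) persistence_system \<Rightarrow> 'i \<Rightarrow> 'i \<Rightarrow> bool" where
  "algebraic_iso c S r s \<longleftrightarrow> (\<forall>D. sub_chain_complex (chains S r) D \<longrightarrow>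
     relative_iso c S r s D (\<lambda>k. chain_map S r s k ` D k))"

locale structure_map = based_map S r S s "transition S r s" "\<lambda>_. 1"
  for S :: "('i, 's) persistence_system" and r s +
  assumes complex_face_closed: "\<And>A. A \<subseteq> simplices S r \<Longrightarrow> is_complex S r A \<Longrightarrow> face_closed S r A"
    and empty_complex: "is_complex S r {}"
begin

lemma algebraic_imp_combinatorial:
  assumes "algebraic_iso c S r s"
  shows "combinatorial_iso c S r s"
  unfolding combinatorial_iso_def
proof (intro allI impI)
  fix H assume H: "H \<subseteq> simplices S r"
  have "relative_iso c S r s (Inf_complex S r H) (\<lambda>k. push k ` Inf_complex S r H k)"
    using assms C.sub_chain_complex_Inf[OF H] by (simp add: algebraic_iso_def chain_map_eq_signed_map)
  then show "relative_iso c S r s (Inf_complex S r H) (Inf_complex S s (transition S r s ` H))"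
    by (simp add: push_Inf[OF H])
qed

lemma combinatorial_imp_geometric:
  assumes "combinatorial_iso c S r s"
  shows "geometric_iso c S r s"
  unfolding geometric_iso_def
proof (intro allI impI, elim conjE)
  fix A assume A: "A \<subseteq> simplices S r" "is_complex S r A"
  then have "face_closed S r A"
    by (rule complex_face_closed)
  then show "relative_iso c S r s (graded_span S A) (graded_span S (transition S r s ` A))"
    using assms A face_closed_image
    by (metis combinatorial_iso_def C.Inf_complex_face_closed C'.Inf_complex_face_closed)
qed

text \<open>
  For the empty subcomplex the relative complexes are the quotients by \<open>0\<close>.
\<close>

lemma geometric_imp_absolute:
  assumes "geometric_iso c S r s"
  shows "absolute_iso c S r s"
proof -
  have Z: "graded_span S {} = (\<lambda>k. {\<one>\<^bsub>grp (chains S t) k\<^esub>})" for t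
    by (simp add: graded_span_def fun_eq_iff) auto
  have "relative_iso c S r s (graded_span S {}) (graded_span S {})"
    using assms empty_complex by (auto simp: geometric_iso_def)
  then have "homology_iso c (quotient_complex (chains S r) (\<lambda>k. {\<one>\<^bsub>grp (chains S r) k\<^esub>}))
      (quotient_complex (chains S s) (\<lambda>k. {\<one>\<^bsub>grp (chains S s) k\<^esub>}))
      (\<lambda>k. quot_map (grp (chains S s) k) {\<one>\<^bsub>grp (chains S s) k\<^esub>} (push k))"
    unfolding relative_iso_def chain_map_eq_signed_map Z[of r, THEN fun_cong] using Z by metis
  then show ?thesis
    unfolding absolute_iso_def chain_map_eq_signed_map
    by (rule retract_of_chain_hom.homology_iso_retract[OF push.retract_of_trivial_quotient])
qed

text \<open>
  The key step: integral absolute homology controls relative homology with any coefficients.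
\<close>

lemma integral_imp_algebraic:
  fixes c :: "'f::field coefficients"
  assumes "absolute_iso (Integer_coeffs :: 'f coefficients) S r s"
  shows "algebraic_iso c S r s" and "absolute_iso c S r s"
proof -
  have "quasi_iso (chains S r) (chains S s) push"
    using assms homology_iso_Integer_iff[OF chain_hom_push]
    unfolding absolute_iso_def chain_map_eq_signed_map by metis
  then obtain g h where gh: "deformation_retract (chains S r) (chains S s) push g h"
    by (rule deformation_retract_of_quasi_iso)
  then show "absolute_iso c S r s"
    unfolding absolute_iso_def chain_map_eq_signed_map by (rule deformation_retract.homology_iso)
  show "algebraic_iso c S r s"
    unfolding algebraic_iso_def
  proof (intro allI impI)
    fix D assume "sub_chain_complex (chains S r) D"
    then have D: "subcomplex (chains S r) D"
      by (intro subcomplex.intro subcomplex_axioms.intro C.abelian_complex_chains)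
    show "relative_iso c S r s D (\<lambda>k. chain_map S r s k ` D k)"
      unfolding relative_iso_def chain_map_eq_signed_map
      by (rule deformation_retract.homology_iso)
        (rule deformation_retract.deformation_retract_quotient[OF gh D])
  qed
qed

end

section \<open>Critical points of persistence systems\<close>

definition regular_points ::
    "'i::{topological_space,order} set \<Rightarrow> ('i \<Rightarrow> 'i \<Rightarrow> bool) \<Rightarrow> 'i set" where
  "regular_points \<Omega> P =
     {t. \<exists>U. openin (top_of_set \<Omega>) U \<and> t \<in> U \<and> (\<forall>r\<in>U. \<forall>s\<in>U. r \<le> s \<longrightarrow> P r s)}"

lemma critical_points_eq: "critical_points \<Omega> P = \<Omega> - regular_points \<Omega> P"
  by (auto simp: critical_points_def regular_points_def)

lemma regular_pointsE:
  assumes "t \<in> regular_points \<Omega> P"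
  obtains U where "openin (top_of_set \<Omega>) U" "t \<in> U" "\<And>r s. r \<in> U \<Longrightarrow> s \<in> U \<Longrightarrow> r \<le> s \<Longrightarrow> P r s"
  using assms unfolding regular_points_def by blast

lemma regular_pointsI:
  assumes "openin (top_of_set \<Omega>) U" "t \<in> U" "\<And>r s. r \<in> U \<Longrightarrow> s \<in> U \<Longrightarrow> r \<le> s \<Longrightarrow> P r s"
  shows "t \<in> regular_points \<Omega> P"
  unfolding regular_points_def using assms by (intro CollectI exI[of _ U]) simp

lemma regular_points_mono:
  assumes "\<And>r s. r \<in> \<Omega> \<Longrightarrow> s \<in> \<Omega> \<Longrightarrow> r \<le> s \<Longrightarrow> P r s \<Longrightarrow> Q r s"
  shows "regular_points \<Omega> P \<subseteq> regular_points \<Omega> Q"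
proof
  fix t assume "t \<in> regular_points \<Omega> P"
  then obtain U where U: "openin (top_of_set \<Omega>) U" "t \<in> U"
    and P: "\<And>r s. r \<in> U \<Longrightarrow> s \<in> U \<Longrightarrow> r \<le> s \<Longrightarrow> P r s"
    by (rule regular_pointsE) blast
  have "U \<subseteq> \<Omega>"
    using U(1) by (rule openin_imp_subset)
  with U show "t \<in> regular_points \<Omega> Q"
    by (rule_tac regular_pointsI) (auto intro: assms P)
qed

lemma critical_points_antimono:
  "(\<And>r s. r \<in> \<Omega> \<Longrightarrow> s \<in> \<Omega> \<Longrightarrow> r \<le> s \<Longrightarrow> P r s \<Longrightarrow> Q r s) \<Longrightarrow>
     critical_points \<Omega> Q \<subseteq> critical_points \<Omega> P"
  unfolding critical_points_eq using regular_points_mono[of \<Omega> P Q] by blast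

lemma critical_points_conj:
  "critical_points \<Omega> (\<lambda>r s. P r s \<and> Q r s) = critical_points \<Omega> P \<union> critical_points \<Omega> Q"
proof -
  have "regular_points \<Omega> P \<inter> regular_points \<Omega> Q \<subseteq> regular_points \<Omega> (\<lambda>r s. P r s \<and> Q r s)"
  proof
    fix t assume "t \<in> regular_points \<Omega> P \<inter> regular_points \<Omega> Q"
    then obtain U V where U: "openin (top_of_set \<Omega>) U" "t \<in> U"
        and P: "\<And>r s. r \<in> U \<Longrightarrow> s \<in> U \<Longrightarrow> r \<le> s \<Longrightarrow> P r s"
        and V: "openin (top_of_set \<Omega>) V" "t \<in> V"
        and Q: "\<And>r s. r \<in> V \<Longrightarrow> s \<in> V \<Longrightarrow> r \<le> s \<Longrightarrow> Q r s"
      by (elim IntE regular_pointsE) metis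
    show "t \<in> regular_points \<Omega> (\<lambda>r s. P r s \<and> Q r s)"
      by (rule regular_pointsI[of _ "U \<inter> V"]) (use U V in \<open>auto intro: P Q\<close>)
  qed
  moreover have "regular_points \<Omega> (\<lambda>r s. P r s \<and> Q r s) \<subseteq> regular_points \<Omega> P"
      "regular_points \<Omega> (\<lambda>r s. P r s \<and> Q r s) \<subseteq> regular_points \<Omega> Q"
    by (intro regular_points_mono; simp)+
  ultimately show ?thesis
    unfolding critical_points_eq by blast
qed

lemma GACr_eq: "GACr c \<Omega> S = critical_points \<Omega> (geometric_iso c S)"
  and CACr_eq: "CACr c \<Omega> S = critical_points \<Omega> (combinatorial_iso c S)"
  and AACr_eq: "AACr c \<Omega> S = critical_points \<Omega> (algebraic_iso c S)"
  unfolding GACr_def CACr_def AACr_def geometric_iso_def combinatorial_iso_def algebraic_iso_def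
  by (rule refl)+

locale regular_system =
  fixes \<Omega> :: "'i::{topological_space,order} set" and S :: "('i, 's) persistence_system"
  assumes structure_map: "\<And>r s. r \<in> \<Omega> \<Longrightarrow> s \<in> \<Omega> \<Longrightarrow> r \<le> s \<Longrightarrow> structure_map S r s"
begin

lemma critical_point_inclusions:
  fixes c :: "'f::field coefficients"
  shows "Cr c \<Omega> S \<subseteq> GACr c \<Omega> S" "GACr c \<Omega> S \<subseteq> CACr c \<Omega> S" "CACr c \<Omega> S \<subseteq> AACr c \<Omega> S"
  unfolding Cr_def GACr_eq CACr_eq AACr_eq
  by (rule critical_points_antimono,
      rule structure_map.geometric_imp_absolute structure_map.combinatorial_imp_geometric
        structure_map.algebraic_imp_combinatorial, erule (2) structure_map, assumption)+

lemma critical_point_coefficients: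
  fixes c :: "'f::field coefficients"
  defines "Z \<equiv> Integer_coeffs :: 'f coefficients"
  shows "Cr c \<Omega> S \<subseteq> Cr Z \<Omega> S" "GACr c \<Omega> S \<subseteq> GACr Z \<Omega> S" "CACr c \<Omega> S \<subseteq> CACr Z \<Omega> S"
    "AACr c \<Omega> S \<subseteq> AACr Z \<Omega> S"
proof -
  have "Cr c \<Omega> S \<subseteq> Cr Z \<Omega> S"
    unfolding Cr_def Z_def
    by (rule critical_points_antimono, rule structure_map.integral_imp_algebraic(2),
        erule (2) structure_map, assumption)
  moreover have "AACr c \<Omega> S \<subseteq> Cr Z \<Omega> S"
    unfolding Cr_def AACr_eq Z_def
    by (rule critical_points_antimono, rule structure_map.integral_imp_algebraic(1),
        erule (2) structure_map, assumption)
  ultimately show "Cr c \<Omega> S \<subseteq> Cr Z \<Omega> S" "GACr c \<Omega> S \<subseteq> GACr Z \<Omega> S" "CACr c \<Omega> S \<subseteq> CACr Z \<Omega> S"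
    "AACr c \<Omega> S \<subseteq> AACr Z \<Omega> S"
    using critical_point_inclusions[of c] critical_point_inclusions[of Z] by blast+
qed

end

locale regular_system_map = S: regular_system \<Omega> S + S': regular_system \<Omega> S'
  for \<Omega> :: "'i::{topological_space,order} set" and S :: "('i, 's) persistence_system"
    and S' :: "('i, 'u) persistence_system" +
  fixes F :: "'i \<Rightarrow> 's \<Rightarrow> 'u" and \<epsilon> :: "'i \<Rightarrow> 's \<Rightarrow> int"
  assumes level_map: "\<And>t. t \<in> \<Omega> \<Longrightarrow> based_map S t S' t (F t) (\<epsilon> t)"
    and natural: "\<And>r s \<sigma>. r \<in> \<Omega> \<Longrightarrow> s \<in> \<Omega> \<Longrightarrow> r \<le> s \<Longrightarrow> \<sigma> \<in> simplices S r \<Longrightarrow>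
      transition S' r s (F r \<sigma>) = F s (transition S r s \<sigma>)"
    and natural_sign: "\<And>r s \<sigma>. r \<in> \<Omega> \<Longrightarrow> s \<in> \<Omega> \<Longrightarrow> r \<le> s \<Longrightarrow> \<sigma> \<in> simplices S r \<Longrightarrow>
      \<epsilon> s (transition S r s \<sigma>) = \<epsilon> r \<sigma>"
    and complex_image: "\<And>t A. t \<in> \<Omega> \<Longrightarrow> A \<subseteq> simplices S t \<Longrightarrow> is_complex S t A \<Longrightarrow>
      is_complex S' t (F t ` A)"
begin

text \<open>
  The structure maps of \<open>S\<close> and \<open>S'\<close> act on the exact sequences of the triples
  \<open>F A \<subseteq> F (simplices S) \<subseteq> simplices S'\<close> at \<open>r\<close> and at \<open>s\<close>.  The two squares commute by naturality,
  including that of the signs.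
\<close>

lemma split_exact_map_spans:
  assumes r: "r \<in> \<Omega>" and s: "s \<in> \<Omega>" and rs: "r \<le> s" and A: "face_closed S r A"
  defines "A' \<equiv> transition S r s ` A"
  defines "Q \<equiv> \<lambda>t A. quotient_complex (chains S t) (graded_span S A)"
    and "Q' \<equiv> \<lambda>t A. quotient_complex (chains S' t) (graded_span S' A)"
    and "q \<equiv> \<lambda>t A (h :: nat \<Rightarrow> ('s \<Rightarrow>\<^sub>0 int) \<Rightarrow> _) k. quot_map (grp (chains S' t) k) (graded_span S' A k) (h k)"
    and "q' \<equiv> \<lambda>t A (h :: nat \<Rightarrow> ('u \<Rightarrow>\<^sub>0 int) \<Rightarrow> _) k. quot_map (grp (chains S' t) k) (graded_span S' A k) (h k)"
  obtains \<rho> \<sigma> \<rho>' \<sigma>' where "split_exact_map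
    (Q r A) (Q' r (F r ` A)) (Q' r (F r ` simplices S r))
    (q r (F r ` A) (signed_map (F r) (\<epsilon> r))) (q' r (F r ` simplices S r) (\<lambda>k x. x)) \<rho> \<sigma>
    (Q s A') (Q' s (F s ` A')) (Q' s (F s ` simplices S s))
    (q s (F s ` A') (signed_map (F s) (\<epsilon> s))) (q' s (F s ` simplices S s) (\<lambda>k x. x)) \<rho>' \<sigma>'
    (\<lambda>k. quot_map (grp (chains S s) k) (graded_span S A' k) (chain_map S r s k))
    (q' s (F s ` A') (chain_map S' r s)) (q' s (F s ` simplices S s) (chain_map S' r s))"
proof -
  interpret T: structure_map S r s
    using r s rs by (rule S.structure_map)
  interpret T': structure_map S' r s
    using r s rs by (rule S'.structure_map)
  interpret Fr: based_map S r S' r "F r" "\<epsilon> r"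
    using r by (rule level_map)
  interpret Fs: based_map S s S' s "F s" "\<epsilon> s"
    using s by (rule level_map)
  have sub: "A \<subseteq> simplices S r"
    using A by (simp add: face_closed_def)
  have A': "face_closed S s A'"
    unfolding A'_def by (rule T.face_closed_image[OF A])
  have FA: "transition S' r s ` F r ` A = F s ` A'"
    using sub natural[OF r s rs] by (auto simp: A'_def image_image subset_iff intro!: image_cong)
  have "transition S' r s ` F r ` simplices S r \<subseteq> F s ` simplices S s"
    using natural[OF r s rs] T.F_simplex by auto
  then interpret e: pair_chain_hom "chains S' r" "chains S' s" T'.push
      "graded_span S' (F r ` simplices S r)" "graded_span S' (F s ` simplices S s)"
    by (intro T'.pair_chain_hom_push Fr.face_closed_image Fs.face_closed_image
        T.C.face_closed_simplices T.C'.face_closed_simplices)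
  interpret a: pair_chain_hom "chains S r" "chains S s" T.push "graded_span S A" "graded_span S A'"
    by (intro T.pair_chain_hom_push A A') (simp add: A'_def)
  interpret b: pair_chain_hom "chains S' r" "chains S' s" T'.push
      "graded_span S' (F r ` A)" "graded_span S' (F s ` A')"
    by (intro T'.pair_chain_hom_push Fr.face_closed_image Fs.face_closed_image A A') (simp add: FA)
  interpret i: pair_chain_hom "chains S r" "chains S' r" Fr.push "graded_span S A" "graded_span S' (F r ` A)"
    by (intro Fr.pair_chain_hom_push Fr.face_closed_image A) simp
  interpret i': pair_chain_hom "chains S s" "chains S' s" Fs.push "graded_span S A'" "graded_span S' (F s ` A')"
    by (intro Fs.pair_chain_hom_push Fs.face_closed_image A') simp
  have ident: "pair_chain_hom (chains S' t) (chains S' t) (\<lambda>k x. x) (graded_span S' H) (graded_span S' H')"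
    if "based_complex S' t" "face_closed S' t H" "face_closed S' t H'" "H \<subseteq> H'" for t H H'
  proof -
    interpret based_complex S' t by fact
    show ?thesis
      using that by (intro pair_chain_hom.intro pair_chain_hom_axioms.intro chain_hom.intro
          chain_hom_axioms.intro abelian_complex_chains subcomplex_span hom_ident)
        (auto simp: graded_span_def)
  qed
  interpret p: pair_chain_hom "chains S' r" "chains S' r" "\<lambda>k x. x"
      "graded_span S' (F r ` A)" "graded_span S' (F r ` simplices S r)"
    using sub by (intro ident Fr.face_closed_image T.C.face_closed_simplices A T'.C.based_complex_axioms) auto
  interpret p': pair_chain_hom "chains S' s" "chains S' s" "\<lambda>k x. x"
      "graded_span S' (F s ` A')" "graded_span S' (F s ` simplices S s)"
    using A' by (intro ident Fs.face_closed_image T.C'.face_closed_simplices T'.C'.based_complex_axioms)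
      (auto simp: face_closed_def)
  have natural_push: "T'.push k (Fr.push k x) = Fs.push k (T.push k x)"
    if x: "x \<in> carrier (grp (chains S r) k)" for k x
    unfolding signed_map_def frag_extend_frag_extend
    by (rule frag_extend_eq) (use x natural[OF r s rs] natural_sign[OF r s rs] in
        \<open>auto simp: frag_extend_cmul\<close>)
  show thesis
  proof (rule that, unfold Q_def Q'_def q_def q'_def chain_map_eq_signed_map,
      rule split_exact_map.intro[OF Fr.split_exact_span[OF A] Fs.split_exact_span[OF A']
        a.chain_hom_induced[unfolded a.induced_def[abs_def]]
        b.chain_hom_induced[unfolded b.induced_def[abs_def]]
        e.chain_hom_induced[unfolded e.induced_def[abs_def]]], rule split_exact_map_axioms.intro,
      unfold a.induced_def[symmetric] b.induced_def[symmetric] e.induced_def[symmetric]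
        i.induced_def[symmetric] i'.induced_def[symmetric] p.induced_def[symmetric] p'.induced_def[symmetric])
    fix k x
    assume "x \<in> carrier (grp (quotient_complex (chains S r) (graded_span S A)) k)"
    then obtain y where y: "y \<in> carrier (grp (chains S r) k)"
      and x: "x = graded_span S A k #>\<^bsub>grp (chains S r) k\<^esub> y"
      unfolding a.D.carrier_quotient by blast
    show "b.induced k (i.induced k x) = i'.induced k (a.induced k x)"
      unfolding x
      using y by (simp add: a.induced_coset b.induced_coset i.induced_coset i'.induced_coset
          T.push.closed Fr.push.closed natural_push del: grp_chains)
  next
    fix k x
    assume "x \<in> carrier (grp (quotient_complex (chains S' r) (graded_span S' (F r ` A))) k)"
    then obtain y where y: "y \<in> carrier (grp (chains S' r) k)"
      and x: "x = graded_span S' (F r ` A) k #>\<^bsub>grp (chains S' r) k\<^esub> y"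
      unfolding b.D.carrier_quotient by blast
    show "e.induced k (p.induced k x) = p'.induced k (b.induced k x)"
      unfolding x
      using y by (simp add: e.induced_coset b.induced_coset p.induced_coset p'.induced_coset
          T'.push.closed del: grp_chains)
  qed
qed

definition map_iso :: "'f::field coefficients \<Rightarrow> 'i \<Rightarrow> 'i \<Rightarrow> bool" where
  "map_iso c r s \<longleftrightarrow> relative_iso c S' r s (graded_span S' (F r ` simplices S r))
     (graded_span S' (F s ` simplices S s))"

lemma Cr_map_eq: "Cr_map c \<Omega> S S' F = critical_points \<Omega> (map_iso c)"
  unfolding Cr_map_def map_iso_def ..

lemma transition_image:
  assumes "r \<in> \<Omega>" "s \<in> \<Omega>" "r \<le> s" "A \<subseteq> simplices S r"
  shows "transition S' r s ` F r ` A = F s ` transition S r s ` A"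
  using natural[OF assms(1-3)] assms(4) by (auto simp: image_image subset_iff intro!: image_cong)

text \<open>
  The image of \<open>A\<close> under \<open>F\<close> is an admissible subcomplex for \<open>S'\<close>, so that the middle and the right
  map of the exact sequences are isomorphisms in homology.
\<close>

lemma geometric_iso_source:
  assumes rs: "r \<in> \<Omega>" "s \<in> \<Omega>" "r \<le> s" and S': "geometric_iso c S' r s" and F: "map_iso c r s"
  shows "geometric_iso c S r s"
  unfolding geometric_iso_def
proof (intro allI impI, elim conjE)
  fix A assume A: "A \<subseteq> simplices S r" "is_complex S r A"
  interpret T: structure_map S r s
    using rs by (rule S.structure_map)
  have "F r ` A \<subseteq> simplices S' r"
    using based_map.F_simplex[OF level_map[OF rs(1)]] A by blast
  then have "relative_iso c S' r s (graded_span S' (F r ` A)) (graded_span S' (transition S' r s ` F r ` A))"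
    using S' complex_image[OF rs(1) A] by (simp add: geometric_iso_def)
  note b = this[unfolded transition_image[OF rs A(1)] relative_iso_def]
  show "relative_iso c S r s (graded_span S A) (graded_span S (transition S r s ` A))"
    unfolding relative_iso_def
    by (rule split_exact_map_spans[OF rs T.complex_face_closed[OF A]],
        erule split_exact_map.homology_iso_left[OF _ b F[unfolded map_iso_def relative_iso_def]])
qed

text \<open>
  Apply the exact sequences with \<open>A\<close> empty; the left and the middle map are isomorphisms in homology
  with coefficients \<open>c\<close> because integral regularity of \<open>S\<close> and \<open>S'\<close> implies regularity over \<open>c\<close>.
\<close>

lemma map_iso_of_integral:
  fixes c :: "'f::field coefficients"
  assumes rs: "r \<in> \<Omega>" "s \<in> \<Omega>" "r \<le> s"
    and S: "absolute_iso (Integer_coeffs :: 'f coefficients) S r s"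
    and S': "absolute_iso (Integer_coeffs :: 'f coefficients) S' r s"
  shows "map_iso c r s"
proof -
  interpret T: structure_map S r s
    using rs by (rule S.structure_map)
  interpret T': structure_map S' r s
    using rs by (rule S'.structure_map)
  have "geometric_iso c S r s" "geometric_iso c S' r s"
    using T.integral_imp_algebraic(1)[OF S] T'.integral_imp_algebraic(1)[OF S']
    by (simp_all add: T.algebraic_imp_combinatorial T.combinatorial_imp_geometric
        T'.algebraic_imp_combinatorial T'.combinatorial_imp_geometric)
  then have "relative_iso c S r s (graded_span S {}) (graded_span S (transition S r s ` {}))"
      "relative_iso c S' r s (graded_span S' (F r ` {})) (graded_span S' (F s ` transition S r s ` {}))"
    using T.empty_complex T'.empty_complex by (auto simp: geometric_iso_def)
  note ab = this[unfolded relative_iso_def]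
  show ?thesis
    unfolding map_iso_def relative_iso_def
    by (rule split_exact_map_spans[OF rs T.complex_face_closed[OF empty_subsetI T.empty_complex]],
        erule split_exact_map.homology_iso_right[OF _ ab])
qed

lemma critical_point_map_inclusions:
  fixes c :: "'f::field coefficients"
  defines "Z \<equiv> Integer_coeffs :: 'f coefficients"
  shows "GACr c \<Omega> S \<subseteq> GACr c \<Omega> S' \<union> Cr_map c \<Omega> S S' F"
    and "GACr c \<Omega> S' \<union> Cr_map c \<Omega> S S' F \<subseteq> GACr Z \<Omega> S' \<union> Cr_map Z \<Omega> S S' F"
proof -
  show "GACr c \<Omega> S \<subseteq> GACr c \<Omega> S' \<union> Cr_map c \<Omega> S S' F"
    unfolding GACr_eq Cr_map_eq critical_points_conj[symmetric]
    by (rule critical_points_antimono) (use geometric_iso_source in blast)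
  have "geometric_iso c S' r s \<and> map_iso c r s"
    if rs: "r \<in> \<Omega>" "s \<in> \<Omega>" "r \<le> s" and reg: "geometric_iso Z S' r s" "map_iso Z r s" for r s
  proof -
    interpret T: structure_map S r s
      using rs by (rule S.structure_map)
    interpret T': structure_map S' r s
      using rs by (rule S'.structure_map)
    have S: "absolute_iso Z S r s" and S': "absolute_iso Z S' r s"
      using geometric_iso_source[OF rs reg] reg
      by (simp_all add: T.geometric_imp_absolute T'.geometric_imp_absolute)
    show ?thesis
      using map_iso_of_integral[OF rs S[unfolded Z_def] S'[unfolded Z_def]]
        T'.integral_imp_algebraic(1)[OF S'[unfolded Z_def]]
      by (simp add: T'.algebraic_imp_combinatorial T'.combinatorial_imp_geometric)
  qed
  then show "GACr c \<Omega> S' \<union> Cr_map c \<Omega> S S' F \<subseteq> GACr Z \<Omega> S' \<union> Cr_map Z \<Omega> S S' F"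
    unfolding GACr_eq Cr_map_eq critical_points_conj[symmetric]
    by (intro critical_points_antimono) blast
qed

end

section \<open>Directed simplicial complexes\<close>

definition del_nth :: "nat \<Rightarrow> 'a list \<Rightarrow> 'a list" where
  "del_nth i \<sigma> = take i \<sigma> @ drop (Suc i) \<sigma>"

lemma directed_boundary_eq:
  "directed_boundary \<sigma> = (\<Sum>i<length \<sigma>. frag_cmul ((- 1) ^ i) (frag_of (del_nth i \<sigma>)))"
  by (simp add: directed_boundary_def del_nth_def)

lemma length_del_nth: "i < length \<sigma> \<Longrightarrow> length (del_nth i \<sigma>) = length \<sigma> - 1"
  by (simp add: del_nth_def)

lemma subseq_del_nth: "subseq (del_nth i \<sigma>) \<sigma>"
proof -
  have "drop (Suc i) \<sigma> = tl (drop i \<sigma>)"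
    by (simp add: drop_Suc tl_drop)
  then have "subseq (drop (Suc i) \<sigma>) (drop i \<sigma>)"
    by (cases "drop i \<sigma>") auto
  then have "subseq (take i \<sigma> @ drop (Suc i) \<sigma>) (take i \<sigma> @ drop i \<sigma>)"
    by (rule list_emb_append_mono[OF subseq_order.order_refl])
  then show ?thesis
    by (simp add: del_nth_def)
qed

lemma nth_del_nth: "k < length \<sigma> - 1 \<Longrightarrow> i < length \<sigma> \<Longrightarrow> del_nth i \<sigma> ! k = \<sigma> ! (if k < i then k else Suc k)"
  by (auto simp: del_nth_def nth_append min_def)

lemma del_nth_del_nth:
  assumes "j < i" "i < length \<sigma>"
  shows "del_nth j (del_nth i \<sigma>) = del_nth (i - 1) (del_nth j \<sigma>)"
  by (rule nth_equalityI) (use assms in \<open>auto simp: nth_del_nth length_del_nth\<close>)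

text \<open>
  Deleting the entries \<open>j < i\<close> in either order leaves the same list, but with opposite signs, since
  the later entry moves from position \<open>i\<close> to \<open>i - 1\<close> if the earlier one is deleted first.
\<close>

lemma directed_boundary_directed_boundary:
  "frag_extend directed_boundary (directed_boundary \<sigma>) = 0"
proof -
  define n where "n = length \<sigma>"
  define f where "f = (\<lambda>(i, j). frag_cmul ((- 1) ^ (i + j)) (frag_of (del_nth j (del_nth i \<sigma>))))"
  define L where "L = {(i, j). j < i \<and> i < n}"
  define U where "U = {(i, j). i \<le> j \<and> j < n - 1}"
  have "finite L" "finite U"
    by (rule finite_subset[of _ "{..<n} \<times> {..<n}"]; force simp: L_def U_def)+
  have LU: "{..<n} \<times> {..<n - 1} = L \<union> U" "L \<inter> U = {}"
    by (auto simp: L_def U_def)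
  have "frag_extend directed_boundary (directed_boundary \<sigma>) = (\<Sum>i<n. \<Sum>j<n - 1. f (i, j))"
    by (simp add: directed_boundary_eq[of \<sigma>] frag_extend_sum frag_extend_cmul f_def n_def o_def)
      (auto intro!: sum.cong simp: directed_boundary_eq length_del_nth frag_cmul_sum power_add)
  also have "\<dots> = sum f ({..<n} \<times> {..<n - 1})"
    by (simp add: sum.cartesian_product case_prod_beta)
  also have "\<dots> = sum f L + sum f U"
    unfolding LU(1) using \<open>finite L\<close> \<open>finite U\<close> LU(2) by (rule sum.union_disjoint)
  also have "sum f L = (\<Sum>x\<in>U. - f x)"
  proof (rule sum.reindex_bij_witness[of _ "\<lambda>(i, j). (Suc j, i)" "\<lambda>(i, j). (j, i - 1)"])
    fix x assume "x \<in> L"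
    then obtain i j where x: "x = (i, j)" "j < i" "i < length \<sigma>"
      by (auto simp: L_def n_def)
    then have "(- 1 :: int) ^ (i + j) = - ((- 1) ^ (j + (i - 1)))"
      by (cases i) (auto simp: add.commute)
    then show "- f (case x of (i, j) \<Rightarrow> (j, i - 1)) = f x"
      using x by (simp add: f_def del_nth_del_nth)
  qed (auto simp: L_def U_def)
  finally show ?thesis
    by (simp add: sum_negf)
qed

lemma keys_directed_boundary:
  "Poly_Mapping.keys (directed_boundary \<sigma>) \<subseteq> (\<lambda>i. del_nth i \<sigma>) ` {..<length \<sigma>}"
proof -
  have "Poly_Mapping.keys (directed_boundary \<sigma>)
      \<subseteq> (\<Union>i<length \<sigma>. Poly_Mapping.keys (frag_cmul ((- 1) ^ i) (frag_of (del_nth i \<sigma>))))"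
    unfolding directed_boundary_eq by (rule keys_sum)
  then show ?thesis
    by auto
qed

lemma face_of_directed_boundary:
  assumes "1 < length \<sigma>" "\<tau> \<in> Poly_Mapping.keys (directed_boundary \<sigma>)"
  shows "\<tau> \<noteq> [] \<and> subseq \<tau> \<sigma> \<and> length \<tau> = length \<sigma> - 1"
proof -
  obtain i where "i < length \<sigma>" "\<tau> = del_nth i \<sigma>"
    using assms(2) keys_directed_boundary by fastforce
  then show ?thesis
    using assms(1) length_del_nth[of i \<sigma>] subseq_del_nth[of i \<sigma>] by auto
qed

lemma directed_boundary_map:
  "directed_boundary (map f \<sigma>) = signed_map (map f) (\<lambda>_. 1) k (directed_boundary \<sigma>)"
  by (simp add: directed_boundary_eq signed_map_def frag_extend_sum frag_extend_cmul o_def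
      del_nth_def take_map drop_map)

lemma based_complex_directed:
  assumes "directed_simplicial_complex V (K t)"
  shows "based_complex (directed_system X \<phi> K) t"
proof
  let ?S = "directed_system X \<phi> K"
  fix \<sigma> assume \<sigma>: "\<sigma> \<in> simplices ?S t" "0 < dimn ?S \<sigma>"
  show "face_sum ?S t \<sigma> \<in> carrier (free_Abelian_group
      {\<tau> \<in> simplices ?S t. dimn ?S \<tau> = dimn ?S \<sigma> - 1})"
    using \<sigma> assms face_of_directed_boundary[of \<sigma>]
    by (auto simp: directed_system_def directed_simplicial_complex_def)
qed (simp add: directed_system_def directed_boundary_directed_boundary)

lemma based_map_directed:
  assumes "directed_simplicial_complex V (K r)" "directed_simplicial_complex V' (K' s)"
    and "directed_simplicial_map V V' (K r) (K' s) f"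
  shows "based_map (directed_system X \<phi> K) r (directed_system X' \<phi>' K') s (map f) (\<lambda>_. 1)"
  using assms
  by (intro based_map.intro based_map_axioms.intro based_complex_directed)
    (auto simp: directed_system_def directed_simplicial_map_def directed_boundary_map)

lemma face_closed_directed:
  assumes "A \<subseteq> K t" "directed_simplicial_complex V A"
  shows "face_closed (directed_system X \<phi> K) t A"
  using assms face_of_directed_boundary
  by (force simp: face_closed_def directed_system_def directed_simplicial_complex_def)

lemma regular_system_directed:
  assumes "persistence_directed_complex \<Omega> X \<phi> K"
  shows "regular_system \<Omega> (directed_system X \<phi> K)"
proof (rule regular_system.intro)
  fix r s assume rs: "r \<in> \<Omega>" "s \<in> \<Omega>" "r \<le> s"
  let ?S = "directed_system X \<phi> K"
  have "based_map ?S r ?S s (map (\<phi> r s)) (\<lambda>_. 1)"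
    using assms rs unfolding persistence_directed_complex_def
    by (intro based_map_directed[of "topspace (X r)" _ _ "topspace (X s)"]) auto
  then show "structure_map ?S r s"
  proof (intro structure_map.intro structure_map_axioms.intro)
    show "face_closed ?S r A" if "A \<subseteq> simplices ?S r" "is_complex ?S r A" for A
      by (rule face_closed_directed[of _ _ _ "topspace (X r)"])
        (use that in \<open>simp_all add: directed_system_def\<close>)
    show "is_complex ?S r {}"
      by (simp add: directed_system_def directed_simplicial_complex_def hyperdigraph_def)
  qed (simp add: directed_system_def)
qed

lemma directed_simplicial_complex_image:
  assumes "directed_simplicial_complex V A" "hyperdigraph V' (map f ` A)"
  shows "directed_simplicial_complex V' (map f ` A)"
proof -
  have "\<tau> \<in> map f ` A" if \<tau>: "\<tau> \<noteq> []" "subseq \<tau> (map f \<sigma>)" and \<sigma>: "\<sigma> \<in> A" for \<sigma> \<tau>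
  proof -
    obtain N where N: "\<tau> = map f (nths \<sigma> N)"
      using \<tau>(2) by (auto simp: subseq_conv_nths nths_map)
    moreover have "subseq (nths \<sigma> N) \<sigma>"
      by (auto simp: subseq_conv_nths)
    ultimately have "nths \<sigma> N \<in> A"
      using assms(1) \<sigma> \<tau>(1) by (auto simp: directed_simplicial_complex_def)
    then show ?thesis
      using N by blast
  qed
  then show ?thesis
    using assms(2) by (auto simp: directed_simplicial_complex_def)
qed

lemma regular_system_map_directed:
  assumes K: "persistence_directed_complex \<Omega> X \<phi> K" and K': "persistence_directed_complex \<Omega> X' \<phi>' K'"
    and f: "persistence_directed_map \<Omega> X \<phi> K X' \<phi>' K' f"
  shows "regular_system_map \<Omega> (directed_system X \<phi> K) (directed_system X' \<phi>' K') (\<lambda>t. map (f t)) (\<lambda>_ _. 1)"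
proof (intro regular_system_map.intro regular_system_map_axioms.intro regular_system_directed K K')
  let ?S = "directed_system X \<phi> K" and ?S' = "directed_system X' \<phi>' K'"
  show "based_map ?S t ?S' t (map (f t)) (\<lambda>_. 1)"
    if "t \<in> \<Omega>" for t
    using that K K' f unfolding persistence_directed_complex_def persistence_directed_map_def
    by (intro based_map_directed[of "topspace (X t)" _ _ "topspace (X' t)"]) auto
  fix r s \<sigma> assume rs: "r \<in> \<Omega>" "s \<in> \<Omega>" "r \<le> s" and "\<sigma> \<in> simplices ?S r"
  then have \<sigma>: "\<sigma> \<in> K r"
    by (simp add: directed_system_def)
  have "[v] \<in> K r" if "v \<in> set \<sigma>" for v
    using K rs \<sigma> that
    by (auto simp: persistence_directed_complex_def directed_simplicial_complex_def subseq_singleton_left)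
  then show "transition ?S' r s (map (f r) \<sigma>)
      = map (f s) (transition ?S r s \<sigma>)"
    using f rs by (simp add: directed_system_def persistence_directed_map_def)
next
  let ?S = "directed_system X \<phi> K" and ?S' = "directed_system X' \<phi>' K'"
  fix t A
  assume t: "t \<in> \<Omega>" and A: "A \<subseteq> simplices ?S t" "is_complex ?S t A"
  have "map (f t) ` A \<subseteq> K' t"
    using f t A by (auto simp: persistence_directed_map_def directed_simplicial_map_def directed_system_def)
  moreover have "hyperdigraph (topspace (X' t)) (K' t)"
    using K' t by (simp add: persistence_directed_complex_def directed_simplicial_complex_def)
  ultimately have "hyperdigraph (topspace (X' t)) (map (f t) ` A)"
    unfolding hyperdigraph_def by (meson subsetD)
  then show "is_complex ?S' t (map (f t) ` A)"
    using A by (auto simp: directed_system_def intro: directed_simplicial_complex_image)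
qed simp

section \<open>Simplicial complexes with ordered vertices\<close>

definition position :: "('a \<Rightarrow> real) \<Rightarrow> 'a set \<Rightarrow> 'a \<Rightarrow> nat" where
  "position e \<sigma> v = card {w \<in> \<sigma>. e w < e v}"

lemma ordered_boundary_eq:
  "ordered_boundary e \<sigma> = (\<Sum>v\<in>\<sigma>. frag_cmul ((- 1) ^ position e \<sigma> v) (frag_of (\<sigma> - {v})))"
  by (simp add: ordered_boundary_def position_def)

lemma position_remove:
  assumes "finite \<sigma>" "v \<in> \<sigma>"
  shows "position e \<sigma> w = position e (\<sigma> - {v}) w + (if e v < e w then 1 else 0)"
proof -
  have "{u \<in> \<sigma>. e u < e w} = {u \<in> \<sigma> - {v}. e u < e w} \<union> (if e v < e w then {v} else {})"
    using assms by auto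
  then show ?thesis
    using assms unfolding position_def by (cases "e v < e w") simp_all
qed

text \<open>
  Removing two vertices in either order gives the same face with opposite signs, because exactly one
  of the two lowers the position of the other.  So the sum equals its own negative.
\<close>

lemma ordered_boundary_ordered_boundary:
  assumes \<sigma>: "finite \<sigma>" and e: "inj_on e \<sigma>"
  shows "frag_extend (ordered_boundary e) (ordered_boundary e \<sigma>) = 0"
proof -
  define f where "f = (\<lambda>(v, w). frag_cmul ((- 1) ^ (position e \<sigma> v + position e (\<sigma> - {v}) w)) (frag_of (\<sigma> - {v} - {w})))"
  define P where "P = Sigma \<sigma> (\<lambda>v. \<sigma> - {v})"
  have "frag_extend (ordered_boundary e) (ordered_boundary e \<sigma>) = (\<Sum>v\<in>\<sigma>. \<Sum>w\<in>\<sigma> - {v}. f (v, w))"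
    using \<sigma> by (simp add: ordered_boundary_eq[of e \<sigma>] frag_extend_sum frag_extend_cmul o_def)
      (simp add: ordered_boundary_eq frag_cmul_sum f_def power_add)
  also have "\<dots> = sum f P"
    using \<sigma> by (simp add: P_def sum.Sigma case_prod_beta)
  finally have eq: "frag_extend (ordered_boundary e) (ordered_boundary e \<sigma>) = sum f P" .
  have "sum f P = (\<Sum>x\<in>P. - f x)"
  proof (rule sum.reindex_bij_witness[of _ prod.swap prod.swap])
    fix x assume "x \<in> P"
    then obtain v w where x: "x = (v, w)" "v \<in> \<sigma>" "w \<in> \<sigma>" "v \<noteq> w"
      by (auto simp: P_def)
    then have "e v < e w \<or> e w < e v"
      using inj_on_contraD[OF e x(4,2,3)] by linarith
    then have "(- 1 :: int) ^ (position e \<sigma> v + position e (\<sigma> - {v}) w)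
        = - ((- 1) ^ (position e \<sigma> w + position e (\<sigma> - {w}) v))"
      using position_remove[OF \<sigma> x(2), of e w] position_remove[OF \<sigma> x(3), of e v] by (auto simp: add.commute)
    moreover have "\<sigma> - {v} - {w} = \<sigma> - {w} - {v}"
      by blast
    ultimately show "- f (prod.swap x) = f x"
      using x by (simp add: f_def)
  qed (auto simp: P_def)
  then have "sum f P = - sum f P"
    by (simp add: sum_negf)
  then have "poly_mapping.lookup (sum f P) x = - poly_mapping.lookup (sum f P) x" for x
    by (metis lookup_uminus)
  then have "sum f P = 0"
    by (intro poly_mapping_eqI) simp
  then show ?thesis
    by (simp add: eq)
qed

lemma keys_ordered_boundary: "Poly_Mapping.keys (ordered_boundary e \<sigma>) \<subseteq> (\<lambda>v. \<sigma> - {v}) ` \<sigma>"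
proof -
  have "Poly_Mapping.keys (ordered_boundary e \<sigma>)
      \<subseteq> (\<Union>v\<in>\<sigma>. Poly_Mapping.keys (frag_cmul ((- 1) ^ position e \<sigma> v) (frag_of (\<sigma> - {v}))))"
    unfolding ordered_boundary_eq by (rule keys_sum)
  then show ?thesis
    by auto
qed

lemma face_of_ordered_boundary:
  assumes "1 < card \<sigma>" "\<tau> \<in> Poly_Mapping.keys (ordered_boundary e \<sigma>)"
  shows "\<tau> \<noteq> {} \<and> \<tau> \<subseteq> \<sigma> \<and> card \<tau> = card \<sigma> - 1"
proof -
  obtain v where v: "v \<in> \<sigma>" "\<tau> = \<sigma> - {v}"
    using assms(2) keys_ordered_boundary by fastforce
  then have "card \<tau> = card \<sigma> - 1"
    by (simp add: card_Diff_singleton)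
  moreover from this have "\<tau> \<noteq> {}"
    using assms(1) by auto
  ultimately show ?thesis
    using v by auto
qed

text \<open>
  The hypothesis on \<open>\<epsilon>\<close> compares the two coefficients with which the image of a face \<open>\<sigma> - {v}\<close> occurs.
\<close>

lemma ordered_boundary_image:
  assumes \<sigma>: "finite \<sigma>" and f: "inj_on f \<sigma>"
    and sign: "\<And>v. v \<in> \<sigma> \<Longrightarrow> \<epsilon> \<sigma> * (- 1) ^ position e' (f ` \<sigma>) (f v) = (- 1) ^ position e \<sigma> v * \<epsilon> (\<sigma> - {v})"
  shows "frag_cmul (\<epsilon> \<sigma>) (ordered_boundary e' (f ` \<sigma>)) = signed_map (image f) \<epsilon> k (ordered_boundary e \<sigma>)"
proof -
  have "f ` (\<sigma> - {v}) = f ` \<sigma> - {f v}" if "v \<in> \<sigma>" for v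
    using f that by (auto simp: inj_on_def)
  then show ?thesis
    using \<sigma> by (simp add: ordered_boundary_eq signed_map_def frag_extend_sum frag_extend_cmul o_def
        frag_cmul_sum sum.reindex[OF f] sign)
qed

definition inversions :: "('a \<Rightarrow> real) \<Rightarrow> ('a \<Rightarrow> real) \<Rightarrow> 'a set \<Rightarrow> ('a \<times> 'a) set" where
  "inversions e e' \<sigma> = {(v, w) \<in> \<sigma> \<times> \<sigma>. e v < e w \<and> e' w < e' v}"

text \<open>
  Count the vertices \<open>w\<close> other than \<open>v\<close> by the order of \<open>w\<close> and \<open>v\<close> under \<open>e\<close> and \<open>e'\<close>: let \<open>c\<close> precede
  \<open>v\<close> under both, \<open>a\<close> under \<open>e\<close> only and \<open>b\<close> under \<open>e'\<close> only.  Then \<open>v\<close> has position \<open>a + c\<close> under \<open>e\<close> and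
  \<open>b + c\<close> under \<open>e'\<close> and is part of \<open>a + b\<close> inversions, and \<open>(a + b) + (b + c)\<close> has the parity of
  \<open>a + c\<close>.
\<close>

lemma inversion_sign_face:
  assumes \<sigma>: "finite \<sigma>" and v: "v \<in> \<sigma>" and inj: "inj_on e \<sigma>" "inj_on e' \<sigma>"
  shows "(- 1 :: int) ^ card (inversions e e' \<sigma>) * (- 1) ^ position e' \<sigma> v
    = (- 1) ^ position e \<sigma> v * (- 1) ^ card (inversions e e' (\<sigma> - {v}))"
proof -
  define a where "a = {w \<in> \<sigma>. e w < e v \<and> e' v < e' w}"
  define b where "b = {w \<in> \<sigma>. e v < e w \<and> e' w < e' v}"
  define c where "c = {w \<in> \<sigma>. e w < e v \<and> e' w < e' v}"
  have fin: "finite a" "finite b" "finite c"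
    using \<sigma> by (auto simp: a_def b_def c_def)
  have neq: "e w \<noteq> e v \<and> e' w \<noteq> e' v" if "w \<in> \<sigma>" "w \<noteq> v" for w
    using that v inj by (auto simp: inj_on_def)
  have "{w \<in> \<sigma>. e w < e v} = a \<union> c" "{w \<in> \<sigma>. e' w < e' v} = b \<union> c"
    using neq by (auto simp: a_def b_def c_def) (metis less_irrefl neq_iff)+
  moreover have "a \<inter> c = {}" "b \<inter> c = {}"
    by (auto simp: a_def b_def c_def)
  ultimately have pos: "position e \<sigma> v = card a + card c" "position e' \<sigma> v = card b + card c"
    using fin by (simp_all add: position_def card_Un_disjoint)
  have split: "inversions e e' \<sigma> = inversions e e' (\<sigma> - {v}) \<union> ((\<lambda>w. (w, v)) ` a \<union> (\<lambda>w. (v, w)) ` b)"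
    using v by (auto simp: inversions_def a_def b_def)
  have "card (inversions e e' \<sigma>)
      = card (inversions e e' (\<sigma> - {v})) + card ((\<lambda>w. (w, v)) ` a \<union> (\<lambda>w. (v, w)) ` b)"
  proof -
    have "finite (inversions e e' (\<sigma> - {v}))"
      using \<sigma> by (rule_tac finite_subset[of _ "\<sigma> \<times> \<sigma>"]) (auto simp: inversions_def)
    then show ?thesis
      unfolding split using fin by (subst card_Un_disjoint) (auto simp: inversions_def)
  qed
  also have "card ((\<lambda>w. (w, v)) ` a \<union> (\<lambda>w. (v, w)) ` b) = card a + card b"
  proof -
    have "(\<lambda>w. (w, v)) ` a \<inter> (\<lambda>w. (v, w)) ` b = {}"
      by (auto simp: a_def)
    then show ?thesis
      using fin by (simp add: card_Un_disjoint card_image inj_on_def)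
  qed
  finally show ?thesis
    by (simp add: pos power_add)
qed

lemma abstract_simplicial_complexD:
  assumes "abstract_simplicial_complex V K" "\<sigma> \<in> K"
  shows "finite \<sigma>" "\<sigma> \<noteq> {}" "\<sigma> \<subseteq> V" "v \<in> \<sigma> \<Longrightarrow> {v} \<in> K" "\<tau> \<noteq> {} \<Longrightarrow> \<tau> \<subseteq> \<sigma> \<Longrightarrow> \<tau> \<in> K"
proof -
  show "finite \<sigma>" "\<sigma> \<noteq> {}" "\<sigma> \<subseteq> V"
    using assms by (simp_all add: abstract_simplicial_complex_def hypergraph_def)
  show face: "\<tau> \<in> K" if "\<tau> \<noteq> {}" "\<tau> \<subseteq> \<sigma>" for \<tau>
    using assms that unfolding abstract_simplicial_complex_def by blast
  show "{v} \<in> K" if "v \<in> \<sigma>"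
    by (rule face) (use that in auto)
qed

lemma based_complex_simplicial:
  assumes K: "abstract_simplicial_complex V (K t)" and e: "inj_on (e t) V"
  shows "based_complex (simplicial_system X \<phi> e K) t"
proof
  let ?S = "simplicial_system X \<phi> e K"
  fix \<sigma> assume \<sigma>: "\<sigma> \<in> simplices ?S t"
  then have \<sigma>': "\<sigma> \<in> K t"
    by (simp add: simplicial_system_def)
  show "face_sum ?S t \<sigma> \<in> carrier (free_Abelian_group
      {\<tau> \<in> simplices ?S t. dimn ?S \<tau> = dimn ?S \<sigma> - 1})"
    if "0 < dimn ?S \<sigma>"
    using that abstract_simplicial_complexD(5)[OF K \<sigma>'] face_of_ordered_boundary[of \<sigma> _ "e t"]
    by (auto simp: simplicial_system_def)
  have "inj_on (e t) \<sigma>"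
    using e abstract_simplicial_complexD(3)[OF K \<sigma>'] by (rule inj_on_subset)
  then show "frag_extend (face_sum ?S t) (face_sum ?S t \<sigma>) = 0"
    using abstract_simplicial_complexD(1)[OF K \<sigma>'] by (simp add: simplicial_system_def ordered_boundary_ordered_boundary)
qed

lemma injective_simplicial_map_inj:
  assumes K: "abstract_simplicial_complex V K" and f: "injective_simplicial_map V V' K K' f"
  shows "\<sigma> \<in> K \<Longrightarrow> inj_on f \<sigma>" and "inj_on (image f) K"
proof -
  have inj: "inj_on f {v. {v} \<in> K}"
    using f by (simp add: injective_simplicial_map_def)
  have sub: "\<sigma> \<subseteq> {v. {v} \<in> K}" if "\<sigma> \<in> K" for \<sigma>
    using abstract_simplicial_complexD(4)[OF K that] by blast
  show "inj_on f \<sigma>" if "\<sigma> \<in> K"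
    by (rule inj_on_subset[OF inj sub[OF that]])
  show "inj_on (image f) K"
  proof (rule inj_onI)
    fix \<sigma> \<tau> assume "\<sigma> \<in> K" "\<tau> \<in> K" "f ` \<sigma> = f ` \<tau>"
    then show "\<sigma> = \<tau>"
      using inj_on_image_eq_iff[OF inj sub sub] by blast
  qed
qed

lemma based_map_simplicial:
  assumes K: "abstract_simplicial_complex V (K r)" and K': "abstract_simplicial_complex V' (K' s)"
    and e: "inj_on (e r) V" and e': "inj_on (e' s) V'"
    and f: "injective_simplicial_map V V' (K r) (K' s) f"
    and unit: "\<And>\<sigma>. \<sigma> \<in> K r \<Longrightarrow> \<epsilon> \<sigma> * \<epsilon> \<sigma> = 1"
    and sign: "\<And>\<sigma> v. \<sigma> \<in> K r \<Longrightarrow> v \<in> \<sigma> \<Longrightarrow>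
      \<epsilon> \<sigma> * (- 1) ^ position (e' s) (f ` \<sigma>) (f v) = (- 1) ^ position (e r) \<sigma> v * \<epsilon> (\<sigma> - {v})"
  shows "based_map (simplicial_system X \<phi> e K) r (simplicial_system X' \<phi>' e' K') s (image f) \<epsilon>"
proof (intro based_map.intro based_map_axioms.intro)
  let ?S = "simplicial_system X \<phi> e K" and ?S' = "simplicial_system X' \<phi>' e' K'"
  show "based_complex ?S r" "based_complex ?S' s"
    using K K' e e' by (auto intro: based_complex_simplicial)
  show "inj_on (image f) (simplices ?S r)"
    using injective_simplicial_map_inj(2)[OF K f] by (simp add: simplicial_system_def)
  fix \<sigma> assume "\<sigma> \<in> simplices ?S r"
  then have \<sigma>: "\<sigma> \<in> K r"
    by (simp add: simplicial_system_def)
  note inj = injective_simplicial_map_inj(1)[OF K f \<sigma>]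
  show "f ` \<sigma> \<in> simplices ?S' s"
    using f \<sigma> by (simp add: simplicial_system_def injective_simplicial_map_def simplicial_map_def)
  show "dimn ?S' (f ` \<sigma>) = dimn ?S \<sigma>"
    using inj by (simp add: simplicial_system_def card_image)
  show "\<epsilon> \<sigma> * \<epsilon> \<sigma> = 1"
    using \<sigma> by (rule unit)
  show "frag_cmul (\<epsilon> \<sigma>) (face_sum ?S' s (f ` \<sigma>)) =
      signed_map (image f) \<epsilon> (dimn ?S \<sigma> - 1) (face_sum ?S r \<sigma>)"
    using ordered_boundary_image[OF abstract_simplicial_complexD(1)[OF K \<sigma>] inj sign[OF \<sigma>]]
    by (simp add: simplicial_system_def)
qed

lemma face_closed_simplicial:
  assumes "A \<subseteq> K t" "abstract_simplicial_complex V A"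
  shows "face_closed (simplicial_system X \<phi> e K) t A"
  unfolding face_closed_def
proof (intro conjI ballI impI)
  fix \<sigma> assume "\<sigma> \<in> A" "0 < dimn (simplicial_system X \<phi> e K) \<sigma>"
  then show "Poly_Mapping.keys (face_sum (simplicial_system X \<phi> e K) t \<sigma>) \<subseteq> A"
    using abstract_simplicial_complexD(5)[OF assms(2)] face_of_ordered_boundary[of \<sigma> _ "e t"]
    by (auto simp: simplicial_system_def)
qed (use assms in \<open>simp add: simplicial_system_def\<close>)

lemma persistence_embedding_inj:
  assumes "persistence_embedding \<Omega> X \<phi> e" "t \<in> \<Omega>"
  shows "inj_on (e t) (topspace (X t))"
  using assms by (auto simp: persistence_embedding_def embedding_map_def intro: homeomorphic_imp_injective_map)

text \<open>
  The compatibility of the structure maps with the embeddings into the reals makes them injective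
  and order-preserving, so that positions are preserved and trivial signs suffice.
\<close>

lemma regular_system_simplicial:
  assumes e: "persistence_embedding \<Omega> X \<phi> e" and K: "persistence_simplicial_complex \<Omega> X \<phi> K"
  shows "regular_system \<Omega> (simplicial_system X \<phi> e K)"
proof (rule regular_system.intro)
  fix r s assume rs: "r \<in> \<Omega>" "s \<in> \<Omega>" "r \<le> s"
  let ?S = "simplicial_system X \<phi> e K"
  have Kr: "abstract_simplicial_complex (topspace (X r)) (K r)"
    and Ks: "abstract_simplicial_complex (topspace (X s)) (K s)"
    and \<phi>: "simplicial_map (topspace (X r)) (topspace (X s)) (K r) (K s) (\<phi> r s)"
    using K rs by (auto simp: persistence_simplicial_complex_def)
  have e_\<phi>: "e s (\<phi> r s x) = e r x" if "x \<in> topspace (X r)" for x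
    using e rs that by (auto simp: persistence_embedding_def)
  have inj: "inj_on (\<phi> r s) (topspace (X r))"
  proof (rule inj_onI)
    fix x y assume "x \<in> topspace (X r)" "y \<in> topspace (X r)" "\<phi> r s x = \<phi> r s y"
    then show "x = y"
      using e_\<phi> persistence_embedding_inj[OF e rs(1)] by (metis inj_onD)
  qed
  have "{v. {v} \<in> K r} \<subseteq> topspace (X r)"
    using abstract_simplicial_complexD(3)[OF Kr] by blast
  then have "injective_simplicial_map (topspace (X r)) (topspace (X s)) (K r) (K s) (\<phi> r s)"
    using \<phi> inj by (auto simp: injective_simplicial_map_def intro: inj_on_subset)
  moreover have "position (e s) (\<phi> r s ` \<sigma>) (\<phi> r s v) = position (e r) \<sigma> v"
    if \<sigma>: "\<sigma> \<in> K r" and v: "v \<in> \<sigma>" for \<sigma> v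
  proof -
    have sub: "\<sigma> \<subseteq> topspace (X r)"
      using abstract_simplicial_complexD(3)[OF Kr \<sigma>] .
    then have "{w \<in> \<phi> r s ` \<sigma>. e s w < e s (\<phi> r s v)} = \<phi> r s ` {w \<in> \<sigma>. e r w < e r v}"
      using v e_\<phi> by (auto simp: subset_iff)
    moreover have "inj_on (\<phi> r s) {w \<in> \<sigma>. e r w < e r v}"
      using sub by (intro inj_on_subset[OF inj]) auto
    ultimately show ?thesis
      by (simp add: position_def card_image)
  qed
  ultimately have "based_map ?S r ?S s (image (\<phi> r s)) (\<lambda>_. 1)"
    using Kr Ks persistence_embedding_inj[OF e rs(1)] persistence_embedding_inj[OF e rs(2)]
    by (intro based_map_simplicial[of "topspace (X r)" _ _ "topspace (X s)"]) auto
  then show "structure_map ?S r s"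
  proof (intro structure_map.intro structure_map_axioms.intro)
    show "face_closed ?S r A" if "A \<subseteq> simplices ?S r" "is_complex ?S r A" for A
      by (rule face_closed_simplicial[of _ _ _ "topspace (X r)"])
        (use that in \<open>simp_all add: simplicial_system_def\<close>)
    show "is_complex ?S r {}"
      by (simp add: simplicial_system_def abstract_simplicial_complex_def hypergraph_def)
  qed (simp add: simplicial_system_def)
qed

lemma abstract_simplicial_complex_image:
  assumes "abstract_simplicial_complex V A" "hypergraph V' (image f ` A)"
  shows "abstract_simplicial_complex V' (image f ` A)"
proof -
  have "\<tau> \<in> image f ` A" if \<tau>: "\<tau> \<noteq> {}" "\<tau> \<subseteq> f ` \<sigma>" and \<sigma>: "\<sigma> \<in> A" for \<sigma> \<tau>
  proof -
    obtain \<rho> where "\<rho> \<subseteq> \<sigma>" "\<tau> = f ` \<rho>"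
      using \<tau>(2) by (auto simp: subset_image_iff)
    then show ?thesis
      using abstract_simplicial_complexD(5)[OF assms(1) \<sigma>, of \<rho>] \<tau>(1) by blast
  qed
  then show ?thesis
    using assms(2) by (auto simp: abstract_simplicial_complex_def)
qed

text \<open>
  The sign of the permutation that sorts by \<open>e'\<close> the vertices listed in the order of \<open>e\<close>.
\<close>

definition sorting_sign :: "('a \<Rightarrow> real) \<Rightarrow> ('a \<Rightarrow> real) \<Rightarrow> 'a set \<Rightarrow> int" where
  "sorting_sign e e' \<sigma> = (- 1) ^ card (inversions e e' \<sigma>)"

text \<open>
  The signs are natural because the structure maps identify the inversions of \<open>\<sigma>\<close> with those of its
  image.
\<close>

lemma regular_system_map_simplicial:
  assumes e: "persistence_embedding \<Omega> X \<phi> e" and e': "persistence_embedding \<Omega> X' \<phi>' e'"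
    and K: "persistence_simplicial_complex \<Omega> X \<phi> K" and K': "persistence_simplicial_complex \<Omega> X' \<phi>' K'"
    and f: "persistence_injective_simplicial_map \<Omega> X \<phi> K X' \<phi>' K' f"
  shows "regular_system_map \<Omega> (simplicial_system X \<phi> e K) (simplicial_system X' \<phi>' e' K')
    (\<lambda>t. image (f t)) (\<lambda>t. sorting_sign (e t) (e' t \<circ> f t))"
proof (intro regular_system_map.intro regular_system_map_axioms.intro regular_system_simplicial e e' K K')
  let ?S = "simplicial_system X \<phi> e K" and ?S' = "simplicial_system X' \<phi>' e' K'"
  have Kt: "abstract_simplicial_complex (topspace (X t)) (K t)"
    and Kt': "abstract_simplicial_complex (topspace (X' t)) (K' t)"
    and ft: "injective_simplicial_map (topspace (X t)) (topspace (X' t)) (K t) (K' t) (f t)"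
    if "t \<in> \<Omega>" for t
    using that K K' f by (auto simp: persistence_simplicial_complex_def persistence_injective_simplicial_map_def)
  show "based_map ?S t ?S' t (image (f t))
      (sorting_sign (e t) (e' t \<circ> f t))" if t: "t \<in> \<Omega>" for t
  proof (rule based_map_simplicial[where K = K and r = t and K' = K' and s = t and e = e and e' = e',
        OF Kt[OF t] Kt'[OF t] _ _ ft[OF t]])
    show "inj_on (e t) (topspace (X t))" "inj_on (e' t) (topspace (X' t))"
      using t e e' by (auto intro: persistence_embedding_inj)
    fix \<sigma> assume \<sigma>: "\<sigma> \<in> K t"
    show "sorting_sign (e t) (e' t \<circ> f t) \<sigma> * sorting_sign (e t) (e' t \<circ> f t) \<sigma> = 1"
      by (simp add: sorting_sign_def flip: power_mult_distrib)
    fix v assume v: "v \<in> \<sigma>"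
    have fin: "finite \<sigma>" and sub: "\<sigma> \<subseteq> topspace (X t)"
      using abstract_simplicial_complexD[OF Kt[OF t] \<sigma>] by auto
    have inj_f: "inj_on (f t) \<sigma>"
      by (rule injective_simplicial_map_inj(1)[OF Kt[OF t] ft[OF t] \<sigma>])
    have "f t ` \<sigma> \<in> K' t"
      using ft[OF t] \<sigma> by (simp add: injective_simplicial_map_def simplicial_map_def)
    then have "f t ` \<sigma> \<subseteq> topspace (X' t)"
      by (rule abstract_simplicial_complexD(3)[OF Kt'[OF t]])
    then have "inj_on (e' t \<circ> f t) \<sigma>"
      using persistence_embedding_inj[OF e' t] inj_f by (auto intro: comp_inj_on inj_on_subset)
    moreover have "inj_on (e t) \<sigma>"
      using persistence_embedding_inj[OF e t] sub by (rule inj_on_subset)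
    moreover have "position (e' t) (f t ` \<sigma>) (f t v) = position (e' t \<circ> f t) \<sigma> v"
    proof -
      have "{w \<in> f t ` \<sigma>. e' t w < e' t (f t v)} = f t ` {w \<in> \<sigma>. (e' t \<circ> f t) w < (e' t \<circ> f t) v}"
        by auto
      moreover have "inj_on (f t) {w \<in> \<sigma>. (e' t \<circ> f t) w < (e' t \<circ> f t) v}"
        by (rule inj_on_subset[OF inj_f]) auto
      ultimately show ?thesis
        by (simp add: position_def card_image)
    qed
    ultimately show "sorting_sign (e t) (e' t \<circ> f t) \<sigma> * (- 1) ^ position (e' t) (f t ` \<sigma>) (f t v) =
        (- 1) ^ position (e t) \<sigma> v * sorting_sign (e t) (e' t \<circ> f t) (\<sigma> - {v})"
      using inversion_sign_face[OF fin v] by (simp add: sorting_sign_def)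
  qed
  show "is_complex ?S' t (image (f t) ` A)"
    if t: "t \<in> \<Omega>" and A: "A \<subseteq> simplices ?S t"
      "is_complex ?S t A" for t A
  proof -
    have "image (f t) ` A \<subseteq> K' t"
      using ft[OF t] A by (auto simp: injective_simplicial_map_def simplicial_map_def simplicial_system_def)
    moreover have "hypergraph (topspace (X' t)) (K' t)"
      using Kt'[OF t] by (simp add: abstract_simplicial_complex_def)
    ultimately have "hypergraph (topspace (X' t)) (image (f t) ` A)"
      unfolding hypergraph_def by (meson subsetD)
    then show ?thesis
      using A by (auto simp: simplicial_system_def intro: abstract_simplicial_complex_image)
  qed
  fix r s \<sigma>
  assume rs: "r \<in> \<Omega>" "s \<in> \<Omega>" "r \<le> s" and "\<sigma> \<in> simplices ?S r"
  then have \<sigma>: "\<sigma> \<in> K r"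
    by (simp add: simplicial_system_def)
  have sub: "v \<in> topspace (X r)" and f_top: "f r v \<in> topspace (X' r)"
    and nat: "\<phi>' r s (f r v) = f s (\<phi> r s v)" if "v \<in> \<sigma>" for v
  proof -
    show top: "v \<in> topspace (X r)"
      using abstract_simplicial_complexD(3)[OF Kt[OF rs(1)] \<sigma>] that by blast
    show "f r v \<in> topspace (X' r)"
      using top ft[OF rs(1)] by (auto simp: injective_simplicial_map_def simplicial_map_def)
    show "\<phi>' r s (f r v) = f s (\<phi> r s v)"
      using f rs abstract_simplicial_complexD(4)[OF Kt[OF rs(1)] \<sigma> that] by (simp add: persistence_injective_simplicial_map_def)
  qed
  show "transition ?S' r s (f r ` \<sigma>)
      = f s ` transition ?S r s \<sigma>"
    using nat by (simp add: simplicial_system_def image_image)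
  have e_\<phi>: "e s (\<phi> r s v) = e r v" and e'_\<phi>: "(e' s \<circ> f s) (\<phi> r s v) = (e' r \<circ> f r) v" if "v \<in> \<sigma>" for v
  proof -
    show "e s (\<phi> r s v) = e r v"
      using e rs sub[OF that] by (simp add: persistence_embedding_def)
    show "(e' s \<circ> f s) (\<phi> r s v) = (e' r \<circ> f r) v"
      using e' rs f_top[OF that] nat[OF that, symmetric] by (simp add: persistence_embedding_def)
  qed
  have "inversions (e s) (e' s \<circ> f s) (\<phi> r s ` \<sigma>)
      = map_prod (\<phi> r s) (\<phi> r s) ` inversions (e r) (e' r \<circ> f r) \<sigma>"
    using e_\<phi> e'_\<phi> by (auto simp: inversions_def image_iff)
  moreover have "inj_on (\<phi> r s) \<sigma>"
  proof (rule inj_onI)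
    fix v w assume "v \<in> \<sigma>" "w \<in> \<sigma>" "\<phi> r s v = \<phi> r s w"
    then show "v = w"
      using e_\<phi> sub persistence_embedding_inj[OF e rs(1)] by (metis inj_onD)
  qed
  then have "inj_on (map_prod (\<phi> r s) (\<phi> r s)) (inversions (e r) (e' r \<circ> f r) \<sigma>)"
    by (auto simp: inj_on_def inversions_def)
  ultimately show "sorting_sign (e s) (e' s \<circ> f s) (transition ?S r s \<sigma>)
      = sorting_sign (e r) (e' r \<circ> f r) \<sigma>"
    by (simp add: sorting_sign_def simplicial_system_def card_image)
qed

theorem theorem1p2:
  fixes \<Omega> :: "(ereal ^ 'n) set"
    and X :: "ereal ^ 'n \<Rightarrow> 'a topology"
    and \<phi> :: "ereal ^ 'n \<Rightarrow> ereal ^ 'n \<Rightarrow> 'a \<Rightarrow> 'a"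
    and X' :: "ereal ^ 'n \<Rightarrow> 'b topology"
    and \<phi>' :: "ereal ^ 'n \<Rightarrow> ereal ^ 'n \<Rightarrow> 'b \<Rightarrow> 'b"
  assumes "persistence_space \<Omega> X \<phi>"
    and "persistence_space \<Omega> X' \<phi>'"
  shows
    "let \<F> = (Field_coeffs :: 'f::field coefficients); \<Z> = (Integer_coeffs :: 'f coefficients) in
     (\<forall>K. persistence_directed_complex \<Omega> X \<phi> K \<longrightarrow>
       (let S = directed_system X \<phi> K in
          Cr \<F> \<Omega> S \<subseteq> GACr \<F> \<Omega> S \<and> GACr \<F> \<Omega> S \<subseteq> CACr \<F> \<Omega> S \<and> CACr \<F> \<Omega> S \<subseteq> AACr \<F> \<Omega> S \<and>
          Cr \<Z> \<Omega> S \<subseteq> GACr \<Z> \<Omega> S \<and> GACr \<Z> \<Omega> S \<subseteq> CACr \<Z> \<Omega> S \<and> CACr \<Z> \<Omega> S \<subseteq> AACr \<Z> \<Omega> S \<and>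
          Cr \<F> \<Omega> S \<subseteq> Cr \<Z> \<Omega> S \<and> GACr \<F> \<Omega> S \<subseteq> GACr \<Z> \<Omega> S \<and>
          CACr \<F> \<Omega> S \<subseteq> CACr \<Z> \<Omega> S \<and> AACr \<F> \<Omega> S \<subseteq> AACr \<Z> \<Omega> S)) \<and>
     (\<forall>e K. persistence_embedding \<Omega> X \<phi> e \<and> persistence_simplicial_complex \<Omega> X \<phi> K \<longrightarrow>
       (let S = simplicial_system X \<phi> e K in
          Cr \<F> \<Omega> S \<subseteq> GACr \<F> \<Omega> S \<and> GACr \<F> \<Omega> S \<subseteq> CACr \<F> \<Omega> S \<and> CACr \<F> \<Omega> S \<subseteq> AACr \<F> \<Omega> S \<and>
          Cr \<Z> \<Omega> S \<subseteq> GACr \<Z> \<Omega> S \<and> GACr \<Z> \<Omega> S \<subseteq> CACr \<Z> \<Omega> S \<and> CACr \<Z> \<Omega> S \<subseteq> AACr \<Z> \<Omega> S \<and>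
          Cr \<F> \<Omega> S \<subseteq> Cr \<Z> \<Omega> S \<and> GACr \<F> \<Omega> S \<subseteq> GACr \<Z> \<Omega> S \<and>
          CACr \<F> \<Omega> S \<subseteq> CACr \<Z> \<Omega> S \<and> AACr \<F> \<Omega> S \<subseteq> AACr \<Z> \<Omega> S)) \<and>
     (\<forall>K K' f. persistence_directed_complex \<Omega> X \<phi> K \<and> persistence_directed_complex \<Omega> X' \<phi>' K' \<and>
         persistence_directed_map \<Omega> X \<phi> K X' \<phi>' K' f \<longrightarrow>
       (let S = directed_system X \<phi> K; S' = directed_system X' \<phi>' K'; F = (\<lambda>t. map (f t)) in
          GACr \<F> \<Omega> S \<subseteq> GACr \<Z> \<Omega> S \<and>
          GACr \<F> \<Omega> S' \<union> Cr_map \<F> \<Omega> S S' F \<subseteq> GACr \<Z> \<Omega> S' \<union> Cr_map \<Z> \<Omega> S S' F \<and>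
          GACr \<F> \<Omega> S \<subseteq> GACr \<F> \<Omega> S' \<union> Cr_map \<F> \<Omega> S S' F \<and>
          GACr \<Z> \<Omega> S \<subseteq> GACr \<Z> \<Omega> S' \<union> Cr_map \<Z> \<Omega> S S' F)) \<and>
     (\<forall>e e' K K' f. persistence_embedding \<Omega> X \<phi> e \<and> persistence_embedding \<Omega> X' \<phi>' e' \<and>
         persistence_simplicial_complex \<Omega> X \<phi> K \<and> persistence_simplicial_complex \<Omega> X' \<phi>' K' \<and>
         persistence_injective_simplicial_map \<Omega> X \<phi> K X' \<phi>' K' f \<longrightarrow>
       (let S = simplicial_system X \<phi> e K; S' = simplicial_system X' \<phi>' e' K';
            F = (\<lambda>t. image (f t)) in
          GACr \<F> \<Omega> S \<subseteq> GACr \<Z> \<Omega> S \<and>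
          GACr \<F> \<Omega> S' \<union> Cr_map \<F> \<Omega> S S' F \<subseteq> GACr \<Z> \<Omega> S' \<union> Cr_map \<Z> \<Omega> S S' F \<and>
          GACr \<F> \<Omega> S \<subseteq> GACr \<F> \<Omega> S' \<union> Cr_map \<F> \<Omega> S S' F \<and>
          GACr \<Z> \<Omega> S \<subseteq> GACr \<Z> \<Omega> S' \<union> Cr_map \<Z> \<Omega> S S' F))"
proof -
  let ?F = "Field_coeffs :: 'f coefficients" and ?Z = "Integer_coeffs :: 'f coefficients"
  note system = regular_system.critical_point_inclusions[where c = ?F]
      regular_system.critical_point_inclusions[where c = ?Z]
      regular_system.critical_point_coefficients[where c = ?F]
    and system_map = regular_system.critical_point_coefficients(2)[where c = ?F,
        OF regular_system_map.axioms(1)]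
      regular_system_map.critical_point_map_inclusions(2)[where c = ?F]
      regular_system_map.critical_point_map_inclusions(1)[where c = ?F]
      regular_system_map.critical_point_map_inclusions(1)[where c = ?Z]
  show ?thesis
    unfolding Let_def
    by (intro conjI allI impI; (elim conjE)?;
      (rule system system_map;
       (rule regular_system_directed regular_system_simplicial
          regular_system_map_directed regular_system_map_simplicial; assumption)))
qed

end
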